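(* Let $p\ge1$ and let $f,g\in\mathbb{C}[x_1,\dots,x_p]$ be polynomials, where $f$ satisfies Mahler's Hypothesis. Then: (1) (Raabe formula) For every $s\in\mathbb{C}$ outside the set of possible poles of $Z(s;f,g)$, $$Z(s;f,g)=\int_{t\in[0,1]^p}\zeta(s;f_t,g_t)\,dt,$$ where $f_t(x):=f(t+x)$, $g_t(x):=g(t+x)$ and $dt$ is Lebesgue measure on $\mathbb{R}^p$. (2) For each fixed integer $N\ge0$, the maps $a\mapsto\zeta(-N;f_a,g_a)$ and $a\mapsto Z(-N;f_a,g_a)$ are polynomials in $a=(a_1,\dots,a_p)\in[0,\infty)^p$ of degree at most $N\deg(f)+\deg(g)+p$. (3) Let $N\ge 0$ be an integer. If the polynomial $Z(-N;f_a,g_a)$ is written as a (finite) sum of monomials $$Z(-N;f_a,g_a)=\sum_L c_L\,a^L,\qquad a^L:=\prod_{i=1}^p a_i^{L_i},\quad c_L=c_L(N;f,g)\in\mathbb{C},$$ with $L=(L_1,\dots,L_p)$ ranging over multi-indices of non-negative integers, then $$\zeta(-N;f,g)=\sum_L c_L\,B_L,\qquad B_L:=\prod_{i=1}^p B_{L_i},$$ and, more generally, for all $a\in[0,\infty)^p$, $$\zeta(-N;f_a,g_a)=\sum_L c_L\,B_L(a),\qquad B_L(a):=\prod_{i=1}^p B_{L_i}(a_i).$$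
   Context: Mahler's Hypothesis for $f\in\mathbb{C}[x_1,\dots,x_p]$: $f$ is non-constant, $f(x)\neq0$ for all $x\in[0,\infty)^p$, and the top-degree homogeneous part $f_{\mathrm{top}}$ of $f$ satisfies $f_{\mathrm{top}}(x)\ne0$ for all $x\in[0,\infty)^p\setminus\{0\}$. For $a\in[0,\infty)^p$ and a polynomial $h$, the shifted polynomial is $h_a(x):=h(x+a)$; if $f$ satisfies Mahler's Hypothesis so does $f_a$, with the same degree and top-degree part. Here $\deg$ is the total degree. For $f$ satisfying Mahler's Hypothesis and any polynomial $g$, set for $\mathrm{Re}(s)>(\deg(g)+p)/\deg(f)$ $$Z(s;f,g):=\int_{[0,\infty)^p}g(x)f(x)^{-s}\,dx,\qquad \zeta(s;f,g):=\sum_{k_1=0}^\infty\cdots\sum_{k_p=0}^\infty g(k_1,\dots,k_p)f(k_1,\dots,k_p)^{-s},$$ where $f(x)^{-s}:=e^{-s\log f(x)}$ for a fixed continuous branch of $\log f$ on $[0,\infty)^p$; for the shifts $f_a$ the branch $\log f_a(x):=\log f(x+a)$ is used. (Values at integers $s$ do not depend on the choice of continuous branch.) By a known theorem of Mahler, both converge absolutely in that half-plane and extend to meromorphic functions of $s\in\mathbb{C}$, regular at all $s=0,-1,-2,\dots$, with at most simple poles, all lying among the numbers $s=(\deg(g)+p-\ell)/\deg(f)$, $\ell\ge0$ an integer. The "set of possible poles" is the set of numbers of this form that are not non-positive integers. All values of $Z$ and $\zeta$ are those of the meromorphic continuations. Bernoulli polynomials $B_j(t)$ are defined by $B_0(t)=1$,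 $\frac{dB_j}{dt}=jB_{j-1}(t)$, $\int_0^1B_j(t)\,dt=0$ for $j\ge1$; Bernoulli numbers are $B_j:=B_j(0)$. *)

theory Defs
  imports
    "HOL-Complex_Analysis.Complex_Analysis"
    "HOL-Library.Poly_Mapping"
    "HOL-Library.Nonpos_Ints"
    "HOL-Computational_Algebra.Polynomial"
begin

unbundle no fps_syntax

text \<open>
  A polynomial in the variables \<open>x $ i\<close>, indexed by a finite type \<open>'n\<close> with \<open>p = CARD('n)\<close>, maps
  exponent vectors to coefficients; \<^typ>\<open>('n \<Rightarrow>\<^sub>0 nat) \<Rightarrow>\<^sub>0 complex\<close> carries the convolution product.
\<close>

type_synonym 'n mpoly = "('n \<Rightarrow>\<^sub>0 nat) \<Rightarrow>\<^sub>0 complex"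

definition mconst :: "complex \<Rightarrow> 'n mpoly" where
  "mconst c = Poly_Mapping.single 0 c"

definition mvar :: "'n \<Rightarrow> 'n mpoly" where
  "mvar i = Poly_Mapping.single (Poly_Mapping.single i 1) 1"

definition meval :: "'n::finite mpoly \<Rightarrow> real^'n \<Rightarrow> complex" where
  "meval P x = (\<Sum>m\<in>Poly_Mapping.keys P. Poly_Mapping.lookup P m * (\<Prod>i\<in>UNIV. of_real (x $ i) ^ Poly_Mapping.lookup m i))"

definition mono_deg :: "('n::finite \<Rightarrow>\<^sub>0 nat) \<Rightarrow> nat" where
  "mono_deg m = (\<Sum>i\<in>UNIV. Poly_Mapping.lookup m i)"

text \<open>The total degree; the zero polynomial gets degree 0.\<close>

definition total_deg :: "'n::finite mpoly \<Rightarrow> nat" where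
  "total_deg P = Max (insert 0 (mono_deg ` Poly_Mapping.keys P))"

definition top_part :: "'n::finite mpoly \<Rightarrow> 'n mpoly" where
  "top_part P = (\<Sum>m\<in>{m\<in>Poly_Mapping.keys P. mono_deg m = total_deg P}. Poly_Mapping.single m (Poly_Mapping.lookup P m))"

definition mshift :: "real^'n \<Rightarrow> 'n::finite mpoly \<Rightarrow> 'n mpoly" where
  "mshift a P =
     (\<Sum>m\<in>Poly_Mapping.keys P. mconst (Poly_Mapping.lookup P m) * (\<Prod>i\<in>UNIV. (mvar i + mconst (of_real (a $ i))) ^ Poly_Mapping.lookup m i))"

lemma meval_superset:
  assumes "finite A" "Poly_Mapping.keys P \<subseteq> A"
  shows "meval P x = (\<Sum>m\<in>A. Poly_Mapping.lookup P m * (\<Prod>i\<in>UNIV. of_real (x $ i) ^ Poly_Mapping.lookup m i))"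
  unfolding meval_def using assms
  by (intro sum.mono_neutral_left) (auto simp: in_keys_iff)

lemma meval_zero [simp]: "meval 0 x = 0"
  by (simp add: meval_def)

lemma meval_single [simp]:
  "meval (Poly_Mapping.single m c) x = c * (\<Prod>i\<in>UNIV. of_real (x $ i) ^ Poly_Mapping.lookup m i)"
  by (subst meval_superset[of "{m}"]) auto

lemma meval_add [simp]: "meval (P + Q) x = meval P x + meval Q x"
proof -
  let ?A = "Poly_Mapping.keys P \<union> Poly_Mapping.keys Q"
  have "Poly_Mapping.keys (P + Q) \<subseteq> ?A" by (rule keys_add)
  then show ?thesis
    by (subst (1 2 3) meval_superset[of ?A]) (auto simp: lookup_add algebra_simps sum.distrib)
qed

lemma meval_sum [simp]: "meval (sum F A) x = (\<Sum>a\<in>A. meval (F a) x)"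
  by (induction A rule: infinite_finite_induct) auto

lemma mpoly_eq_sum_single:
  "(P :: 'n mpoly) = (\<Sum>m\<in>Poly_Mapping.keys P. Poly_Mapping.single m (Poly_Mapping.lookup P m))"
proof (rule poly_mapping_eqI)
  fix k
  have "Poly_Mapping.lookup (\<Sum>m\<in>Poly_Mapping.keys P. Poly_Mapping.single m (Poly_Mapping.lookup P m)) k
      = (\<Sum>m\<in>Poly_Mapping.keys P. if k = m then Poly_Mapping.lookup P k else 0)"
    unfolding lookup_sum by (intro sum.cong) (auto simp: lookup_single when_def)
  also have "\<dots> = Poly_Mapping.lookup P k"
    by (auto simp: in_keys_iff)
  finally show "Poly_Mapping.lookup P k = Poly_Mapping.lookup (\<Sum>m\<in>Poly_Mapping.keys P. Poly_Mapping.single m (Poly_Mapping.lookup P m)) k" ..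
qed

lemma meval_mult [simp]: "meval (P * Q) x = meval P x * meval Q x"
proof -
  have "P * Q = (\<Sum>m\<in>Poly_Mapping.keys P. \<Sum>n\<in>Poly_Mapping.keys Q. Poly_Mapping.single (m + n) (Poly_Mapping.lookup P m * Poly_Mapping.lookup Q n))"
    by (subst mpoly_eq_sum_single[of P], subst mpoly_eq_sum_single[of Q])
       (simp only: sum_product mult_single)
  then have "meval (P * Q) x = (\<Sum>m\<in>Poly_Mapping.keys P. \<Sum>n\<in>Poly_Mapping.keys Q.
      (Poly_Mapping.lookup P m * (\<Prod>i\<in>UNIV. of_real (x $ i) ^ Poly_Mapping.lookup m i)) *
      (Poly_Mapping.lookup Q n * (\<Prod>i\<in>UNIV. of_real (x $ i) ^ Poly_Mapping.lookup n i)))"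
    by (simp add: lookup_add power_add prod.distrib mult_ac)
  also have "\<dots> = meval P x * meval Q x"
    by (simp add: meval_def sum_product)
  finally show ?thesis .
qed

lemma meval_mconst [simp]: "meval (mconst c) x = c"
  by (simp add: mconst_def)

lemma meval_one [simp]: "meval 1 x = 1"
  using meval_mconst[of 1 x] by (simp add: mconst_def)

lemma meval_mvar [simp]: "meval (mvar i) x = of_real (x $ i)"
proof -
  have "(\<Prod>j\<in>UNIV. complex_of_real (x $ j) ^ (1 when i = j)) =
        (\<Prod>j\<in>UNIV. if i = j then complex_of_real (x $ j) else 1)"
    by (intro prod.cong) (auto simp: when_def)
  then show ?thesis by (simp add: mvar_def lookup_single)
qed

lemma meval_power [simp]: "meval (P ^ n) x = meval P x ^ n"
  by (induction n) auto

lemma meval_prod [simp]: "meval (prod F A) x = (\<Prod>a\<in>A. meval (F a) x)"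
  by (induction A rule: infinite_finite_induct) auto

lemma meval_mshift: "meval (mshift a P) x = meval P (a + x)"
  by (simp add: mshift_def meval_def[of P] add.commute)

definition orthant :: "(real^'n) set" where
  "orthant = {x. \<forall>i. 0 \<le> x $ i}"

definition mahler :: "'n::finite mpoly \<Rightarrow> bool" where
  "mahler f \<longleftrightarrow> (\<forall>c. f \<noteq> mconst c) \<and> (\<forall>x\<in>orthant. meval f x \<noteq> 0) \<and>
     (\<forall>x\<in>orthant - {0}. meval (top_part f) x \<noteq> 0)"

definition log_branch :: "'n::finite mpoly \<Rightarrow> (real^'n \<Rightarrow> complex) \<Rightarrow> bool" where
  "log_branch f lf \<longleftrightarrow> continuous_on orthant lf \<and> (\<forall>x\<in>orthant. exp (lf x) = meval f x)"

text \<open>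
  The meromorphic continuation to the plane of a function given on \<open>Re s > \<sigma>\<close>. Asking for
  \<open>nicely_meromorphic_on\<close> removes the removable singularities and sets the value at poles to 0,
  so that the continuation is unique as a function.
\<close>

definition mero_cont :: "real \<Rightarrow> (complex \<Rightarrow> complex) \<Rightarrow> complex \<Rightarrow> complex" where
  "mero_cont \<sigma> F = (THE h. h nicely_meromorphic_on UNIV \<and> (\<forall>s. Re s > \<sigma> \<longrightarrow> h s = F s))"

definition abscissa :: "'n::finite mpoly \<Rightarrow> 'n mpoly \<Rightarrow> real" where
  "abscissa f g = real (total_deg g + CARD('n)) / real (total_deg f)"

text \<open>The argument \<open>lf\<close> is the chosen branch of \<open>log f\<close>, so that \<open>exp (- s * lf x)\<close> is \<open>f(x)\<^sup>-\<^sup>s\<close>.\<close>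

definition Zint ::
  "'n::finite mpoly \<Rightarrow> (real^'n \<Rightarrow> complex) \<Rightarrow> 'n mpoly \<Rightarrow> complex \<Rightarrow> complex" where
  "Zint f lf g = mero_cont (abscissa f g)
     (\<lambda>s. LINT x:orthant|lborel. meval g x * exp (- s * lf x))"

definition Zsum ::
  "'n::finite mpoly \<Rightarrow> (real^'n \<Rightarrow> complex) \<Rightarrow> 'n mpoly \<Rightarrow> complex \<Rightarrow> complex" where
  "Zsum f lf g = mero_cont (abscissa f g)
     (\<lambda>s. \<Sum>\<^sub>\<infinity>k\<in>(UNIV :: (nat^'n) set).
        meval g (\<chi> i. real (k $ i)) * exp (- s * lf (\<chi> i. real (k $ i))))"

definition Zint_shift ::
  "'n::finite mpoly \<Rightarrow> (real^'n \<Rightarrow> complex) \<Rightarrow> 'n mpoly \<Rightarrow> real^'n \<Rightarrow> complex \<Rightarrow> complex" where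
  "Zint_shift f lf g a = Zint (mshift a f) (\<lambda>x. lf (a + x)) (mshift a g)"

definition Zsum_shift ::
  "'n::finite mpoly \<Rightarrow> (real^'n \<Rightarrow> complex) \<Rightarrow> 'n mpoly \<Rightarrow> real^'n \<Rightarrow> complex \<Rightarrow> complex" where
  "Zsum_shift f lf g a = Zsum (mshift a f) (\<lambda>x. lf (a + x)) (mshift a g)"

definition possible_poles :: "'n::finite mpoly \<Rightarrow> 'n mpoly \<Rightarrow> complex set" where
  "possible_poles f g =
     {s. \<exists>l::nat. s = of_real ((real (total_deg g) + real CARD('n) - real l) / real (total_deg f))}
       - \<int>\<^sub>\<le>\<^sub>0"

lemma mero_cont_eqI:
  assumes h: "h nicely_meromorphic_on UNIV" and eq: "\<And>s. Re s > \<sigma> \<Longrightarrow> h s = F s"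
  shows "mero_cont \<sigma> F = h"
  unfolding mero_cont_def
proof (rule the_equality)
  fix k assume k: "k nicely_meromorphic_on UNIV \<and> (\<forall>s. Re s > \<sigma> \<longrightarrow> k s = F s)"
  have mero: "(\<lambda>s. k s - h s) meromorphic_on UNIV"
    using h k by (intro meromorphic_intros) (auto simp: nicely_meromorphic_on_def)
  have not_avoid: "\<not> (\<forall>\<^sub>\<approx>s\<in>UNIV. k s - h s \<noteq> 0)"
  proof
    assume "\<forall>\<^sub>\<approx>s\<in>UNIV. k s - h s \<noteq> 0"
    then have "\<forall>\<^sub>F s in at (of_real (\<sigma> + 1)). k s - h s \<noteq> 0"
      by (simp add: eventually_cosparse_open_eq)
    moreover have "\<forall>\<^sub>F s in at (of_real (\<sigma> + 1)). s \<in> {s. Re s > \<sigma>}"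
      by (intro eventually_at_in_open') (auto simp: open_halfspace_Re_gt)
    ultimately have "\<forall>\<^sub>F s in at (complex_of_real (\<sigma> + 1)). False"
      by eventually_elim (use eq k in auto)
    then show False
      by (simp add: eventually_False)
  qed
  have "\<forall>\<^sub>\<approx>s\<in>UNIV. k s - h s = 0"
    using meromorphic_imp_constant_or_avoid[OF mero, of 0] not_avoid by auto
  then have ev: "\<forall>\<^sub>F s in at z. k s = h s" for z
    by (simp add: eventually_cosparse_open_eq)
  show "k = h"
  proof
    fix z
    have "is_pole k z \<longleftrightarrow> is_pole h z"
      by (intro is_pole_cong ev refl)
    moreover have "(k \<longlongrightarrow> c) (at z) \<longleftrightarrow> (h \<longlongrightarrow> c) (at z)" for c
      by (intro tendsto_cong ev)
    ultimately show "k z = h z"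
      using h k unfolding nicely_meromorphic_on_def
      by (metis LIM_unique UNIV_I not_tendsto_and_filterlim_at_infinity at_neq_bot is_pole_def)
  qed
qed (use assms in auto)

primrec bernpoly :: "nat \<Rightarrow> real poly" where
  "bernpoly 0 = 1"
| "bernpoly (Suc j) =
     (THE q. pderiv q = of_nat (Suc j) * bernpoly j \<and> integral {0..1} (poly q) = 0)"

definition bernnum :: "nat \<Rightarrow> real" where
  "bernnum j = poly (bernpoly j) 0"

lemma ex1_normalised_antiderivative:
  "\<exists>!q. pderiv q = (p :: real poly) \<and> integral {0..1} (poly q) = 0"
proof -
  have int: "poly q integrable_on {0..1}" for q :: "real poly"
    by (intro integrable_continuous_interval continuous_intros)
  define Q where "Q = (\<Sum>i\<le>degree p. monom (coeff p i / real (Suc i)) (Suc i))"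
  have "pderiv Q = (\<Sum>i\<le>degree p. monom (coeff p i) i)"
    unfolding Q_def higher_pderiv_sum [of 1, simplified]
    by (intro sum.cong refl) (simp add: pderiv_monom del: of_nat_Suc)
  then have Q: "pderiv Q = p"
    by (simp add: poly_as_sum_of_monoms)
  define q where "q = Q - [:integral {0..1} (poly Q):]"
  have "integral {0..1} (poly q) =
      integral {0..1} (poly Q) - integral {0..1} (\<lambda>t::real. integral {0..1} (poly Q))"
    using int[of Q]
    by (subst Henstock_Kurzweil_Integration.integral_diff [symmetric])
       (auto simp: q_def intro!: Henstock_Kurzweil_Integration.integral_cong)
  then have ex: "pderiv q = p \<and> integral {0..1} (poly q) = 0"
    using Q by (simp add: q_def pderiv_diff)
  show ?thesis
  proof (rule ex1I[of _ q], fact ex)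
    fix r assume r: "pderiv r = p \<and> integral {0..1} (poly r) = 0"
    then have "pderiv (r - q) = 0"
      using ex by (simp add: pderiv_diff)
    then obtain c where c: "r - q = [:c:]"
      using pderiv_iszero by blast
    have "integral {0..1} (\<lambda>t. poly r t - poly q t) = 0"
      using r ex int by (subst Henstock_Kurzweil_Integration.integral_diff) auto
    moreover have "poly r t - poly q t = c" for t
      using arg_cong[OF c, of "\<lambda>u. poly u t"] by simp
    ultimately have "c = 0" by simp
    with c show "r = q" by simp
  qed
qed

lemma bernpoly_Suc:
  "pderiv (bernpoly (Suc j)) = of_nat (Suc j) * bernpoly j"
  "integral {0..1} (poly (bernpoly (Suc j))) = 0"
  using theI'[OF ex1_normalised_antiderivative[of "of_nat (Suc j) * bernpoly j"]]
  by simp_all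

end

theory Submission
  imports Defs
begin

unbundle no Formal_Power_Series.fps_syntax

text \<open>
  Write \<open>p = CARD('n)\<close> and \<open>d = deg f\<close>. Integrating the divergence of the field \<open>g f\<^sup>-\<^sup>s x\<close> over the orthant
  and using Euler's identity for \<open>f\<close> expresses \<open>(d s - deg g - p) Z(s; f, g)\<close> through
  \<open>Z\<close>-integrals whose abscissa of convergence is smaller by \<open>1/d\<close>, which continues \<open>Z\<close>. A first order Taylor
  expansion inside Raabe's formula gives \<open>\<zeta>(s; f, g) = Z(s; f, g)\<close> minus averages of shifted zeta functions
  of the partial derivatives of \<open>g f\<^sup>-\<^sup>s\<close>, again with smaller abscissa, which continues \<open>\<zeta>\<close>.
  Both recursions are uniform in the shift \<open>a\<close>, so Raabe's formula and the formula for the gradient in \<open>a\<close>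
  hold for the continuations. Each derivative in \<open>a\<close> produces the factor \<open>d s - deg g - p\<close>
  and raises it by 1, so at \<open>s = -N\<close> it vanishes after \<open>N d + deg g + p\<close> steps: the value is a polynomial in \<open>a\<close>.
  Raabe's formula says that averaging over the unit cube maps the polynomial of \<open>\<zeta>\<close> to that of \<open>Z\<close>.
  Averaging is injective on polynomials and maps \<open>B\<^sub>L(a)\<close> to \<open>a\<^sup>L\<close>.
\<close>

section \<open>Polynomial functions\<close>

text \<open>\<open>mero_cont\<close> is a definite description, so a continuation has to be
  exhibited before any of its values can be discussed; and averaging continued values over
  \<open>t\<close> makes sense only if the continuation is continuous in the shift. Hence every
  construction stays inside a class of families that are jointly continuous in (a, s) and
  holomorphic in s. The recursion for Z would divide by d s - deg g - p, and every further step by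
  the successor of the previous divisor; a reciprocal Gamma factor clears all these denominators at
  once. Differentiation creates two kinds of term, of degree D - 1 at s and of degree D + d - 1 at s
  + 1; both raise the divisor by the same amount, so one normalisation serves both. Degree bounds D
  are carried instead of exact degrees, because a derivative can lose more than one degree. Z and
  zeta receive the same normalisation, independent of the shift; undoing it is multiplication by a
  single number, finite at s = -N because the two reciprocal Gamma functions involved both have a
  simple zero there.\<close>

text \<open>The degree bound is an integer, so that \<open>polyfun D h\<close> with \<open>D < 0\<close> forces \<open>h = 0\<close>.\<close>

definition polyfun :: "int \<Rightarrow> (real^'n::finite \<Rightarrow> complex) \<Rightarrow> bool" where
  "polyfun D h \<longleftrightarrow> (\<exists>P. h = meval P \<and> (\<forall>m\<in>Poly_Mapping.keys P. int (mono_deg m) \<le> D))"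

definition mon :: "('n::finite \<Rightarrow>\<^sub>0 nat) \<Rightarrow> real^'n \<Rightarrow> complex" where
  "mon m x = (\<Prod>i\<in>UNIV. of_real (x $ i) ^ Poly_Mapping.lookup m i)"

lemma meval_mon: "meval P x = (\<Sum>m\<in>Poly_Mapping.keys P. Poly_Mapping.lookup P m * mon m x)"
  by (simp add: meval_def mon_def)

lemma mono_deg_add: "mono_deg (m + n) = mono_deg m + mono_deg n"
  by (simp add: mono_deg_def lookup_add sum.distrib)

lemma polyfun_mono: "polyfun D h \<Longrightarrow> D \<le> E \<Longrightarrow> polyfun E h"
  unfolding polyfun_def by (elim exE conjE, intro exI conjI) (auto intro: order_trans)

lemma polyfun_zero [simp]: "polyfun D (\<lambda>_. 0)"
  unfolding polyfun_def by (rule exI[of _ 0]) (auto simp: fun_eq_iff)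

lemma polyfun_add:
  assumes "polyfun D h" "polyfun D k" shows "polyfun D (\<lambda>x. h x + k x)"
proof -
  from assms obtain P Q where "h = meval P" "\<forall>m\<in>Poly_Mapping.keys P. int (mono_deg m) \<le> D"
    "k = meval Q" "\<forall>m\<in>Poly_Mapping.keys Q. int (mono_deg m) \<le> D"
    unfolding polyfun_def by blast
  moreover have "Poly_Mapping.keys (P + Q) \<subseteq> Poly_Mapping.keys P \<union> Poly_Mapping.keys Q"
    by (rule keys_add)
  ultimately show ?thesis
    unfolding polyfun_def by (intro exI[of _ "P + Q"]) (auto simp: fun_eq_iff)
qed

lemma polyfun_mult:
  assumes "polyfun D h" "polyfun E k" shows "polyfun (D + E) (\<lambda>x. h x * k x)"
proof -
  from assms obtain P Q where PQ: "h = meval P" "\<forall>m\<in>Poly_Mapping.keys P. int (mono_deg m) \<le> D"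
    "k = meval Q" "\<forall>m\<in>Poly_Mapping.keys Q. int (mono_deg m) \<le> E"
    unfolding polyfun_def by blast
  have "int (mono_deg m) \<le> D + E" if m: "m \<in> Poly_Mapping.keys (P * Q)" for m
  proof -
    obtain m1 m2 where "m1 \<in> Poly_Mapping.keys P" "m2 \<in> Poly_Mapping.keys Q" "m = m1 + m2"
      using m keys_mult[of P Q] by blast
    with PQ show ?thesis by (force simp: mono_deg_add)
  qed
  with PQ show ?thesis
    unfolding polyfun_def by (intro exI[of _ "P * Q"]) (auto simp: fun_eq_iff)
qed

lemma polyfun_sum:
  "(\<And>i. i \<in> A \<Longrightarrow> polyfun D (h i)) \<Longrightarrow> polyfun D (\<lambda>x. \<Sum>i\<in>A. h i x)"
  by (induction A rule: infinite_finite_induct) (auto intro: polyfun_add)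

lemma polyfun_const: "D \<ge> 0 \<Longrightarrow> polyfun D (\<lambda>_. c)"
  unfolding polyfun_def
  by (rule exI[of _ "mconst c"]) (auto simp: fun_eq_iff mconst_def mono_deg_def split: if_splits)

lemma polyfun_cmult: "polyfun D h \<Longrightarrow> polyfun D (\<lambda>x. c * h x)"
  using polyfun_mult[OF polyfun_const[of 0 c]] by simp

lemma polyfun_uminus: "polyfun D h \<Longrightarrow> polyfun D (\<lambda>x. - h x)"
  using polyfun_cmult[of D h "-1"] by simp

lemma polyfun_coord: "polyfun 1 (\<lambda>x::real^'n::finite. of_real (x $ i))"
proof -
  have "mono_deg (Poly_Mapping.single i 1) = 1"
    by (simp add: mono_deg_def lookup_single when_def)
  then show ?thesis
    unfolding polyfun_def
    by (intro exI[of _ "mvar i"]) (auto simp: fun_eq_iff, simp add: mvar_def)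
qed

lemma polyfun_power: "polyfun D h \<Longrightarrow> polyfun (int n * D) (\<lambda>x. h x ^ n)"
proof (induction n)
  case (Suc n)
  then show ?case using polyfun_mult[of D h "int n * D" "\<lambda>x. h x ^ n"] by (simp add: algebra_simps)
qed (simp add: polyfun_const)

lemma polyfun_prod:
  "(\<And>i. i \<in> A \<Longrightarrow> polyfun (D i) (h i)) \<Longrightarrow> polyfun (\<Sum>i\<in>A. D i) (\<lambda>x. \<Prod>i\<in>A. h i x)"
  by (induction A rule: infinite_finite_induct) (auto intro: polyfun_mult polyfun_const)

lemma polyfun_mon: "polyfun (int (mono_deg m)) (mon m)"
proof -
  have "polyfun (\<Sum>i\<in>UNIV. int (Poly_Mapping.lookup m i) * 1) (\<lambda>x. \<Prod>i\<in>UNIV. of_real (x $ i) ^ Poly_Mapping.lookup m i)"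
    by (intro polyfun_prod polyfun_power polyfun_coord)
  then show ?thesis by (simp add: mono_deg_def mon_def[abs_def])
qed

text \<open>Induction over monomials within the degree bound. The \<open>add\<close> case keeps the
  bounds of both summands, which makes their continuity, and so their integrability, available in
  \<open>polyfun_integral_affine\<close>.\<close>

lemma polyfun_induct [consumes 1, case_names zero add mon]:
  assumes h: "polyfun D h"
    and zero: "Q (\<lambda>_. 0)"
    and add: "\<And>h k. polyfun D h \<Longrightarrow> polyfun D k \<Longrightarrow> Q h \<Longrightarrow> Q k \<Longrightarrow> Q (\<lambda>x. h x + k x)"
    and mon: "\<And>c m. int (mono_deg m) \<le> D \<Longrightarrow> Q (\<lambda>x. c * mon m x)"
  shows "Q h"
proof -
  obtain P where P: "h = meval P" "\<forall>m\<in>Poly_Mapping.keys P. int (mono_deg m) \<le> D"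
    using h unfolding polyfun_def by blast
  have "polyfun D (\<lambda>x. \<Sum>m\<in>A. Poly_Mapping.lookup P m * mon m x) \<and>
        Q (\<lambda>x. \<Sum>m\<in>A. Poly_Mapping.lookup P m * mon m x)"
    if "finite A" "A \<subseteq> Poly_Mapping.keys P" for A
    using that
  proof (induction A rule: finite_induct)
    case (insert m A)
    then have "int (mono_deg m) \<le> D" using P by auto
    with insert show ?case
      by (auto intro!: add mon polyfun_add polyfun_cmult polyfun_mono[OF polyfun_mon])
  qed (auto intro: zero)
  from this[of "Poly_Mapping.keys P"] show ?thesis
    by (simp add: P(1) meval_mon[abs_def])
qed

lemma polyfun_neg: "polyfun D h \<Longrightarrow> D < 0 \<Longrightarrow> h = (\<lambda>_. 0)"
  by (induction rule: polyfun_induct) auto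

lemma mono_deg_le_total_deg: "m \<in> Poly_Mapping.keys P \<Longrightarrow> mono_deg m \<le> total_deg P"
  unfolding total_deg_def by (intro Max_ge) auto

lemma polyfun_meval: "polyfun (int (total_deg P)) (meval P)"
  unfolding polyfun_def using mono_deg_le_total_deg by (intro exI[of _ P]) auto

lemma polyfun_imp_meval:
  assumes "polyfun (int n) h" obtains P where "h = meval P" "total_deg P \<le> n"
proof -
  obtain P where "h = meval P" "\<forall>m\<in>Poly_Mapping.keys P. int (mono_deg m) \<le> int n"
    using assms unfolding polyfun_def by blast
  then show ?thesis by (intro that[of P]) (auto simp: total_deg_def)
qed

lemma continuous_on_polyfun: "polyfun D h \<Longrightarrow> continuous_on A h"
  by (induction rule: polyfun_induct) (auto intro!: continuous_intros simp: mon_def)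

section \<open>Partial derivatives and the Euler operator\<close>

definition pd :: "'n::finite \<Rightarrow> (real^'n \<Rightarrow> complex) \<Rightarrow> real^'n \<Rightarrow> complex" where
  "pd i h x = frechet_derivative h (at x) (axis i 1)"

text \<open>The operator x . grad - D annihilates homogeneous polynomials of degree D, so it lowers
  a degree bound D by one. That drop is what makes both the asymptotics of \<open>lf\<close> and the
  recursion for Z work.\<close>

definition eul :: "real \<Rightarrow> (real^'n::finite \<Rightarrow> complex) \<Rightarrow> real^'n \<Rightarrow> complex" where
  "eul D h x = (\<Sum>i\<in>UNIV. of_real (x $ i) * pd i h x) - of_real D * h x"

text \<open>The truncated subtraction in the exponent is harmless: at exponent 0 the factor
  \<open>of_nat (Poly_Mapping.lookup m i)\<close> vanishes.\<close>

lemma mon_has_derivative: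
  fixes x :: "real^'n::finite"
  shows "(mon m has_derivative (\<lambda>v. \<Sum>i\<in>UNIV. of_real (v $ i) *
     (of_nat (Poly_Mapping.lookup m i) * (of_real (x $ i) ^ (Poly_Mapping.lookup m i - 1) *
       (\<Prod>j\<in>UNIV - {i}. of_real (x $ j) ^ Poly_Mapping.lookup m j))))) (at x)"
proof -
  have c: "((\<lambda>y::real^'n. complex_of_real (y $ i)) has_derivative (\<lambda>v. of_real (v $ i))) (at x)" for i
    by (intro bounded_linear_imp_has_derivative bounded_linear_compose[OF bounded_linear_of_real] bounded_linear_vec_nth)
  have "((\<lambda>y::real^'n. \<Prod>i\<in>UNIV. complex_of_real (y $ i) ^ Poly_Mapping.lookup m i) has_derivative
     (\<lambda>v. \<Sum>i\<in>UNIV. of_nat (Poly_Mapping.lookup m i) * of_real (v $ i) * of_real (x $ i) ^ (Poly_Mapping.lookup m i - 1) *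
       (\<Prod>j\<in>UNIV - {i}. of_real (x $ j) ^ Poly_Mapping.lookup m j))) (at x)"
    by (rule has_derivative_prod) (rule has_derivative_power[OF c, unfolded mult.assoc] has_derivative_eq_rhs[OF has_derivative_power[OF c]], simp add: mult_ac)
  then show ?thesis
    by (simp add: mon_def[abs_def] mult_ac)
qed

lemma polyfun_mon_partial:
  "polyfun (int (mono_deg m) - 1) (\<lambda>x. of_nat (Poly_Mapping.lookup m i) * (of_real (x $ i) ^ (Poly_Mapping.lookup m i - 1) *
       (\<Prod>j\<in>UNIV - {i}. of_real (x $ j) ^ Poly_Mapping.lookup m j)))"
proof (cases "Poly_Mapping.lookup m i = 0")
  case False
  have "polyfun (int (Poly_Mapping.lookup m i - 1) * 1 + (\<Sum>j\<in>UNIV - {i}. int (Poly_Mapping.lookup m j) * 1))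
     (\<lambda>x. of_real (x $ i) ^ (Poly_Mapping.lookup m i - 1) *
       (\<Prod>j\<in>UNIV - {i}. of_real (x $ j) ^ Poly_Mapping.lookup m j))"
    by (intro polyfun_mult polyfun_prod polyfun_power polyfun_coord)
  moreover have "int (mono_deg m) = int (Poly_Mapping.lookup m i) + (\<Sum>j\<in>UNIV - {i}. int (Poly_Mapping.lookup m j))"
    unfolding mono_deg_def by (subst sum.remove[of _ i]) auto
  ultimately show ?thesis
    using False by (intro polyfun_cmult) (simp add: of_nat_diff algebra_simps)
qed simp

lemma mon_euler:
  "(\<Sum>i\<in>UNIV. of_real (x $ i) * (of_nat (Poly_Mapping.lookup m i) * (of_real (x $ i) ^ (Poly_Mapping.lookup m i - 1) *
       (\<Prod>j\<in>UNIV - {i}. of_real (x $ j) ^ Poly_Mapping.lookup m j)))) = of_nat (mono_deg m) * mon m x"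
proof -
  have "of_real (x $ i) * (of_nat (Poly_Mapping.lookup m i) * (of_real (x $ i) ^ (Poly_Mapping.lookup m i - 1) *
       (\<Prod>j\<in>UNIV - {i}. of_real (x $ j) ^ Poly_Mapping.lookup m j))) = of_nat (Poly_Mapping.lookup m i) * mon m x" for i
  proof (cases "Poly_Mapping.lookup m i")
    case (Suc k)
    have "mon m x = of_real (x $ i) ^ Poly_Mapping.lookup m i * (\<Prod>j\<in>UNIV - {i}. of_real (x $ j) ^ Poly_Mapping.lookup m j)"
      unfolding mon_def by (subst prod.remove[of _ i]) auto
    then show ?thesis by (simp add: Suc)
  qed simp
  then show ?thesis by (simp only: mono_deg_def of_nat_sum sum_distrib_right)
qed

text \<open>One witness \<open>g\<close> carries all three properties, so a single induction over
  monomials suffices. On a monomial the Euler expression is the monomial times its degree minus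
  D.\<close>

lemma polyfun_gradient:
  fixes h :: "real^'n::finite \<Rightarrow> complex"
  assumes "polyfun D h"
  obtains g where
    "\<And>x. (h has_derivative (\<lambda>v. \<Sum>i\<in>UNIV. of_real (v $ i) * g i x)) (at x)"
    "\<And>i. polyfun (D - 1) (g i)"
    "polyfun (D - 1) (\<lambda>x. (\<Sum>i\<in>UNIV. of_real (x $ i) * g i x) - of_int D * h x)"
proof -
  have "\<exists>g. (\<forall>x. (h has_derivative (\<lambda>v. \<Sum>i\<in>UNIV. of_real (v $ i) * g i x)) (at x)) \<and>
    (\<forall>i. polyfun (D - 1) (g i)) \<and>
    polyfun (D - 1) (\<lambda>x. (\<Sum>i\<in>UNIV. of_real (x $ i) * g i x) - of_int D * h x)"
    using assms
  proof (induction rule: polyfun_induct)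
    case zero
    show ?case by (rule exI[of _ "\<lambda>_ _. 0"]) auto
  next
    case (add h k)
    then obtain g l where g: "\<forall>x. (h has_derivative (\<lambda>v. \<Sum>i\<in>UNIV. of_real (v $ i) * g i x)) (at x)"
        "\<forall>i. polyfun (D - 1) (g i)" "polyfun (D - 1) (\<lambda>x. (\<Sum>i\<in>UNIV. of_real (x $ i) * g i x) - of_int D * h x)"
      and l: "\<forall>x. (k has_derivative (\<lambda>v. \<Sum>i\<in>UNIV. of_real (v $ i) * l i x)) (at x)"
        "\<forall>i. polyfun (D - 1) (l i)" "polyfun (D - 1) (\<lambda>x. (\<Sum>i\<in>UNIV. of_real (x $ i) * l i x) - of_int D * k x)"
      by blast
    have "((\<lambda>x. h x + k x) has_derivative (\<lambda>v. \<Sum>i\<in>UNIV. of_real (v $ i) * (g i x + l i x))) (at x)" for x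
      using has_derivative_add[OF g(1)[rule_format, of x] l(1)[rule_format, of x]]
      by (simp add: sum.distrib distrib_left)
    moreover have "polyfun (D - 1) (\<lambda>x. g i x + l i x)" for i
      using g l by (intro polyfun_add) auto
    moreover have "polyfun (D - 1) (\<lambda>x. (\<Sum>i\<in>UNIV. of_real (x $ i) * (g i x + l i x)) - of_int D * (h x + k x))"
      using polyfun_add[OF g(3) l(3)] by (simp add: sum.distrib algebra_simps)
    ultimately show ?case by (intro exI[of _ "\<lambda>i x. g i x + l i x"]) blast
  next
    case (mon c m)
    let ?g = "\<lambda>i x. of_nat (Poly_Mapping.lookup m i) * (of_real (x $ i) ^ (Poly_Mapping.lookup m i - 1) *
       (\<Prod>j\<in>UNIV - {i}. of_real (x $ j) ^ Poly_Mapping.lookup m j))"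
    have "((\<lambda>x. c * mon m x) has_derivative (\<lambda>v. \<Sum>i\<in>UNIV. of_real (v $ i) * (c * ?g i x))) (at x)" for x :: "real^'n"
      using has_derivative_mult_right[OF mon_has_derivative[of m x], of c]
      by (simp add: sum_distrib_left mult.left_commute)
    moreover have "polyfun (D - 1) (\<lambda>x. c * ?g i x)" for i
      by (intro polyfun_cmult polyfun_mono[OF polyfun_mon_partial]) (use mon in auto)
    moreover have "polyfun (D - 1) (\<lambda>x. (\<Sum>i\<in>UNIV. of_real (x $ i) * (c * ?g i x)) - of_int D * (c * mon m x))"
    proof -
      have "(\<Sum>i\<in>UNIV. of_real (x $ i) * (c * ?g i x)) = c * (of_nat (mono_deg m) * mon m x)" for x :: "real^'n"
        unfolding mon_euler[symmetric] sum_distrib_left by (intro sum.cong) (simp_all add: mult_ac)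
      then have eq: "(\<Sum>i\<in>UNIV. of_real (x $ i) * (c * ?g i x)) - of_int D * (c * mon m x) =
          (of_int (int (mono_deg m) - D) * c) * mon m x" for x :: "real^'n"
        by (simp add: algebra_simps)
      show ?thesis
      \<comment> \<open>The factor \<open>mono_deg m - D\<close> vanishes for a monomial of full
        degree; any other monomial already has degree at most D - 1.\<close>
      proof (cases "int (mono_deg m) = D")
        case False
        then show ?thesis unfolding eq
          by (intro polyfun_cmult polyfun_mono[OF polyfun_mon]) (use mon in auto)
      next
        case True
        then show ?thesis unfolding eq by simp
      qed
    qed
    ultimately show ?case
      by (intro exI[of _ "\<lambda>i x. c * ?g i x"]) blast
  qed
  then show ?thesis using that by blast
qed

lemma pd_eqI:
  assumes "(h has_derivative (\<lambda>v. \<Sum>i\<in>UNIV. of_real (v $ i) * g i x)) (at x)"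
  shows "pd i h x = g i x"
proof -
  have "pd i h x = (\<Sum>j\<in>UNIV. of_real (axis i 1 $ j) * g j x)"
    unfolding pd_def frechet_derivative_at[OF assms, symmetric] ..
  also have "\<dots> = (\<Sum>j\<in>UNIV. if j = i then g j x else 0)"
    by (intro sum.cong) (auto simp: axis_def)
  finally show ?thesis by simp
qed

lemma
  assumes "polyfun D h"
  shows polyfun_has_derivative: "(h has_derivative (\<lambda>v. \<Sum>i\<in>UNIV. of_real (v $ i) * pd i h x)) (at x)"
    and polyfun_pd: "polyfun (D - 1) (pd i h)"
    and polyfun_eul: "polyfun (D - 1) (eul (of_int D) h)"
proof -
  obtain g where g: "\<And>x. (h has_derivative (\<lambda>v. \<Sum>i\<in>UNIV. of_real (v $ i) * g i x)) (at x)"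
    "\<And>i. polyfun (D - 1) (g i)"
    "polyfun (D - 1) (\<lambda>x. (\<Sum>i\<in>UNIV. of_real (x $ i) * g i x) - of_int D * h x)"
    using polyfun_gradient[OF assms] by blast
  have pd: "pd i h = g i" for i
    using g(1) by (intro ext pd_eqI)
  show "(h has_derivative (\<lambda>v. \<Sum>i\<in>UNIV. of_real (v $ i) * pd i h x)) (at x)" "polyfun (D - 1) (pd i h)"
    using g by (auto simp: pd)
  show "polyfun (D - 1) (eul (of_int D) h)"
    using g(3) by (simp add: eul_def[abs_def] pd)
qed

lemma pd_zero [simp]: "pd i (\<lambda>_. 0) = (\<lambda>_. 0)"
  by (simp add: pd_def fun_eq_iff)

lemma eul_zero [simp]: "eul D (\<lambda>_. 0) = (\<lambda>_. 0)"
  by (simp add: eul_def fun_eq_iff)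

lemma norm_mon_le: "norm (mon m x) \<le> (1 + norm x) ^ mono_deg m"
proof -
  have "norm (mon m x) \<le> (\<Prod>i\<in>UNIV. (1 + norm x) ^ Poly_Mapping.lookup m i)"
    unfolding mon_def prod_norm[symmetric] norm_power norm_of_real
    using component_le_norm_cart[of x] by (intro prod_mono conjI power_mono) (auto intro: add_increasing order_trans)
  then show ?thesis by (simp add: power_sum mono_deg_def)
qed

text \<open>The base \<open>1 + norm x\<close> is at least 1, so lower monomials are absorbed into
  the top power. A \<open>powr\<close> exponent also makes sense for negative D, where the function
  is zero.\<close>

lemma polyfun_bound:
  fixes h :: "real^'n::finite \<Rightarrow> complex"
  assumes "polyfun D h"
  obtains C where "C \<ge> 0" "\<And>x. norm (h x) \<le> C * (1 + norm x) powr of_int D"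
proof -
  have "\<exists>C\<ge>0. \<forall>x. norm (h x) \<le> C * (1 + norm x) powr of_int D"
    using assms
  proof (induction rule: polyfun_induct)
    case (add h k)
    then obtain C1 C2 where "C1 \<ge> 0" "\<forall>x. norm (h x) \<le> C1 * (1 + norm x) powr of_int D"
      "C2 \<ge> 0" "\<forall>x. norm (k x) \<le> C2 * (1 + norm x) powr of_int D" by blast
    then show ?case
      by (intro exI[of _ "C1 + C2"]) (auto simp: distrib_right intro: norm_triangle_le add_mono)
  next
    case (mon c m)
    have "norm (c * mon m x) \<le> norm c * (1 + norm x) powr of_int D" for x :: "real^'n"
    proof -
      have p: "1 + norm x > 0" by (smt (verit) norm_ge_zero)
      have "norm (mon m x) \<le> (1 + norm x) powr real (mono_deg m)"
        using norm_mon_le[of m x] p by (simp add: powr_realpow)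
      also have "\<dots> \<le> (1 + norm x) powr of_int D"
        using mon by (intro powr_mono) auto
      finally show ?thesis by (simp add: norm_mult mult_left_mono)
    qed
    then show ?case by (intro exI[of _ "norm c"]) auto
  qed (auto intro: exI[of _ 0])
  then show ?thesis using that by blast
qed

text \<open>Expanding every coordinate power by the binomial theorem separates \<open>a\<close> from
  \<open>y\<close>, and only the coefficients are integrated. Three uses are covered: averages over
  the cube, averages along the segments from \<open>a\<close> to \<open>a + t\<close>, and integrals
  along the segment from 0 to \<open>a\<close>. Trivial factors such as \<open>1 *\<^sub>R a\<close>
  or \<open>+ 0\<close> in later applications only match this shape.\<close>

lemma polyfun_integral_affine:
  fixes w \<psi> :: "'b::euclidean_space \<Rightarrow> real" and \<phi> :: "'b \<Rightarrow> real^'n::finite"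
  assumes "polyfun D q" and w: "continuous_on (cbox l u) w"
    and \<psi>: "continuous_on (cbox l u) \<psi>" and \<phi>: "continuous_on (cbox l u) \<phi>"
  shows "polyfun D (\<lambda>a. integral (cbox l u) (\<lambda>y. of_real (w y) * q (\<psi> y *\<^sub>R a + \<phi> y)))"
  using assms(1)
proof (induction rule: polyfun_induct)
  case (add h k)
  have *: "(\<lambda>y. of_real (w y) * h (\<psi> y *\<^sub>R a + \<phi> y)) integrable_on cbox l u" if "polyfun D h" for h a
    by (intro integrable_continuous continuous_intros w \<psi> \<phi>
      continuous_on_compose2[OF continuous_on_polyfun[OF that]]) auto
  show ?case
    using add by (simp add: distrib_left integral_add * polyfun_add)
next
  case (mon c m)
  let ?L = "Poly_Mapping.lookup m"
  let ?P = "PiE UNIV (\<lambda>i. {..?L i})"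
  \<comment> \<open>The coefficient of the monomial with exponents \<open>e\<close> in
    \<open>a\<close>, as a function of the integration variable.\<close>
  define B where "B = (\<lambda>e y. of_real (w y) * c * (\<Prod>i\<in>UNIV. of_nat (?L i choose e i) * of_real (\<psi> y) ^ e i * complex_of_real (\<phi> y $ i) ^ (?L i - e i)))"
  have contB: "continuous_on (cbox l u) (B e)" for e
    unfolding B_def by (intro continuous_intros w \<psi> \<phi>)
  have "of_real (w y) * (c * mon m (\<psi> y *\<^sub>R a + \<phi> y)) = (\<Sum>e\<in>?P. (\<Prod>i\<in>UNIV. of_real (a $ i) ^ e i) * B e y)" for a y
  proof -
    have "mon m (\<psi> y *\<^sub>R a + \<phi> y) = (\<Prod>i\<in>UNIV. (of_real (\<psi> y) * of_real (a $ i) + of_real (\<phi> y $ i)) ^ ?L i)"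
      by (simp add: mon_def)
    also have "\<dots> = (\<Prod>i\<in>UNIV. \<Sum>j\<le>?L i. of_nat (?L i choose j) * (of_real (\<psi> y) * of_real (a $ i)) ^ j * of_real (\<phi> y $ i) ^ (?L i - j))"
      by (simp only: binomial_ring)
    also have "\<dots> = (\<Sum>e\<in>?P. \<Prod>i\<in>UNIV. of_nat (?L i choose e i) * (of_real (\<psi> y) * of_real (a $ i)) ^ e i * of_real (\<phi> y $ i) ^ (?L i - e i))"
      by (intro prod_sum_PiE) auto
    finally show ?thesis
      by (simp add: B_def sum_distrib_left prod.distrib power_mult_distrib mult_ac)
  qed
  moreover have "((\<lambda>y. \<Sum>e\<in>?P. (\<Prod>i\<in>UNIV. of_real (a $ i) ^ e i) * B e y) has_integral
     (\<Sum>e\<in>?P. (\<Prod>i\<in>UNIV. of_real (a $ i) ^ e i) * integral (cbox l u) (B e))) (cbox l u)" for a :: "real^'n"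
    by (intro has_integral_sum has_integral_mult_right integrable_integral integrable_continuous contB)
       (auto intro: finite_PiE)
  ultimately have "integral (cbox l u) (\<lambda>y. of_real (w y) * (c * mon m (\<psi> y *\<^sub>R a + \<phi> y))) =
     (\<Sum>e\<in>?P. integral (cbox l u) (B e) * (\<Prod>i\<in>UNIV. of_real (a $ i) ^ e i))" for a
    by (simp add: integral_unique mult.commute)
  moreover have "polyfun D (\<lambda>a. integral (cbox l u) (B e) * (\<Prod>i\<in>UNIV. of_real (a $ i) ^ e i))" if e: "e \<in> ?P" for e
  proof (rule polyfun_cmult)
    have "polyfun (\<Sum>i\<in>UNIV. int (e i) * 1) (\<lambda>a::real^'n. \<Prod>i\<in>UNIV. of_real (a $ i) ^ e i)"
      by (intro polyfun_prod polyfun_power polyfun_coord)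
    moreover have "(\<Sum>i\<in>UNIV. int (e i) * 1) \<le> int (mono_deg m)"
      using e unfolding mono_deg_def of_nat_sum by (intro sum_mono) (auto simp: PiE_iff)
    ultimately show "polyfun D (\<lambda>a::real^'n. \<Prod>i\<in>UNIV. of_real (a $ i) ^ e i)"
      using mon by (meson order_trans polyfun_mono)
  qed
  ultimately show ?case by (simp add: polyfun_sum)
qed simp

lemma polyfun_poly: "polyfun (int (degree q)) (\<lambda>a. of_real (poly q (a $ i)))"
proof -
  have "polyfun (int (degree q)) (\<lambda>a. \<Sum>k\<le>degree q. of_real (coeff q k) * of_real (a $ i) ^ k)"
    by (intro polyfun_sum polyfun_cmult polyfun_mono[OF polyfun_power[OF polyfun_coord]]) auto
  then show ?thesis by (simp add: poly_altdef)
qed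

section \<open>Degree and shifts\<close>

text \<open>While \<open>polyfun\<close> bounds a function, \<open>total_deg\<close> reads the keys
  of the polynomial itself. This version on the level of keys serves to compare the total degrees of
  a polynomial and its shift.\<close>

definition degle :: "int \<Rightarrow> 'n::finite mpoly \<Rightarrow> bool" where
  "degle D P \<longleftrightarrow> (\<forall>m\<in>Poly_Mapping.keys P. int (mono_deg m) \<le> D)"

lemma degle_mono: "degle D P \<Longrightarrow> D \<le> E \<Longrightarrow> degle E P"
  unfolding degle_def by (auto intro: order_trans)

lemma degle_add: "degle D P \<Longrightarrow> degle D Q \<Longrightarrow> degle D (P + Q)"
  using keys_add[of P Q] unfolding degle_def by blast

lemma degle_mult:
  assumes "degle D P" "degle E Q" shows "degle (D + E) (P * Q)"
  unfolding degle_def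
proof
  fix m assume "m \<in> Poly_Mapping.keys (P * Q)"
  then obtain m1 m2 where "m1 \<in> Poly_Mapping.keys P" "m2 \<in> Poly_Mapping.keys Q" "m = m1 + m2"
    using keys_mult[of P Q] by blast
  with assms show "int (mono_deg m) \<le> D + E" by (force simp: mono_deg_add degle_def)
qed

lemma degle_sum: "(\<And>i. i \<in> A \<Longrightarrow> degle D (P i)) \<Longrightarrow> degle D (\<Sum>i\<in>A. P i)"
  by (induction A rule: infinite_finite_induct) (auto intro: degle_add simp: degle_def[of _ 0])

lemma degle_mconst: "degle 0 (mconst c)"
  by (auto simp: degle_def mconst_def mono_deg_def split: if_splits)

lemma degle_mvar: "degle 1 (mvar i)"
  by (auto simp: degle_def mvar_def mono_deg_def lookup_single when_def split: if_splits)

lemma degle_one: "degle 0 1"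
  using degle_mconst[of 1] by (simp add: mconst_def)

text \<open>Congruence modulo terms of degree below D. It is compatible with products, so it passes
  from x_i + a_i versus x_i to every monomial and its shift.\<close>

definition same_top :: "int \<Rightarrow> 'n::finite mpoly \<Rightarrow> 'n mpoly \<Rightarrow> bool" where
  "same_top D P Q \<longleftrightarrow> degle D P \<and> degle D Q \<and> degle (D - 1) (P - Q)"

lemma same_top_mult:
  assumes "same_top D P Q" "same_top E P' Q'" shows "same_top (D + E) (P * P') (Q * Q')"
proof -
  have "P * P' - Q * Q' = (P - Q) * P' + Q * (P' - Q')" by (simp add: algebra_simps)
  moreover have "degle (D + E - 1) ((P - Q) * P')" "degle (D + E - 1) (Q * (P' - Q'))"
    using assms degle_mult[of "D - 1" "P - Q" E P'] degle_mult[of D Q "E - 1" "P' - Q'"]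
    unfolding same_top_def by (simp_all add: algebra_simps)
  ultimately show ?thesis
    using assms unfolding same_top_def by (auto intro: degle_mult degle_add)
qed

lemma same_top_one: "same_top 0 1 1"
  by (simp add: same_top_def degle_one) (simp add: degle_def)

lemma same_top_power: "same_top D P Q \<Longrightarrow> same_top (int n * D) (P ^ n) (Q ^ n)"
proof (induction n)
  case (Suc n)
  then show ?case using same_top_mult[of D P Q "int n * D" "P ^ n" "Q ^ n"] by (simp add: algebra_simps)
qed (simp add: same_top_one)

lemma same_top_prod:
  "(\<And>i. i \<in> A \<Longrightarrow> same_top (D i) (P i) (Q i)) \<Longrightarrow> same_top (\<Sum>i\<in>A. D i) (\<Prod>i\<in>A. P i) (\<Prod>i\<in>A. Q i)"
  by (induction A rule: infinite_finite_induct) (auto intro: same_top_mult same_top_one)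

lemma prod_mvar_eq_single:
  fixes m :: "'n::finite \<Rightarrow>\<^sub>0 nat"
  shows "(\<Prod>i\<in>UNIV. mvar i ^ Poly_Mapping.lookup m i) = Poly_Mapping.single m 1"
proof -
  have pow: "mvar i ^ k = Poly_Mapping.single (Poly_Mapping.single i k) 1" for i :: 'n and k
  proof (induction k)
    case (Suc k)
    then show ?case by (simp add: mvar_def mult_single flip: single_add)
  qed simp
  have prod: "(\<Prod>i\<in>A. Poly_Mapping.single (g i) (1::complex)) = Poly_Mapping.single (\<Sum>i\<in>A. g i) 1"
    for A and g :: "'n \<Rightarrow> 'n \<Rightarrow>\<^sub>0 nat"
    by (induction A rule: infinite_finite_induct) (auto simp: mult_single)
  have "(\<Sum>i\<in>UNIV. Poly_Mapping.single i (Poly_Mapping.lookup m i)) = m"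
    by (rule poly_mapping_eqI) (simp add: lookup_sum lookup_single when_def)
  then show ?thesis by (simp add: pow prod)
qed

lemma same_top_mshift: "same_top (int (total_deg P)) (mshift a P) P"
proof -
  let ?M = "\<lambda>m. \<Prod>i\<in>UNIV. (mvar i + mconst (of_real (a $ i))) ^ Poly_Mapping.lookup m i"
  let ?c = "\<lambda>m. mconst (Poly_Mapping.lookup P m)"
  have "same_top 1 (mvar i + mconst (of_real (a $ i))) (mvar i)" for i
    unfolding same_top_def
    by (auto intro!: degle_add degle_mvar degle_mono[OF degle_mconst])
  then have st: "same_top (int (mono_deg m)) (?M m) (Poly_Mapping.single m 1)" for m
    using same_top_prod[of UNIV "\<lambda>i. int (Poly_Mapping.lookup m i) * 1"
      "\<lambda>i. (mvar i + mconst (of_real (a $ i))) ^ Poly_Mapping.lookup m i" "\<lambda>i. mvar i ^ Poly_Mapping.lookup m i"]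
    by (simp add: same_top_power[where D = 1, simplified] prod_mvar_eq_single mono_deg_def)
  have dP: "degle (int (total_deg P)) P"
    by (simp add: degle_def mono_deg_le_total_deg)
  have c: "same_top 0 (?c m) (?c m)" for m
    by (simp add: same_top_def degle_mconst) (simp add: degle_def)
  have st': "same_top (int (mono_deg m)) (?c m * ?M m) (Poly_Mapping.single m (Poly_Mapping.lookup P m))" for m
    using same_top_mult[OF c[of m] st[of m]] by (simp add: mconst_def mult_single)
  have "mshift a P - P = (\<Sum>m\<in>Poly_Mapping.keys P. ?c m * ?M m - Poly_Mapping.single m (Poly_Mapping.lookup P m))"
    by (subst (2) mpoly_eq_sum_single[of P]) (simp add: mshift_def sum_subtractf)
  also have "degle (int (total_deg P) - 1) \<dots>"
  proof (intro degle_sum)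
    fix m assume "m \<in> Poly_Mapping.keys P"
    show "degle (int (total_deg P) - 1) (?c m * ?M m - Poly_Mapping.single m (Poly_Mapping.lookup P m))"
      by (rule degle_mono[of "int (mono_deg m) - 1"])
         (use st'[of m] in \<open>simp add: same_top_def\<close>, use mono_deg_le_total_deg[OF \<open>m \<in> Poly_Mapping.keys P\<close>] in simp)
  qed
  finally have d: "degle (int (total_deg P) - 1) (mshift a P - P)" .
  have "degle (int (total_deg P)) (mshift a P)"
    using degle_add[OF degle_mono[OF d, of "int (total_deg P)"] dP] by simp
  with d dP show ?thesis by (simp add: same_top_def)
qed

text \<open>A monomial of top degree cannot occur in the difference of the shift and P, so it
  survives the shift. Degree 0 is treated apart because there the maximum may be the default value
  0; the difference then has degree at most -1 and is zero. The consequence that matters is that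
  \<open>abscissa\<close> is the same for all shifts.\<close>

lemma total_deg_mshift [simp]: "total_deg (mshift a P) = total_deg P"
proof (cases "total_deg P = 0")
  case True
  have "Poly_Mapping.keys (mshift a P - P) = {}"
    using same_top_mshift[of P a] True by (auto simp: same_top_def degle_def)
  then show ?thesis by simp
next
  case False
  have "total_deg P \<in> insert 0 (mono_deg ` Poly_Mapping.keys P)"
    unfolding total_deg_def by (intro Max_in) auto
  with False obtain m where m: "m \<in> Poly_Mapping.keys P" "mono_deg m = total_deg P" by auto
  with same_top_mshift[of P a] have "m \<notin> Poly_Mapping.keys (mshift a P - P)"
    by (force simp: same_top_def degle_def)
  then have "Poly_Mapping.lookup (mshift a P) m = Poly_Mapping.lookup P m"
    by (simp add: in_keys_iff lookup_minus)
  with m have "m \<in> Poly_Mapping.keys (mshift a P)" by (simp add: in_keys_iff)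
  then have "total_deg P \<le> total_deg (mshift a P)"
    using mono_deg_le_total_deg m(2) by metis
  moreover have "total_deg (mshift a P) \<le> total_deg P"
    using same_top_mshift[of P a] by (auto simp: total_deg_def[of "mshift a P"] same_top_def degle_def)
  ultimately show ?thesis by simp
qed

section \<open>The lower bound from Mahler's hypothesis\<close>

lemma meval_top_part:
  "meval (top_part P) x = (\<Sum>m\<in>{m\<in>Poly_Mapping.keys P. mono_deg m = total_deg P}. Poly_Mapping.lookup P m * mon m x)"
  by (simp add: top_part_def mon_def)

lemma mon_scaleR: "mon m (r *\<^sub>R x) = of_real r ^ mono_deg m * mon m x"
  by (simp add: mon_def mono_deg_def power_mult_distrib prod.distrib power_sum)

lemma polyfun_minus_top_part: "polyfun (int (total_deg P) - 1) (\<lambda>x. meval P x - meval (top_part P) x)"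
proof -
  let ?K = "Poly_Mapping.keys P"
  have "meval P x - meval (top_part P) x =
      (\<Sum>m\<in>?K - {m\<in>?K. mono_deg m = total_deg P}. Poly_Mapping.lookup P m * mon m x)" for x
    unfolding meval_top_part meval_mon[of P] by (subst sum_diff) auto
  moreover have "polyfun (int (total_deg P) - 1)
      (\<lambda>x. \<Sum>m\<in>?K - {m\<in>?K. mono_deg m = total_deg P}. Poly_Mapping.lookup P m * mon m x)"
    using mono_deg_le_total_deg[of _ P]
    by (intro polyfun_sum polyfun_cmult polyfun_mono[OF polyfun_mon]) force
  ultimately show ?thesis by simp
qed

lemma orthant_closed: "closed (orthant :: (real^'n::finite) set)"
  unfolding orthant_def by (intro closed_Collect_all closed_Collect_le continuous_intros)

lemma orthant_add: "a \<in> orthant \<Longrightarrow> b \<in> orthant \<Longrightarrow> a + b \<in> orthant"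
  by (simp add: orthant_def)

lemma orthant_scaleR: "a \<in> orthant \<Longrightarrow> 0 \<le> r \<Longrightarrow> r *\<^sub>R a \<in> orthant"
  by (simp add: orthant_def)

lemma orthant_zero [simp]: "0 \<in> orthant"
  by (simp add: orthant_def)

lemma orthant_axis [simp]: "axis i 1 \<in> (orthant :: (real^'n::finite) set)"
  by (simp add: orthant_def axis_def)

lemma cbox01_orthant: "t \<in> cbox 0 1 \<Longrightarrow> t \<in> orthant"
  by (simp add: orthant_def mem_box_cart)

lemma norm_le_norm_add_orthant:
  assumes "x \<in> orthant" "y \<in> orthant" shows "norm x \<le> norm (x + y)"
  using assms by (intro norm_le_componentwise_cart) (auto simp: orthant_def)

text \<open>Far out the top part dominates: by homogeneity it is controlled by its minimum on the
  compact part of the unit sphere in the orthant. On the remaining compact piece f itself has a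
  positive minimum because it has no zero there. The two halves of Mahler's Hypothesis are used in
  these two regions.\<close>

lemma mahler_lower_bound:
  fixes f :: "'n::finite mpoly"
  assumes "mahler f"
  obtains c where "c > 0" "\<And>x. x \<in> orthant \<Longrightarrow> norm (meval f x) \<ge> c * (1 + norm x) ^ total_deg f"
proof -
  define d where "d = total_deg f"
  define T where "T = meval (top_part f)"
  define S where "S = orthant \<inter> sphere (0::real^'n) 1"
  have hom: "T (r *\<^sub>R x) = of_real r ^ d * T x" for r x
    by (auto simp: T_def d_def meval_top_part mon_scaleR sum_distrib_left mult_ac intro!: sum.cong)
  have "continuous_on S T"
    unfolding T_def using polyfun_meval by (rule continuous_on_polyfun)
  moreover have "compact S" unfolding S_def by (intro closed_Int_compact orthant_closed) auto
  moreover have "axis undefined 1 \<in> S" by (auto simp: S_def)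
  ultimately obtain x0 where x0: "x0 \<in> S" "\<And>x. x \<in> S \<Longrightarrow> norm (T x0) \<le> norm (T x)"
    using continuous_attains_inf[of S "\<lambda>x. norm (T x)"] by (force intro: continuous_intros)
  define c1 where "c1 = norm (T x0)"
  have "x0 \<in> orthant - {0}" using x0 by (auto simp: S_def)
  then have c1: "c1 > 0" using assms by (auto simp: c1_def T_def mahler_def)
  have T: "norm (T x) \<ge> c1 * norm x ^ d" if "x \<in> orthant" "x \<noteq> 0" for x
  proof -
    have "(1 / norm x) *\<^sub>R x \<in> S" using that by (auto simp: S_def intro!: orthant_scaleR)
    then have "c1 \<le> norm (T ((1 / norm x) *\<^sub>R x))" using x0 by (simp add: c1_def)
    also have "\<dots> = norm (T x) / norm x ^ d"
      using that by (simp add: hom norm_mult norm_power norm_divide power_one_over field_simps)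
    finally show ?thesis using that by (simp add: field_simps)
  qed
  obtain C where C: "C \<ge> 0" "\<And>x. norm (meval f x - T x) \<le> C * (1 + norm x) powr of_int (int d - 1)"
    using polyfun_bound[OF polyfun_minus_top_part[of f]] unfolding T_def d_def by blast
  \<comment> \<open>Beyond this radius the lower-order remainder, at most C (1 + |x|)^(d - 1), is no
    more than half of (c1 / 2^d) (1 + |x|)^d. The power of 2 comes from 1 + |x| <= 2 |x| for |x| >=
    1.\<close>
  define \<rho> where "\<rho> = max 1 (2 * C * 2 ^ d / c1)"
  have \<rho>: "\<rho> \<ge> 1" "\<rho> * c1 / 2 ^ d \<ge> 2 * C"
    using c1 mult_left_mono[OF max.cobounded2[of "2 * C * 2 ^ d / c1" 1], of c1]
    by (auto simp: \<rho>_def pos_le_divide_eq mult_ac)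
  have big: "norm (meval f x) \<ge> c1 / 2 ^ d / 2 * (1 + norm x) ^ d" if x: "x \<in> orthant" "norm x \<ge> \<rho>" for x
  proof -
    have n1: "norm x \<ge> 1" "x \<noteq> 0" using x \<rho> by auto
    have p: "1 + norm x > 0" using n1 by simp
    have "norm (meval f x - T x) \<le> C * ((1 + norm x) ^ d / (1 + norm x))"
      using C(2)[of x] p by (simp add: powr_diff powr_realpow)
    also have "\<dots> = (C / (1 + norm x)) * (1 + norm x) ^ d" by simp
    also have "\<dots> \<le> c1 / 2 ^ d / 2 * (1 + norm x) ^ d"
    proof (intro mult_right_mono)
      have "2 * C \<le> \<rho> * c1 / 2 ^ d" by (rule \<rho>)
      also have "\<dots> \<le> (1 + norm x) * c1 / 2 ^ d"
        using c1 x by (intro divide_right_mono mult_right_mono) auto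
      finally have "C \<le> c1 / 2 ^ d / 2 * (1 + norm x)" by (simp add: field_simps)
      then show "C / (1 + norm x) \<le> c1 / 2 ^ d / 2"
        using p by (simp add: pos_divide_le_eq)
    qed (use p in auto)
    finally have R: "norm (meval f x - T x) \<le> c1 / 2 ^ d / 2 * (1 + norm x) ^ d" .
    have "(1 + norm x) ^ d \<le> (2 * norm x) ^ d" using n1 by (intro power_mono) auto
    then have "c1 / 2 ^ d * (1 + norm x) ^ d \<le> c1 / 2 ^ d * (2 * norm x) ^ d"
      using c1 by (intro mult_left_mono) auto
    also have "\<dots> = c1 * norm x ^ d" by (simp add: power_mult_distrib)
    also have "\<dots> \<le> norm (T x)" using T x n1 by auto
    finally have "c1 / 2 ^ d * (1 + norm x) ^ d \<le> norm (T x)" .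
    moreover have "norm (T x) \<le> norm (meval f x) + norm (meval f x - T x)"
      by (metis norm_minus_commute norm_triangle_sub)
    moreover have "(c1 / 2 ^ d * (1 + norm x) ^ d) / 2 = c1 / 2 ^ d / 2 * (1 + norm x) ^ d"
      by (rule times_divide_eq_left[symmetric])
    ultimately show ?thesis using R by argo
  qed
  define B where "B = orthant \<inter> cball (0::real^'n) \<rho>"
  have "continuous_on B (\<lambda>x. norm (meval f x) / (1 + norm x) ^ d)"
  proof (intro continuous_intros continuous_on_polyfun[OF polyfun_meval] ballI)
    fix x :: "real^'n"
    have "1 + norm x > 0" by (smt (verit) norm_ge_zero)
    then show "(1 + norm x) ^ d \<noteq> 0" by simp
  qed
  moreover have "compact B" unfolding B_def by (intro closed_Int_compact orthant_closed) auto
  moreover have "0 \<in> B" using \<rho> by (auto simp: B_def)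
  ultimately obtain y where y: "y \<in> B" "\<And>x. x \<in> B \<Longrightarrow> norm (meval f y) / (1 + norm y) ^ d \<le> norm (meval f x) / (1 + norm x) ^ d"
    using continuous_attains_inf[of B "\<lambda>x. norm (meval f x) / (1 + norm x) ^ d"] by blast
  define c2 where "c2 = norm (meval f y) / (1 + norm y) ^ d"
  have p: "1 + norm x > 0" for x :: "real^'n" by (smt (verit) norm_ge_zero)
  have c2: "c2 > 0"
    using assms y p[of y] by (auto simp: c2_def B_def mahler_def)
  have small: "norm (meval f x) \<ge> c2 * (1 + norm x) ^ d" if "x \<in> orthant" "norm x \<le> \<rho>" for x
    using y(2)[of x] that p[of x] by (simp add: B_def c2_def[symmetric] field_simps)
  show ?thesis
  proof (rule that[of "min c2 (c1 / 2 ^ d / 2)"])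
    fix x :: "real^'n" assume x: "x \<in> orthant"
    have pp: "(1 + norm x) ^ d \<ge> 0" using p[of x] by simp
    show "min c2 (c1 / 2 ^ d / 2) * (1 + norm x) ^ total_deg f \<le> norm (meval f x)"
      using small[OF x] big[OF x] mult_right_mono[OF min.cobounded1[of c2 "c1 / 2 ^ d / 2"] pp]
        mult_right_mono[OF min.cobounded2[of c2 "c1 / 2 ^ d / 2"] pp]
      unfolding d_def[symmetric] by linarith
  qed (use c1 c2 in auto)
qed

section \<open>Averaging over the unit cube\<close>

lemma polyfun_has_vector_derivative:
  fixes h :: "real^'n::finite \<Rightarrow> complex"
  assumes "polyfun D h"
  shows "((\<lambda>u. h (a + u *\<^sub>R v)) has_vector_derivative (\<Sum>i\<in>UNIV. of_real (v $ i) * pd i h (a + u *\<^sub>R v))) (at u within S)"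
proof -
  have "((\<lambda>u. a + u *\<^sub>R v) has_derivative (\<lambda>r. r *\<^sub>R v)) (at u within S)"
    by (auto intro!: derivative_eq_intros)
  from has_derivative_compose[OF this polyfun_has_derivative[OF assms]]
  have "((\<lambda>u. h (a + u *\<^sub>R v)) has_derivative
      (\<lambda>r. \<Sum>i\<in>UNIV. of_real ((r *\<^sub>R v) $ i) * pd i h (a + u *\<^sub>R v))) (at u within S)" .
  moreover have "(\<Sum>i\<in>UNIV. of_real ((r *\<^sub>R v) $ i) * pd i h (a + u *\<^sub>R v)) =
      r *\<^sub>R (\<Sum>i\<in>UNIV. of_real (v $ i) * pd i h (a + u *\<^sub>R v))" for r
    unfolding scaleR_sum_right by (intro sum.cong refl) (simp add: scaleR_conv_of_real[of _ "_ :: complex"])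
  ultimately show ?thesis
    by (simp only: has_vector_derivative_def)
qed

lemma polyfun_ftc:
  fixes h :: "real^'n::finite \<Rightarrow> complex"
  assumes "polyfun D h"
  shows "h (a + v) = h a + integral {0..1} (\<lambda>u. \<Sum>i\<in>UNIV. of_real (v $ i) * pd i h (a + u *\<^sub>R v))"
proof -
  have "((\<lambda>u. \<Sum>i\<in>UNIV. of_real (v $ i) * pd i h (a + u *\<^sub>R v)) has_integral
      h (a + 1 *\<^sub>R v) - h (a + 0 *\<^sub>R v)) {0..1}"
    by (rule fundamental_theorem_of_calculus) (auto intro!: polyfun_has_vector_derivative[OF assms])
  then show ?thesis by (simp add: integral_unique)
qed

text \<open>The cube has volume 1, so the constant is unchanged, and Fubini merges the two integrals
  into one over a box of pairs (t, u). A single box is the form in which integrals with parameters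
  are treated throughout.\<close>

lemma integral_unit_cube_ftc:
  fixes G :: "real^'n::finite \<Rightarrow> real \<Rightarrow> complex"
  assumes G: "continuous_on (cbox (0, 0) (1, 1)) (\<lambda>(t, u). G t u)"
    and h: "\<And>t. t \<in> cbox 0 1 \<Longrightarrow> h t = c + integral {0..1} (G t)"
  shows "integral (cbox 0 1) h = c + integral (cbox (0, 0) (1, 1)) (\<lambda>(t, u). G t u)"
proof -
  have "continuous_on (cbox 0 1) (\<lambda>t. integral (cbox 0 1) (G t))"
    using G by (intro integral_continuous_on_param) (simp add: cbox_Pair_eq)
  then have i: "(\<lambda>t. integral {0..1} (G t)) integrable_on cbox 0 1"
    by (simp add: integrable_continuous)
  have "integral (cbox 0 1) h = integral (cbox 0 1) (\<lambda>t. c + integral {0..1} (G t))"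
    using h by (intro integral_cong) auto
  also have "\<dots> = c + integral (cbox 0 1) (\<lambda>t. integral {0..1} (G t))"
  proof -
    have "0 \<in> cbox (0::real^'n) 1" by (simp add: mem_box_cart)
    then have "cbox (0::real^'n) 1 \<noteq> {}" by blast
    then show ?thesis
      by (subst integral_add[OF _ i]) (auto simp: content_cbox_if_cart)
  qed
  also have "integral (cbox 0 1) (\<lambda>t. integral {0..1} (G t)) = integral (cbox (0, 0) (1, 1)) (\<lambda>(t, u). G t u)"
    using integral_prod_continuous[OF G] by simp
  finally show ?thesis .
qed

text \<open>By first-order Taylor expansion the average of Q is Q + K with K of smaller degree. If
  all averages vanish, Q agrees with -K on the orthant, and -K is a polynomial with vanishing
  averages and a smaller degree bound; the induction runs on -K.\<close>

lemma cube_average_injective: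
  fixes Q :: "real^'n::finite \<Rightarrow> complex"
  assumes "polyfun D Q" "\<And>a. a \<in> orthant \<Longrightarrow> integral (cbox 0 1) (\<lambda>t. Q (a + t)) = 0" "a \<in> orthant"
  shows "Q a = 0"
proof -
  \<comment> \<open>Counting from \<open>int n - 1\<close> starts the induction at the bound -1,
    where \<open>polyfun_neg\<close> gives the zero function.\<close>
  have "\<forall>a\<in>orthant. Q a = 0"
    if "polyfun (int n - 1) Q" "\<And>a. a \<in> orthant \<Longrightarrow> integral (cbox 0 1) (\<lambda>t. Q (a + t)) = 0"
    for n and Q :: "real^'n::finite \<Rightarrow> complex"
    using that
  proof (induction n arbitrary: Q)
    case 0
    then show ?case using polyfun_neg[of "-1" Q] by simp
  next
    case (Suc n)
    then have Q: "polyfun (int n) Q" by simp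
    define K where "K = (\<lambda>a. \<Sum>i\<in>UNIV. integral (cbox (0, 0) (1, 1)) (\<lambda>y::(real^'n) \<times> real. of_real (fst y $ i) * pd i Q (1 *\<^sub>R a + snd y *\<^sub>R fst y)))"
    have contpd: "continuous_on A (\<lambda>y::(real^'n) \<times> real. pd i Q (a + snd y *\<^sub>R fst y))" for i a A
      by (intro continuous_intros continuous_on_compose2[OF continuous_on_polyfun[OF polyfun_pd[OF Q]]]) auto
    have cont: "continuous_on A (\<lambda>y::(real^'n) \<times> real. of_real (fst y $ i) * pd i Q (a + snd y *\<^sub>R fst y))" for i a A
      by (intro continuous_intros contpd)
    have "polyfun (int n - 1) K"
      unfolding K_def
      by (intro polyfun_sum polyfun_integral_affine polyfun_pd Q continuous_intros)
    then have K: "polyfun (int n - 1) (\<lambda>a. - K a)" by (rule polyfun_uminus)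
    have eq: "integral (cbox 0 1) (\<lambda>t. Q (a + t)) = Q a + K a" for a
    proof -
      have "integral (cbox 0 1) (\<lambda>t. Q (a + t)) = Q a + integral (cbox (0, 0) (1, 1)) (\<lambda>(t, u). \<Sum>i\<in>UNIV. of_real (t $ i) * pd i Q (a + u *\<^sub>R t))"
        by (intro integral_unit_cube_ftc polyfun_ftc[OF Q]) (unfold case_prod_beta, intro continuous_intros contpd)
      also have "integral (cbox (0, 0) (1, 1)) (\<lambda>(t, u). \<Sum>i\<in>UNIV. of_real (t $ i) * pd i Q (a + u *\<^sub>R t)) = K a"
        unfolding K_def case_prod_beta scaleR_one
        by (intro integral_sum integrable_continuous cont) auto
      finally show ?thesis .
    qed
    have QK: "Q a = - K a" if "a \<in> orthant" for a
      using eq[of a] Suc.prems(2)[OF that] by (simp add: eq_neg_iff_add_eq_0)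
    \<comment> \<open>The identity \<open>QK\<close> holds on the orthant only, which is enough
      because \<open>a + t\<close> stays there.\<close>
    have "integral (cbox 0 1) (\<lambda>t. - K (a + t)) = 0" if a: "a \<in> orthant" for a
    proof -
      have "integral (cbox 0 1) (\<lambda>t. - K (a + t)) = integral (cbox 0 1) (\<lambda>t. Q (a + t))"
        by (intro integral_cong) (simp add: QK a orthant_add cbox01_orthant)
      then show ?thesis using Suc.prems(2)[OF a] by simp
    qed
    from Suc.IH[OF K this] QK show ?case by auto
  qed
  moreover have "polyfun (int (nat (D + 1)) - 1) Q"
    using polyfun_mono[OF assms(1)] by simp
  ultimately show ?thesis using assms by blast
qed

section \<open>Bernoulli polynomials\<close>

declare bernpoly.simps(2) [simp del]

text \<open>By induction both sides have the same derivative in x, so they differ by a constant,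
  which is evaluated at x = 0.\<close>

lemma bernpoly_diff: "poly (bernpoly (Suc k)) (x + 1) - poly (bernpoly (Suc k)) x = real (Suc k) * x ^ k"
proof -
  have D: "(poly (bernpoly (Suc j)) has_real_derivative real (Suc j) * poly (bernpoly j) x) (at x)" for j x
    using poly_DERIV[of "bernpoly (Suc j)" x] by (simp add: bernpoly_Suc of_nat_poly)
  have int: "((\<lambda>t. real (Suc j) * poly (bernpoly j) t) has_integral
     poly (bernpoly (Suc j)) (x + 1) - poly (bernpoly (Suc j)) x) {x..x+1}" for j x
    by (rule fundamental_theorem_of_calculus)
       (use D in \<open>auto simp: has_real_derivative_iff_has_vector_derivative[symmetric] intro: DERIV_subset\<close>)
  show ?thesis
  proof (induction k arbitrary: x)
    case 0
    have "((\<lambda>t. 1 :: real) has_integral 1) {x..x+1}"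
      using has_integral_const_real[of "1::real" x "x + 1"] by simp
    with int[of 0 x] show ?case by (simp add: has_integral_unique)
  next
    case (Suc k)
    let ?\<phi> = "\<lambda>x. poly (bernpoly (Suc (Suc k))) (x + 1) - poly (bernpoly (Suc (Suc k))) x - real (Suc (Suc k)) * x ^ Suc k"
    have "(?\<phi> has_real_derivative 0) (at y)" for y
    proof -
      have "((\<lambda>x. real (Suc (Suc k)) * x ^ Suc k) has_real_derivative real (Suc (Suc k)) * (real (Suc k) * y ^ k)) (at y)"
        using DERIV_cmult[OF DERIV_pow[of "Suc k" y]] by (simp del: of_nat_Suc power_Suc)
      moreover have "((\<lambda>x. poly (bernpoly (Suc (Suc k))) (x + 1)) has_real_derivative real (Suc (Suc k)) * poly (bernpoly (Suc k)) (y + 1)) (at y)"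
        using D[of "Suc k" "y + 1"] by (simp only: DERIV_shift)
      ultimately have "(?\<phi> has_real_derivative (real (Suc (Suc k)) * poly (bernpoly (Suc k)) (y + 1)
          - real (Suc (Suc k)) * poly (bernpoly (Suc k)) y - real (Suc (Suc k)) * (real (Suc k) * y ^ k))) (at y)"
        by (intro DERIV_diff D)
      moreover have "real (Suc (Suc k)) * poly (bernpoly (Suc k)) (y + 1)
          - real (Suc (Suc k)) * poly (bernpoly (Suc k)) y - real (Suc (Suc k)) * (real (Suc k) * y ^ k) = 0"
        using Suc[of y] by (simp only: right_diff_distrib[symmetric]) simp
      ultimately show ?thesis by simp
    qed
    then have "?\<phi> x = ?\<phi> 0"
      by (intro DERIV_isconst_all[of ?\<phi>] allI)
    \<comment> \<open>The normalisation enters here: the increment over [0, 1] is a multiple of the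
      mean of the preceding Bernoulli polynomial, which is 0.\<close>
    moreover have "?\<phi> 0 = 0"
    proof -
      have "((\<lambda>t. real (Suc (Suc k)) * poly (bernpoly (Suc k)) t) has_integral
          real (Suc (Suc k)) * integral {0..1} (poly (bernpoly (Suc k)))) {0..0+1}"
        unfolding add_0 by (intro has_integral_mult_right integrable_integral integrable_continuous_interval continuous_intros)
      with int[of "Suc k" 0] have "poly (bernpoly (Suc (Suc k))) (0 + 1) - poly (bernpoly (Suc (Suc k))) 0 =
          real (Suc (Suc k)) * integral {0..1} (poly (bernpoly (Suc k)))"
        by (rule has_integral_unique)
      then show ?thesis by (simp add: bernpoly_Suc(2))
    qed
    ultimately show ?case by simp
  qed
qed

text \<open>B_(k+1) / (k+1) is an antiderivative of B_k, so the average is a difference quotient of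
  step 1, evaluated by \<open>bernpoly_diff\<close>. This also holds for k = 0.\<close>

lemma bernpoly_average: "integral {0..1} (\<lambda>t. poly (bernpoly k) (x + t)) = x ^ k"
proof -
  have "((\<lambda>t. poly (bernpoly k) (x + t)) has_integral
     poly (bernpoly (Suc k)) (x + 1) / real (Suc k) - poly (bernpoly (Suc k)) (x + 0) / real (Suc k)) {0..1}"
  proof (rule fundamental_theorem_of_calculus)
    fix t :: real
    have "((\<lambda>t. poly (bernpoly (Suc k)) (x + t) / real (Suc k)) has_real_derivative
        (poly (pderiv (bernpoly (Suc k))) (x + t) * 1) / real (Suc k)) (at t within {0..1})"
      by (intro DERIV_cdivide DERIV_chain2[OF poly_DERIV]) (auto intro!: derivative_eq_intros)
    then show "((\<lambda>t. poly (bernpoly (Suc k)) (x + t) / real (Suc k)) has_vector_derivative poly (bernpoly k) (x + t)) (at t within {0..1})"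
      by (simp add: has_real_derivative_iff_has_vector_derivative bernpoly_Suc of_nat_poly del: of_nat_Suc)
  qed simp
  moreover have "poly (bernpoly (Suc k)) (x + 1) / real (Suc k) - poly (bernpoly (Suc k)) (x + 0) / real (Suc k) = x ^ k"
    using bernpoly_diff[of k x] by (simp add: field_simps del: of_nat_Suc)
  ultimately show ?thesis by (simp add: integral_unique)
qed

text \<open>Lebesgue measure on \<open>real^'n\<close> is the image of a product measure indexed by
  \<open>Basis\<close>. After relabelling the basis vectors \<open>axis i 1\<close> by
  \<open>i\<close>, the integral of the product splits into one-dimensional integrals.\<close>

lemma integral_unit_cube_prod:
  fixes \<phi> :: "'n::finite \<Rightarrow> real \<Rightarrow> real"
  assumes "\<And>i. continuous_on UNIV (\<phi> i)"
  shows "integral (cbox 0 1) (\<lambda>t::real^'n. \<Prod>i\<in>UNIV. \<phi> i (t $ i)) = (\<Prod>i\<in>UNIV. integral {0..1} (\<phi> i))"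
proof -
  interpret product_sigma_finite "\<lambda>_::real^'n. lborel :: real measure" ..
  have bij: "bij_betw (\<lambda>i. axis i 1) UNIV (Basis :: (real^'n) set)"
    by (auto simp: bij_betw_def inj_on_def axis_eq_axis Basis_vec_def)
  \<comment> \<open>Indexed by basis vectors, as the product measure is; the indicator turns the
    cube into one interval per coordinate.\<close>
  define \<psi> where "\<psi> = (\<lambda>(b::real^'n) x. indicator {0..1} x * \<phi> (inv_into UNIV (\<lambda>i. axis i 1) b) x)"
  have \<psi>_axis: "\<psi> (axis i 1) x = indicator {0..1} x * \<phi> i x" for i x
    using bij_betw_inv_into_left[OF bij, of i] by (simp add: \<psi>_def)
  have meas [measurable]: "\<phi> i \<in> borel_measurable borel" for i
    using assms by (rule borel_measurable_continuous_onI)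
  have int: "integrable lborel (\<lambda>x. indicator {0..1} x * \<phi> i x)" for i
    using borel_integrable_compact[of "{0..1}" "\<phi> i"] continuous_on_subset[OF assms[of i]] by simp
  have "integral (cbox 0 1) (\<lambda>t::real^'n. \<Prod>i\<in>UNIV. \<phi> i (t $ i)) =
      (LINT t:cbox 0 1|lborel. \<Prod>i\<in>UNIV. \<phi> i (t $ i))"
    by (intro set_borel_integral_eq_integral(2)[symmetric])
       (unfold set_integrable_def, intro borel_integrable_compact continuous_intros continuous_on_compose2[OF assms], auto)
  also have "\<dots> = (\<integral>t. (\<Prod>i\<in>UNIV. indicator {0..1} (t $ i) * \<phi> i (t $ i)) \<partial>lborel)"
    unfolding set_lebesgue_integral_def
  proof (intro Bochner_Integration.integral_cong refl)
    fix t :: "real^'n"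
    have "indicat_real (cbox 0 1) t = (\<Prod>i\<in>UNIV. indicator {0..1} (t $ i))"
      by (auto simp: indicator_def mem_box_cart)
    then show "indicat_real (cbox 0 1) t *\<^sub>R (\<Prod>i\<in>UNIV. \<phi> i (t $ i)) = (\<Prod>i\<in>UNIV. indicator {0..1} (t $ i) * \<phi> i (t $ i))"
      by (simp add: prod.distrib)
  qed
  also have "\<dots> = (\<integral>f. (\<Prod>i\<in>UNIV. indicator {0..1} ((\<Sum>b\<in>Basis. f b *\<^sub>R b) $ i) * \<phi> i ((\<Sum>b\<in>Basis. f b *\<^sub>R b) $ i))
      \<partial>(\<Pi>\<^sub>M b\<in>(Basis :: (real^'n) set). lborel))"
    by (subst lborel_eq, subst integral_distr) auto
  also have "\<dots> = (\<integral>f. (\<Prod>b\<in>Basis. \<psi> b (f b)) \<partial>(\<Pi>\<^sub>M b\<in>(Basis :: (real^'n) set). lborel))"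
  proof (intro Bochner_Integration.integral_cong refl)
    fix f :: "real^'n \<Rightarrow> real"
    have "(\<Sum>b\<in>Basis. f b *\<^sub>R b) $ i = f (axis i 1)" for i
    proof -
      have "(\<Sum>b\<in>Basis. f b *\<^sub>R b) $ i = (\<Sum>b\<in>Basis. f b *\<^sub>R b) \<bullet> axis i 1"
        by (simp add: inner_axis)
      also have "\<dots> = f (axis i 1)"
        by (simp add: inner_sum_left inner_Basis if_distrib sum.delta cong: if_cong)
      finally show ?thesis .
    qed
    then show "(\<Prod>i\<in>UNIV. indicator {0..1} ((\<Sum>b\<in>Basis. f b *\<^sub>R b) $ i) * \<phi> i ((\<Sum>b\<in>Basis. f b *\<^sub>R b) $ i)) =
       (\<Prod>b\<in>Basis. \<psi> b (f b))"
      by (simp add: prod.reindex_bij_betw[OF bij, symmetric] \<psi>_axis)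
  qed
  also have "\<dots> = (\<Prod>b\<in>Basis. integral\<^sup>L lborel (\<psi> b))"
    by (rule product_integral_prod) (auto simp: \<psi>_def int)
  also have "\<dots> = (\<Prod>i\<in>UNIV. integral\<^sup>L lborel (\<psi> (axis i 1)))"
    by (simp add: prod.reindex_bij_betw[OF bij, symmetric])
  also have "\<dots> = (\<Prod>i\<in>UNIV. integral {0..1} (\<phi> i))"
  proof (intro prod.cong refl)
    fix i
    have "set_integrable lborel {0..1} (\<phi> i)" using int[of i] by (simp add: set_integrable_def)
    from set_borel_integral_eq_integral(2)[OF this]
    show "integral\<^sup>L lborel (\<psi> (axis i 1)) = integral {0..1} (\<phi> i)"
      by (simp add: \<psi>_axis[abs_def] set_lebesgue_integral_def)
  qed
  finally show ?thesis .
qed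

lemma bernpoly_cube_average:
  "integral (cbox 0 1) (\<lambda>t::real^'n::finite. of_real (\<Prod>i\<in>UNIV. poly (bernpoly (Poly_Mapping.lookup L i)) ((a + t) $ i))) = mon L a"
proof -
  have "integral (cbox 0 1) (\<lambda>t::real^'n. \<Prod>i\<in>UNIV. poly (bernpoly (Poly_Mapping.lookup L i)) (a $ i + t $ i)) =
     (\<Prod>i\<in>UNIV. (a $ i) ^ Poly_Mapping.lookup L i)"
    by (subst integral_unit_cube_prod) (auto intro!: continuous_intros simp: bernpoly_average)
  moreover have *: "((\<lambda>t. of_real (F t) :: complex) has_integral of_real (integral (cbox 0 1) F)) (cbox 0 1)"
    if "continuous_on (cbox 0 1) F" for F :: "real^'n \<Rightarrow> real"
    using has_integral_linear[OF integrable_integral[OF integrable_continuous[OF that]] bounded_linear_of_real]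
    by (simp add: o_def)
  ultimately show ?thesis
    by (subst integral_unique[OF *]) (auto intro!: continuous_intros simp: mon_def)
qed

section \<open>Jointly continuous families of holomorphic functions\<close>

text \<open>Joint continuity together with holomorphy in s is preserved by sums, products, locally
  uniform series and averages over compact sets of shifts, so no stage of the continuation leaves
  this class.\<close>

definition hcont :: "complex set \<Rightarrow> (real^'n::finite \<Rightarrow> complex \<Rightarrow> complex) \<Rightarrow> bool" where
  "hcont H \<Theta> \<longleftrightarrow> continuous_on (orthant \<times> H) (\<lambda>(a, s). \<Theta> a s) \<and> (\<forall>a\<in>orthant. \<Theta> a holomorphic_on H)"

lemma hcont_continuous: "hcont H \<Theta> \<Longrightarrow> continuous_on (orthant \<times> H) (\<lambda>y. \<Theta> (fst y) (snd y))"
  by (simp add: hcont_def case_prod_beta)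

lemma hcont_subset: "hcont H \<Theta> \<Longrightarrow> K \<subseteq> H \<Longrightarrow> hcont K \<Theta>"
  unfolding hcont_def by (blast intro: continuous_on_subset holomorphic_on_subset)

lemma hcont_cong: "hcont H \<Theta> \<Longrightarrow> (\<And>a s. a \<in> orthant \<Longrightarrow> s \<in> H \<Longrightarrow> \<Theta> a s = \<Psi> a s) \<Longrightarrow> hcont H \<Psi>"
  unfolding hcont_def
  using continuous_on_cong[of "orthant \<times> H" "orthant \<times> H" "\<lambda>(a, s). \<Theta> a s" "\<lambda>(a, s). \<Psi> a s"]
    holomorphic_cong[of H H "\<Theta> _" "\<Psi> _"] by force

lemma hcont_zero [simp]: "hcont H (\<lambda>_ _. 0)"
  by (simp add: hcont_def)

lemma hcont_add: "hcont H \<Theta> \<Longrightarrow> hcont H \<Psi> \<Longrightarrow> hcont H (\<lambda>a s. \<Theta> a s + \<Psi> a s)"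
  unfolding hcont_def case_prod_beta by (auto intro!: continuous_intros holomorphic_intros)

lemma hcont_diff: "hcont H \<Theta> \<Longrightarrow> hcont H \<Psi> \<Longrightarrow> hcont H (\<lambda>a s. \<Theta> a s - \<Psi> a s)"
  unfolding hcont_def case_prod_beta by (auto intro!: continuous_intros holomorphic_intros)

lemma hcont_mult: "hcont H \<Theta> \<Longrightarrow> hcont H \<Psi> \<Longrightarrow> hcont H (\<lambda>a s. \<Theta> a s * \<Psi> a s)"
  unfolding hcont_def case_prod_beta by (auto intro!: continuous_intros holomorphic_intros)

lemma hcont_sum: "(\<And>i. i \<in> A \<Longrightarrow> hcont H (\<Theta> i)) \<Longrightarrow> hcont H (\<lambda>a s. \<Sum>i\<in>A. \<Theta> i a s)"
  by (induction A rule: infinite_finite_induct) (auto intro: hcont_add)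

lemma hcont_param: "continuous_on orthant w \<Longrightarrow> hcont H (\<lambda>a _. w a)"
  unfolding hcont_def case_prod_beta
  by (auto intro!: continuous_on_compose2[of orthant w _ fst] continuous_intros)

lemma hcont_hol: "\<phi> holomorphic_on H \<Longrightarrow> hcont H (\<lambda>_ s. \<phi> s)"
  unfolding hcont_def case_prod_beta
  by (auto intro!: continuous_on_compose2[of H \<phi> _ snd] holomorphic_on_imp_continuous_on continuous_intros)

lemma hcont_compose:
  assumes "hcont H \<Theta>" "\<phi> holomorphic_on K" "\<phi> ` K \<subseteq> H"
  shows "hcont K (\<lambda>a s. \<Theta> a (\<phi> s))"
  unfolding hcont_def case_prod_beta
proof (intro conjI ballI)
  show "continuous_on (orthant \<times> K) (\<lambda>y. \<Theta> (fst y) (\<phi> (snd y)))"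
    using assms(3) holomorphic_on_imp_continuous_on[OF assms(2)]
    by (intro continuous_on_compose2[OF hcont_continuous[OF assms(1)], of _ "\<lambda>y. (fst y, \<phi> (snd y))", simplified]
        continuous_on_compose2[of K \<phi> _ snd] continuous_intros) auto
  show "(\<lambda>s. \<Theta> a (\<phi> s)) holomorphic_on K" if "a \<in> orthant" for a
    using holomorphic_on_compose_gen[OF assms(2), of "\<Theta> a" H] assms that by (auto simp: hcont_def o_def)
qed

text \<open>Both requirements are local in s. The bounds for series and the stages of the
  continuation are available only locally, hence this criterion.\<close>

lemma hcont_local:
  assumes "open H" "\<And>s. s \<in> H \<Longrightarrow> \<exists>K. open K \<and> s \<in> K \<and> hcont K \<Theta>"
  shows "hcont H \<Theta>"
  unfolding hcont_def
proof (intro conjI ballI)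
  show "continuous_on (orthant \<times> H) (\<lambda>(a, s). \<Theta> a s)"
    unfolding continuous_on_eq_continuous_within
  proof
    fix y :: "(real^'a) \<times> complex" assume y: "y \<in> orthant \<times> H"
    then obtain K where K: "open K" "snd y \<in> K" "hcont K \<Theta>"
      using assms(2)[of "snd y"] by (auto simp: mem_Times_iff)
    then have "continuous (at y within orthant \<times> K) (\<lambda>(a, s). \<Theta> a s)"
      using y by (auto simp: hcont_def continuous_on_eq_continuous_within)
    then have "((\<lambda>(a, s). \<Theta> a s) \<longlongrightarrow> (\<lambda>(a, s). \<Theta> a s) y) (at y within (orthant \<times> H) \<inter> (UNIV \<times> K))"
      unfolding continuous_within by (rule tendsto_within_subset) auto
    moreover have "at y within (orthant \<times> H) \<inter> (UNIV \<times> K) = at y within (orthant \<times> H)"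
      using K y by (intro at_within_nhd[of _ "UNIV \<times> K"]) (auto simp: open_Times mem_Times_iff)
    ultimately show "continuous (at y within orthant \<times> H) (\<lambda>(a, s). \<Theta> a s)"
      by (simp add: continuous_within)
  qed
  fix a :: "real^'a" assume a: "a \<in> orthant"
  show "\<Theta> a holomorphic_on H"
    unfolding holomorphic_on_def
  proof
    fix s assume "s \<in> H"
    then obtain K where K: "open K" "s \<in> K" "hcont K \<Theta>" using assms by auto
    then have "\<Theta> a field_differentiable at s"
      using a by (auto simp: hcont_def intro: holomorphic_on_imp_differentiable_at)
    then show "\<Theta> a field_differentiable at s within H"
      by (rule field_differentiable_at_within)
  qed
qed

text \<open>Cauchy's estimate for the difference of two members of the family turns uniform
  closeness on a disc into closeness of derivatives. Differentiation under the integral sign in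
  \<open>hcont_integral\<close> requires this continuity.\<close>

lemma continuous_on_deriv_param:
  fixes f :: "'a::metric_space \<Rightarrow> complex \<Rightarrow> complex"
  assumes "open H" and cont: "continuous_on (T \<times> H) (\<lambda>y. f (fst y) (snd y))"
    and hol: "\<And>t. t \<in> T \<Longrightarrow> f t holomorphic_on H"
  shows "continuous_on (T \<times> H) (\<lambda>y. deriv (f (fst y)) (snd y))"
  unfolding continuous_on_iff
proof (intro ballI allI impI)
  fix y :: "'a \<times> complex" and e :: real assume y: "y \<in> T \<times> H" and e: "e > 0"
  obtain t0 s0 where [simp]: "y = (t0, s0)" by (cases y)
  have t0: "t0 \<in> T" and s0: "s0 \<in> H" using y by auto
  obtain r where r: "r > 0" "cball s0 r \<subseteq> H"
    using open_contains_cball assms(1) s0 by blast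
  \<comment> \<open>Half the radius, so that a disc of radius \<open>q\<close> around any point
    within \<open>q\<close> of \<open>s0\<close> stays in \<open>cball s0 r\<close>. The tolerance
    \<open>e * q / 4\<close> below then becomes \<open>e / 4\<close> after division by
    \<open>q\<close>.\<close>
  define q where "q = r / 2"
  have q: "q > 0" using r by (simp add: q_def)
  have "continuous_on (T \<times> cball s0 r) (\<lambda>y. f (fst y) (snd y))"
    by (rule continuous_on_subset[OF cont]) (use r in auto)
  then obtain X0 where X0: "t0 \<in> X0" "open X0"
    "\<forall>t\<in>X0 \<inter> T. \<forall>s\<in>cball s0 r. dist (f t s) (f t0 s) \<le> e * q / 4"
    using continuous_on_prod_compactE[of T "cball s0 r" "\<lambda>y. f (fst y) (snd y)" t0 "e * q / 4"] t0 e q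
    by auto
  have "deriv (f t0) holomorphic_on H"
    using hol t0 assms(1) by (intro holomorphic_deriv) auto
  then have "isCont (deriv (f t0)) s0"
    using assms(1) s0 by (meson holomorphic_on_imp_continuous_on continuous_on_eq_continuous_at)
  then obtain d1 where d1: "d1 > 0" "\<And>s. dist s s0 < d1 \<Longrightarrow> dist (deriv (f t0) s) (deriv (f t0) s0) < e / 2"
    using e unfolding continuous_at_eps_delta by (metis half_gt_zero)
  obtain d2 where d2: "d2 > 0" "ball t0 d2 \<subseteq> X0" using X0 open_contains_ball by blast
  show "\<exists>d>0. \<forall>x'\<in>T \<times> H. dist x' y < d \<longrightarrow> dist (deriv (f (fst x')) (snd x')) (deriv (f (fst y)) (snd y)) < e"
  proof (intro exI conjI ballI impI)
    show "min q (min d1 d2) > 0" using q d1 d2 by simp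
    fix x' assume x': "x' \<in> T \<times> H" "dist x' y < min q (min d1 d2)"
    obtain t s where [simp]: "x' = (t, s)" by (cases x')
    have dt: "dist t t0 < d2" and ds: "dist s s0 < d1" "dist s s0 < q"
      using x'(2) dist_fst_le[of x' y] dist_snd_le[of x' y] by auto
    have t: "t \<in> T" "t \<in> X0" using x' dt d2 by (auto simp: dist_commute)
    have sub: "cball s q \<subseteq> cball s0 r"
    proof
      fix z assume "z \<in> cball s q"
      then show "z \<in> cball s0 r"
        using ds(2) dist_triangle[of s0 z s] by (simp add: q_def dist_commute)
    qed
    have hd: "(\<lambda>z. f t z - f t0 z) holomorphic_on H"
      using hol t t0 by (auto intro!: holomorphic_intros)
    have "norm ((deriv ^^ 1) (\<lambda>z. f t z - f t0 z) s) \<le> fact 1 * (e * q / 4) / q ^ 1"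
    proof (rule Cauchy_inequality)
      show "(\<lambda>z. f t z - f t0 z) holomorphic_on ball s q"
        using hd by (rule holomorphic_on_subset) (use sub r ball_subset_cball in blast)
      show "continuous_on (cball s q) (\<lambda>z. f t z - f t0 z)"
        using holomorphic_on_imp_continuous_on[OF hd] by (rule continuous_on_subset) (use sub r in blast)
      fix x assume "norm (s - x) = q"
      then have "x \<in> cball s0 r" using sub by (auto simp: dist_norm)
      then show "norm (f t x - f t0 x) \<le> e * q / 4" using X0(3) t by (auto simp: dist_norm)
    qed (use q in auto)
    moreover have "f t field_differentiable at s" "f t0 field_differentiable at s"
      using x' hol t t0 assms(1) by (auto intro: holomorphic_on_imp_differentiable_at)
    then have "deriv (\<lambda>z. f t z - f t0 z) s = deriv (f t) s - deriv (f t0) s"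
      by (rule deriv_diff)
    ultimately have "dist (deriv (f t) s) (deriv (f t0) s) \<le> e / 4"
      using q by (simp add: dist_norm)
    moreover have "dist (deriv (f t0) s) (deriv (f t0) s0) < e / 2" using d1 ds by simp
    ultimately have "dist (deriv (f t) s) (deriv (f t0) s0) < e"
      using dist_triangle[of "deriv (f t) s" "deriv (f t0) s0" "deriv (f t0) s"] e by linarith
    then show "dist (deriv (f (fst x')) (snd x')) (deriv (f (fst y)) (snd y)) < e" by simp
  qed
qed

lemma hcont_integral:
  fixes \<phi> :: "'b::euclidean_space \<Rightarrow> real^'n::finite" and w :: "'b \<Rightarrow> real"
  assumes "open H" "hcont H \<Theta>"
    and w: "continuous_on (cbox l u) w" and \<phi>: "continuous_on (cbox l u) \<phi>"
    and orth: "\<And>y. y \<in> cbox l u \<Longrightarrow> \<phi> y \<in> orthant"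
  shows "hcont H (\<lambda>a s. integral (cbox l u) (\<lambda>y. of_real (w y) * \<Theta> (a + \<phi> y) s))"
  unfolding hcont_def
proof (intro conjI ballI)
  note \<Theta> = hcont_continuous[OF assms(2)]
  have "continuous_on ((orthant \<times> H) \<times> cbox l u) (\<lambda>z. of_real (w (snd z)) * \<Theta> (fst (fst z) + \<phi> (snd z)) (snd (fst z)))"
    by (intro continuous_intros continuous_on_compose2[OF w] continuous_on_compose2[OF \<phi>]
        continuous_on_compose2[OF \<Theta>, of _ "\<lambda>z. (fst (fst z) + \<phi> (snd z), snd (fst z))", simplified])
       (auto intro!: orthant_add intro: orth)
  then have "continuous_on (orthant \<times> H) (\<lambda>p. integral (cbox l u) (\<lambda>y. of_real (w y) * \<Theta> (fst p + \<phi> y) (snd p)))"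
    by (intro integral_continuous_on_param) (simp add: case_prod_beta)
  then show "continuous_on (orthant \<times> H) (\<lambda>(a, s). integral (cbox l u) (\<lambda>y. of_real (w y) * \<Theta> (a + \<phi> y) s))"
    by (simp add: case_prod_beta)
  fix a :: "real^'n" assume a: "a \<in> orthant"
  have hol: "\<Theta> (a + \<phi> y) holomorphic_on H" if "y \<in> cbox l u" for y
    using assms(2) orthant_add[OF a orth[OF that]] by (auto simp: hcont_def)
  have cont: "continuous_on (cbox l u \<times> H) (\<lambda>z. \<Theta> (a + \<phi> (fst z)) (snd z))"
    by (intro continuous_intros continuous_on_compose2[OF \<phi>]
        continuous_on_compose2[OF \<Theta>, of _ "\<lambda>z. (a + \<phi> (fst z), snd z)", simplified])
       (auto intro!: orthant_add a intro: orth)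
  have "continuous_on (cbox l u \<times> H) (\<lambda>z. deriv (\<Theta> (a + \<phi> (fst z))) (snd z))"
    using continuous_on_deriv_param[OF assms(1), of "cbox l u" "\<lambda>y. \<Theta> (a + \<phi> y)"] cont hol by simp
  note dcont = this
  show "(\<lambda>s. integral (cbox l u) (\<lambda>y. of_real (w y) * \<Theta> (a + \<phi> y) s)) holomorphic_on H"
    unfolding holomorphic_on_def
  proof
    fix s assume s: "s \<in> H"
    obtain r where r: "r > 0" "ball s r \<subseteq> H"
      using open_contains_ball assms(1) s by blast
    \<comment> \<open>The Leibniz rule is applied on a ball, a convex neighbourhood;
      differentiability at its centre is all that is asked.\<close>
    have "(\<lambda>s. integral (cbox l u) (\<lambda>y. of_real (w y) * \<Theta> (a + \<phi> y) s)) holomorphic_on ball s r"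
    proof (rule leibniz_rule_holomorphic)
      fix z y assume z: "z \<in> ball s r" and y: "y \<in> cbox l u"
      have "(\<Theta> (a + \<phi> y) has_field_derivative deriv (\<Theta> (a + \<phi> y)) z) (at z)"
        using holomorphic_derivI[OF hol[OF y] assms(1)] z r by auto
      then show "((\<lambda>x. of_real (w y) * \<Theta> (a + \<phi> y) x) has_field_derivative of_real (w y) * deriv (\<Theta> (a + \<phi> y)) z) (at z within ball s r)"
        by (rule has_field_derivative_at_within[OF DERIV_cmult])
    next
      fix z assume z: "z \<in> ball s r"
      show "(\<lambda>y. of_real (w y) * \<Theta> (a + \<phi> y) z) integrable_on cbox l u"
        using z r by (intro integrable_continuous continuous_intros w
          continuous_on_compose2[OF cont, of _ "\<lambda>y. (y, z)", simplified]) auto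
    next
      show "continuous_on (ball s r \<times> cbox l u) (\<lambda>(x, t). of_real (w t) * deriv (\<Theta> (a + \<phi> t)) x)"
        unfolding case_prod_beta using r
        by (intro continuous_intros continuous_on_compose2[OF w]
          continuous_on_compose2[OF dcont, of _ "\<lambda>y. (snd y, fst y)", simplified]) auto
    qed auto
    then have "(\<lambda>s. integral (cbox l u) (\<lambda>y. of_real (w y) * \<Theta> (a + \<phi> y) s)) field_differentiable at s"
      using r by (intro holomorphic_on_imp_differentiable_at[of _ "ball s r"]) auto
    then show "(\<lambda>s. integral (cbox l u) (\<lambda>y. of_real (w y) * \<Theta> (a + \<phi> y) s)) field_differentiable at s within H"
      by (rule field_differentiable_at_within)
  qed
qed

text \<open>Weierstrass M-test. The majorant may change with the disc in s but serves all shifts in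
  the unbounded orthant at once.\<close>

lemma hcont_infsum:
  assumes "open H" and \<Theta>: "\<And>k. hcont H (\<Theta> k)"
    and bound: "\<And>s0. s0 \<in> H \<Longrightarrow> \<exists>r M. r > 0 \<and> M summable_on UNIV \<and>
      (\<forall>k. \<forall>a\<in>orthant. \<forall>s\<in>cball s0 r. norm (\<Theta> k a s) \<le> M k)"
  shows "hcont H (\<lambda>a s. \<Sum>\<^sub>\<infinity>k\<in>UNIV. \<Theta> k a s)"
proof (rule hcont_local[OF assms(1)])
  fix s0 assume s0: "s0 \<in> H"
  obtain r1 where r1: "r1 > 0" "cball s0 r1 \<subseteq> H"
    using open_contains_cball assms(1) s0 by blast
  obtain r2 M where r2: "r2 > 0" "M summable_on UNIV"
      "\<And>k a s. a \<in> orthant \<Longrightarrow> s \<in> cball s0 r2 \<Longrightarrow> norm (\<Theta> k a s) \<le> M k"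
    using bound[OF s0] by blast
  define r where "r = min r1 r2"
  have r: "r > 0" "cball s0 r \<subseteq> H" "\<And>k a s. a \<in> orthant \<Longrightarrow> s \<in> cball s0 r \<Longrightarrow> norm (\<Theta> k a s) \<le> M k"
    using r1 r2 by (auto simp: r_def)
  have ul: "uniform_limit (orthant \<times> cball s0 r) (\<lambda>X y. \<Sum>k\<in>X. \<Theta> k (fst y) (snd y))
      (\<lambda>y. \<Sum>\<^sub>\<infinity>k\<in>UNIV. \<Theta> k (fst y) (snd y)) (finite_subsets_at_top UNIV)"
    by (rule Weierstrass_m_test_general[OF _ r2(2)]) (use r in auto)
  have "continuous_on (orthant \<times> cball s0 r) (\<lambda>y. \<Sum>\<^sub>\<infinity>k\<in>UNIV. \<Theta> k (fst y) (snd y))"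
  proof (rule uniform_limit_theorem[OF _ ul])
    have "continuous_on (orthant \<times> cball s0 r) (\<lambda>y. \<Theta> k (fst y) (snd y))" for k
      by (rule continuous_on_subset[OF hcont_continuous[OF \<Theta>]]) (use r in auto)
    then show "\<forall>\<^sub>F X in finite_subsets_at_top UNIV. continuous_on (orthant \<times> cball s0 r) (\<lambda>y. \<Sum>k\<in>X. \<Theta> k (fst y) (snd y))"
      by (intro always_eventually allI continuous_intros)
  qed auto
  then have c: "continuous_on (orthant \<times> ball s0 r) (\<lambda>y. \<Sum>\<^sub>\<infinity>k\<in>UNIV. \<Theta> k (fst y) (snd y))"
    by (rule continuous_on_subset) auto
  have "(\<lambda>s. \<Sum>\<^sub>\<infinity>k\<in>UNIV. \<Theta> k a s) holomorphic_on ball s0 r" if a: "a \<in> orthant" for a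
  proof (rule holomorphic_uniform_limit)
    show "uniform_limit (cball s0 r) (\<lambda>X s. \<Sum>k\<in>X. \<Theta> k a s) (\<lambda>s. \<Sum>\<^sub>\<infinity>k\<in>UNIV. \<Theta> k a s) (finite_subsets_at_top UNIV)"
      by (rule Weierstrass_m_test_general[OF _ r2(2)]) (use r a in auto)
    have h: "\<Theta> k a holomorphic_on H" for k using \<Theta>[of k] a by (simp add: hcont_def)
    show "\<forall>\<^sub>F X in finite_subsets_at_top UNIV. continuous_on (cball s0 r) (\<lambda>s. \<Sum>k\<in>X. \<Theta> k a s) \<and> (\<lambda>s. \<Sum>k\<in>X. \<Theta> k a s) holomorphic_on ball s0 r"
      using r(2) by (intro always_eventually allI conjI holomorphic_on_imp_continuous_on holomorphic_intros holomorphic_on_subset[OF h]) auto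
  qed auto
  with c have "hcont (ball s0 r) (\<lambda>a s. \<Sum>\<^sub>\<infinity>k\<in>UNIV. \<Theta> k a s)"
    by (simp add: hcont_def case_prod_beta)
  then show "\<exists>K. open K \<and> s0 \<in> K \<and> hcont K (\<lambda>a s. \<Sum>\<^sub>\<infinity>k\<in>UNIV. \<Theta> k a s)"
    using r by (intro exI[of _ "ball s0 r"]) auto
qed

text \<open>The stages agree wherever two of them are defined, so choosing the first stage whose
  domain contains s yields a single family on the whole plane that coincides with every
  stage.\<close>

lemma hcont_glue:
  assumes H: "\<And>m. open (H m)" "\<And>m. H m \<subseteq> H (Suc m)" "\<And>s. \<exists>m. s \<in> H m"
    and hc: "\<And>m. hcont (H m) (G m)"
    and step: "\<And>m a s. a \<in> orthant \<Longrightarrow> s \<in> H m \<Longrightarrow> G (Suc m) a s = G m a s"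
  shows "hcont UNIV (\<lambda>a s. G (LEAST m. s \<in> H m) a s)"
    and "a \<in> orthant \<Longrightarrow> s \<in> H m \<Longrightarrow> G (LEAST m. s \<in> H m) a s = G m a s"
proof -
  have eq: "G (LEAST m. s \<in> H m) a s = G m a s" if a: "a \<in> orthant" and s: "s \<in> H m" for a s m
  proof -
    define l where "l = (LEAST m. s \<in> H m)"
    have l: "s \<in> H l" "l \<le> m" using s LeastI[of "\<lambda>m. s \<in> H m"] Least_le[of "\<lambda>m. s \<in> H m"] by (auto simp: l_def)
    from \<open>l \<le> m\<close> have "s \<in> H m \<and> G m a s = G l a s"
    proof (induction m rule: dec_induct)
      case (step m)
      then show ?case using H(2)[of m] assms(5)[OF a, of s m] by auto
    qed (use l in auto)
    then show ?thesis by (simp add: l_def)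
  qed
  show "a \<in> orthant \<Longrightarrow> s \<in> H m \<Longrightarrow> G (LEAST m. s \<in> H m) a s = G m a s" by (rule eq)
  show "hcont UNIV (\<lambda>a s. G (LEAST m. s \<in> H m) a s)"
  proof (rule hcont_local)
    fix s :: complex
    obtain m where m: "s \<in> H m" using H by blast
    have "hcont (H m) (\<lambda>a s. G (LEAST m. s \<in> H m) a s)"
      by (rule hcont_cong[OF hc[of m]]) (simp add: eq)
    then show "\<exists>K. open K \<and> s \<in> K \<and> hcont K (\<lambda>a s. G (LEAST m. s \<in> H m) a s)"
      using H(1) m by blast
  qed simp
qed

text \<open>The identity theorem at a fixed shift; it carries identities proved for convergent
  series over to the continuations.\<close>

lemma entire_eqI:
  assumes "hcont UNIV A" "hcont UNIV B" "open H" "H \<noteq> {}" "\<And>s. s \<in> H \<Longrightarrow> A a s = B a s" "a \<in> orthant"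
  shows "A a s = B a s"
  by (rule analytic_continuation_open[of H UNIV "A a" "B a"]) (use assms in \<open>auto simp: hcont_def\<close>)

section \<open>Complex limits and logarithms\<close>

text \<open>A continuous logarithm is locally the principal logarithm of \<open>g t / g t0\<close>
  plus a constant. The quotient is near 1, away from the branch cut, where \<open>Ln\<close> is
  differentiable.\<close>

lemma has_vector_derivative_log:
  fixes q g :: "real \<Rightarrow> complex"
  assumes q: "continuous_on S q" and e: "\<And>t. t \<in> S \<Longrightarrow> exp (q t) = g t"
    and g: "(g has_vector_derivative g') (at t0 within S)" and t0: "t0 \<in> S"
  shows "(q has_vector_derivative g' / g t0) (at t0 within S)"
proof -
  have g0: "g t0 \<noteq> 0" using e[OF t0] by (metis exp_not_eq_zero)
  have "((\<lambda>z. Ln (z / g t0)) has_field_derivative 1 / g t0) (at (g t0))"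
    using g0 by (auto intro!: derivative_eq_intros)
  then have "((\<lambda>z. Ln (z / g t0)) has_field_derivative 1 / g t0) (at (g t0) within g ` S)"
    by (rule has_field_derivative_at_within)
  from field_vector_diff_chain_within[OF g this]
  have "((\<lambda>t. Ln (g t / g t0)) has_vector_derivative g' / g t0) (at t0 within S)"
    by (simp add: o_def)
  then have der: "((\<lambda>t. q t0 + Ln (g t / g t0)) has_vector_derivative g' / g t0) (at t0 within S)"
    by (intro derivative_eq_intros) auto
  \<comment> \<open>An oscillation of \<open>q\<close> below pi forces
    \<open>Ln (exp (q t - q t0))\<close> to return its argument.\<close>
  obtain \<delta> where \<delta>: "\<delta> > 0" "\<And>t. t \<in> S \<Longrightarrow> dist t t0 < \<delta> \<Longrightarrow> dist (q t) (q t0) < pi"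
    using q t0 pi_gt_zero unfolding continuous_on_iff by blast
  show ?thesis
    using der[unfolded has_vector_derivative_def] \<delta>(1) t0 unfolding has_vector_derivative_def
  proof (rule has_derivative_transform_within)
    fix t assume t: "t \<in> S" "dist t t0 < \<delta>"
    have "\<bar>Im (q t - q t0)\<bar> < pi"
      using \<delta>(2)[OF t] abs_Im_le_cmod[of "q t - q t0"] by (simp add: dist_norm)
    then have "Ln (exp (q t - q t0)) = q t - q t0" by (intro Ln_exp) auto
    moreover have "exp (q t - q t0) = g t / g t0" using e t t0 by (simp add: exp_diff)
    ultimately show "q t0 + Ln (g t / g t0) = q t" by simp
  qed
qed

text \<open>L'Hospital's rule at a common zero. It is meant for the quotient of two reciprocal Gamma
  functions at a non-positive integer s.\<close>

lemma tendsto_divide_common_zero: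
  fixes f g :: "complex \<Rightarrow> complex"
  assumes f: "(f has_field_derivative A) (at z)" "f z = 0"
    and g: "(g has_field_derivative B) (at z)" "g z = 0" "B \<noteq> 0"
  shows "((\<lambda>w. f w / g w) \<longlongrightarrow> A / B) (at z)"
proof -
  have "((\<lambda>w. (f w - f z) / (w - z)) \<longlongrightarrow> A) (at z)" "((\<lambda>w. (g w - g z) / (w - z)) \<longlongrightarrow> B) (at z)"
    using f(1) g(1) by (simp_all add: has_field_derivative_iff)
  from tendsto_divide[OF this g(3)]
  have "((\<lambda>w. (f w / (w - z)) / (g w / (w - z))) \<longlongrightarrow> A / B) (at z)" using f g by simp
  moreover have "\<forall>\<^sub>F w in at z. (f w / (w - z)) / (g w / (w - z)) = f w / g w"
    by (auto simp: eventually_at_filter)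
  ultimately show ?thesis by (rule Lim_transform_eventually)
qed

section \<open>Lattice sums and integrals over the orthant\<close>

lemma has_sum_finite_sum:
  fixes f :: "'i \<Rightarrow> 'k \<Rightarrow> 'b::topological_comm_monoid_add"
  assumes "\<And>i. i \<in> I \<Longrightarrow> (f i has_sum S i) A"
  shows "((\<lambda>k. \<Sum>i\<in>I. f i k) has_sum (\<Sum>i\<in>I. S i)) A"
  using assms
proof (induction I rule: infinite_finite_induct)
  case (insert i I)
  then show ?case by (simp add: has_sum_add)
qed simp_all

lemma summable_on_finite_sum:
  fixes f :: "'i \<Rightarrow> 'k \<Rightarrow> 'b::{topological_comm_monoid_add, t2_space}"
  assumes "\<And>i. i \<in> I \<Longrightarrow> f i summable_on A"
  shows "(\<lambda>k. \<Sum>i\<in>I. f i k) summable_on A"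
  unfolding summable_on_def
  by (rule exI, rule has_sum_finite_sum, rule has_sum_infsum, rule assms)

lemma has_sum_diff:
  fixes f g :: "'k \<Rightarrow> 'b::real_normed_vector"
  assumes "(f has_sum a) A" "(g has_sum b) A"
  shows "((\<lambda>k. f k - g k) has_sum (a - b)) A"
  using has_sum_add[OF assms(1), of "\<lambda>k. - g k" "- b"] assms(2) by (simp add: has_sum_uminus)

definition lattice_vec :: "nat^'n \<Rightarrow> real^'n::finite" where
  "lattice_vec k = (\<chi> i. real (k $ i))"

lemma lattice_vec_orthant [simp]: "lattice_vec k \<in> orthant"
  by (simp add: lattice_vec_def orthant_def)

text \<open>The product of the 1 + k_i is at most (1 + |k|)^p, so the term is bounded by the product
  of the (1 + k_i)^(-q/p). Since q/p > 1, the finite sums are bounded by the p-th power of a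
  convergent one-dimensional series.\<close>

lemma summable_on_lattice_powr:
  assumes q: "q > real CARD('n::finite)"
  shows "(\<lambda>k::nat^'n. (1 + norm (lattice_vec k)) powr (- q)) summable_on UNIV"
proof (rule nonneg_bdd_above_summable_on)
  define p where "p = real CARD('n)"
  have p: "p > 0" by (simp add: p_def)
  define b where "b = (\<lambda>j::nat. (1 + real j) powr (- (q / p)))"
  have "summable (\<lambda>n. real n powr (- (q / p)))"
    using q p by (subst summable_real_powr_iff) (simp add: p_def)
  then have sb: "summable b"
    using summable_Suc_iff[of "\<lambda>n. real n powr (- (q / p))"] by (simp add: b_def add.commute)
  have le: "(1 + norm (lattice_vec k)) powr (- q) \<le> (\<Prod>i\<in>UNIV. b (k $ i))" for k :: "nat^'n"
  proof -
    have "(\<Prod>i\<in>UNIV. 1 + real (k $ i)) \<le> (\<Prod>i\<in>(UNIV::'n set). 1 + norm (lattice_vec k))"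
      using component_le_norm_cart[of "lattice_vec k"] by (intro prod_mono) (auto simp: lattice_vec_def)
    then have "(\<Prod>i\<in>UNIV. 1 + real (k $ i)) \<le> (1 + norm (lattice_vec k)) powr p"
      by (simp add: p_def powr_realpow add_pos_nonneg)
    then have "((1 + norm (lattice_vec k)) powr p) powr (- (q / p)) \<le> (\<Prod>i\<in>UNIV. 1 + real (k $ i)) powr (- (q / p))"
      using q p by (intro powr_mono2') (auto intro!: prod_pos simp: p_def)
    also have "\<dots> = (\<Prod>i\<in>UNIV. b (k $ i))"
      unfolding b_def by (rule prod_powr_distrib)
    finally show ?thesis using p by (simp add: powr_powr)
  qed
  show "bdd_above (sum (\<lambda>k::nat^'n. (1 + norm (lattice_vec k)) powr (- q)) ` {F. F \<subseteq> UNIV \<and> finite F})"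
  proof (rule bdd_aboveI)
    fix y assume "y \<in> sum (\<lambda>k::nat^'n. (1 + norm (lattice_vec k)) powr (- q)) ` {F. F \<subseteq> UNIV \<and> finite F}"
    then obtain F :: "(nat^'n) set" where F: "finite F" "y = (\<Sum>k\<in>F. (1 + norm (lattice_vec k)) powr (- q))" by auto
    \<comment> \<open>An exclusive bound for all coordinates of the points in \<open>F\<close>,
      which encloses \<open>F\<close> in a cube; the inserted 0 covers an empty
      \<open>F\<close>.\<close>
    define N where "N = Suc (Max (insert 0 ((\<lambda>(k, i). k $ i) ` (F \<times> UNIV))))"
    have N: "k $ i < N" if "k \<in> F" for k i
      using F that unfolding N_def less_Suc_eq_le by (intro Max_ge) force+
    have "y \<le> (\<Sum>k\<in>F. \<Prod>i\<in>UNIV. b (k $ i))" unfolding F by (intro sum_mono le)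
    also have "\<dots> = (\<Sum>g\<in>vec_nth ` F. \<Prod>i\<in>UNIV. b (g i))"
      by (subst sum.reindex) (auto simp: inj_on_def vec_eq_iff)
    also have "\<dots> \<le> (\<Sum>g\<in>PiE (UNIV::'n set) (\<lambda>_. {..<N}). \<Prod>i\<in>UNIV. b (g i))"
      by (intro sum_mono2) (auto simp: PiE_iff N b_def finite_PiE intro!: prod_nonneg)
    also have "\<dots> = (\<Prod>i\<in>(UNIV::'n set). \<Sum>j<N. b j)"
      by (rule prod_sum_PiE[symmetric]) auto
    also have "\<dots> \<le> (\<Prod>i\<in>(UNIV::'n set). suminf b)"
      by (intro prod_mono conjI sum_nonneg sum_le_suminf sb) (auto simp: b_def)
    finally show "y \<le> (\<Prod>i\<in>(UNIV::'n set). suminf b)" .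
  qed
qed simp

lemma has_sum_integral_cbox:
  fixes F :: "'k \<Rightarrow> 'b::euclidean_space \<Rightarrow> complex"
  assumes "\<And>k. continuous_on (cbox l u) (F k)"
    and "\<And>k t. t \<in> cbox l u \<Longrightarrow> norm (F k t) \<le> M k" "M summable_on UNIV"
  shows "((\<lambda>k. integral (cbox l u) (F k)) has_sum integral (cbox l u) (\<lambda>t. \<Sum>\<^sub>\<infinity>k\<in>UNIV. F k t)) UNIV"
proof -
  have "uniform_limit (cbox l u) (\<lambda>X t. \<Sum>k\<in>X. F k t) (\<lambda>t. \<Sum>\<^sub>\<infinity>k\<in>UNIV. F k t) (finite_subsets_at_top UNIV)"
    by (rule Weierstrass_m_test_general[OF _ assms(3)]) (use assms in auto)
  then obtain I J where I: "\<And>X. ((\<lambda>t. \<Sum>k\<in>X. F k t) has_integral I X) (cbox l u)"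
    and J: "((\<lambda>t. \<Sum>\<^sub>\<infinity>k\<in>UNIV. F k t) has_integral J) (cbox l u)" and lim: "(I \<longlongrightarrow> J) (finite_subsets_at_top UNIV)"
    by (rule uniform_limit_integral_cbox) (auto intro!: continuous_intros assms)
  have "I X = (\<Sum>k\<in>X. integral (cbox l u) (F k))" if "finite X" for X
    using integral_unique[OF I[of X]] integral_sum[OF that, of F "cbox l u"]
    by (simp add: integrable_continuous assms)
  then have "\<forall>\<^sub>F X in finite_subsets_at_top UNIV. I X = (\<Sum>k\<in>X. integral (cbox l u) (F k))"
    by (simp add: eventually_finite_subsets_at_top_weakI)
  with lim J show ?thesis
    by (simp add: has_sum_def integral_unique tendsto_cong)
qed

lemma integral_shift_unit_cube:
  fixes h :: "real^'n::finite \<Rightarrow> complex"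
  assumes "continuous_on (cbox c (c + 1)) h"
  shows "(h has_integral integral (cbox 0 1) (\<lambda>t. h (c + t))) (cbox c (c + 1))"
proof -
  obtain I where I: "(h has_integral I) (cbox c (c + 1))"
    using integrable_continuous[OF assms] by (auto simp: integrable_on_def)
  from has_integral_affinity[OF this, of 1 c]
  have "((\<lambda>t. h (t + c)) has_integral I) ((\<lambda>x. x - c) ` cbox c (c + 1))" by simp
  also have "(\<lambda>x. x - c) ` cbox c (c + 1) = cbox 0 1"
    using cbox_translation[of "- c" c "c + 1"] by (simp add: add.commute)
  finally show ?thesis using I by (simp add: integral_unique add.commute)
qed

text \<open>The orthant is tiled by unit cells, and \<open>M k\<close> bounds the integral of the
  norm over the k-th cell. Dominated summation then gives integrability and the value
  together.\<close>

lemma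
  fixes h :: "real^'n::finite \<Rightarrow> complex"
  assumes cont: "continuous_on orthant h" and M: "M summable_on UNIV"
    and le: "\<And>k t. t \<in> cbox 0 1 \<Longrightarrow> norm (h (lattice_vec k + t)) \<le> M k"
  shows orthant_integrable: "set_integrable lborel orthant h"
    and orthant_integral_has_sum: "((\<lambda>k. integral (cbox 0 1) (\<lambda>t. h (lattice_vec k + t))) has_sum (LINT x:orthant|lborel. h x)) UNIV"
proof -
  \<comment> \<open>Half-open cells, so that the coordinatewise floor assigns each point of the
    orthant to exactly one of them.\<close>
  define C where "C = (\<lambda>k::nat^'n. {x::real^'n. \<forall>i. real (k $ i) \<le> x $ i \<and> x $ i < real (k $ i) + 1})"
  have C_meas [measurable]: "C k \<in> sets borel" for k unfolding C_def by measurable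
  have C_sub: "C k \<subseteq> cbox (lattice_vec k) (lattice_vec k + 1)" for k
    by (intro subsetI) (simp add: C_def mem_box_cart lattice_vec_def less_imp_le)
  have C_sup: "box (lattice_vec k) (lattice_vec k + 1) \<subseteq> C k" for k
    by (intro subsetI) (simp add: C_def mem_box_cart lattice_vec_def less_imp_le)
  have cbox_orth: "cbox (lattice_vec k) (lattice_vec k + 1) \<subseteq> orthant" for k :: "nat^'n"
    by (auto simp: orthant_def mem_box_cart lattice_vec_def) (meson of_nat_0_le_iff order_trans)
  have C_uniq: "k = k'" if "x \<in> C k" "x \<in> C k'" for x k k'
  proof -
    have "k $ i = k' $ i" for i
    proof -
      have "\<lfloor>x $ i\<rfloor> = int (k $ i)" "\<lfloor>x $ i\<rfloor> = int (k' $ i)"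
        using that by (auto simp: C_def intro!: floor_unique)
      then show ?thesis by simp
    qed
    then show ?thesis by (simp add: vec_eq_iff)
  qed
  have C_ex: "\<exists>k. x \<in> C k" if "x \<in> orthant" for x
    using that by (intro exI[of _ "\<chi> i. nat \<lfloor>x $ i\<rfloor>"]) (auto simp: C_def orthant_def)
  have hcont: "continuous_on (cbox (lattice_vec k) (lattice_vec k + 1)) h" for k
    by (rule continuous_on_subset[OF cont cbox_orth])
  have int_cbox: "set_integrable lborel (cbox (lattice_vec k) (lattice_vec k + 1)) h" for k
    unfolding set_integrable_def by (rule borel_integrable_compact[OF _ hcont]) auto
  have int_C: "set_integrable lborel (C k) h" for k
    by (rule set_integrable_subset[OF int_cbox _ C_sub]) simp
  define J where "J = (\<lambda>k. integral (cbox 0 1) (\<lambda>t. h (lattice_vec k + t)))"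
  have LINT_C: "(LINT x:C k|lborel. h x) = J k" for k
  proof -
    \<comment> \<open>Cell and closed cube differ only on the frontier of the cube, which is
      negligible.\<close>
    have neg: "negligible {x \<in> cbox (lattice_vec k) (lattice_vec k + 1) - C k. h x \<noteq> 0}"
      by (rule negligible_subset[OF negligible_frontier_interval[of "lattice_vec k" "lattice_vec k + 1"]]) (use C_sup in auto)
    have "{x \<in> C k - cbox (lattice_vec k) (lattice_vec k + 1). h x \<noteq> 0} = {}" using C_sub by auto
    then have "negligible {x \<in> C k - cbox (lattice_vec k) (lattice_vec k + 1). h x \<noteq> 0}" by (simp only: negligible_empty)
    from has_integral_spike_set_eq[OF this neg, of "J k"]
    have "(h has_integral J k) (C k)"
      using integral_shift_unit_cube[OF hcont[of k]] by (simp add: J_def)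
    then show ?thesis
      using set_borel_integral_eq_integral(2)[OF int_C[of k]] by (simp add: integral_unique)
  qed
  have le': "norm (h x) \<le> M k" if "x \<in> C k" for x k
  proof -
    have "x \<in> cbox (lattice_vec k) (lattice_vec k + 1)" using C_sub that by blast
    then have "x - lattice_vec k \<in> cbox 0 1" by (simp add: mem_box_cart algebra_simps)
    from le[OF this, of k] show ?thesis by simp
  qed
  have M0: "M k \<ge> 0" for k using le[of 0 k] by (force simp: mem_box_cart intro: order_trans[OF norm_ge_zero])
  \<comment> \<open>Infinity of the lattice gives a bijective enumeration \<open>e\<close> by
    natural numbers, so the theorems on series of integrable functions apply.\<close>
  have "infinite (UNIV :: (nat^'n) set)"
  proof
    assume "finite (UNIV :: (nat^'n) set)"
    then have "finite (range (vec :: nat \<Rightarrow> nat^'n))" by (rule finite_subset[rotated]) simp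
    then show False by (auto simp: inj_on_def vec_eq_iff dest!: finite_imageD)
  qed
  then obtain \<iota> :: "nat^'n \<Rightarrow> nat" where "bij_betw \<iota> UNIV UNIV"
    by (rule countableE_infinite[OF countableI_type])
  then have "bij_betw (inv_into UNIV \<iota>) UNIV UNIV" by (rule bij_betw_inv_into)
  then obtain e :: "nat \<Rightarrow> nat^'n" where e: "bij_betw e UNIV UNIV" by blast
  have Me: "summable (\<lambda>n. M (e n))"
    using M e summable_on_reindex_bij_betw[OF e, of M] by (auto intro: summable_on_imp_summable)
  define F where "F = (\<lambda>n x. indicator (C (e n)) x *\<^sub>R h x)"
  have F_int: "integrable lborel (F n)" for n
    using int_C[of "e n"] by (simp add: F_def set_integrable_def)
  have F_zero: "F m x = 0" if "x \<in> C (e n)" "m \<noteq> n" for m n x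
  proof -
    have "x \<notin> C (e m)" using C_uniq[OF that(1), of "e m"] that(2) e by (auto simp: bij_betw_def inj_on_def)
    then show ?thesis by (simp add: F_def)
  qed
  have F_sum: "suminf (\<lambda>n. F n x) = indicator orthant x *\<^sub>R h x \<and> summable (\<lambda>n. norm (F n x))" for x
  proof (cases "x \<in> orthant")
    case True
    then obtain n where n: "x \<in> C (e n)"
      using C_ex e by (metis bij_betw_imp_surj_on rangeE UNIV_I)
    have "suminf (\<lambda>m. F m x) = (\<Sum>m\<in>{n}. F m x)" by (rule suminf_finite) (use F_zero[OF n] in auto)
    moreover have "summable (\<lambda>n. norm (F n x))" by (rule summable_finite[of "{n}"]) (use F_zero[OF n] in auto)
    ultimately show ?thesis using n True by (simp add: F_def)
  next
    case False
    then have "x \<notin> C (e n)" for n using C_sub[of "e n"] cbox_orth[of "e n"] by blast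
    then have "F n x = 0" for n by (simp add: F_def)
    then show ?thesis using False by simp
  qed
  have F_norm: "(\<integral>x. norm (F n x) \<partial>lborel) \<le> M (e n)" for n
  proof -
    have "(\<integral>x. norm (F n x) \<partial>lborel) \<le> (\<integral>x. M (e n) * indicator (cbox (lattice_vec (e n)) (lattice_vec (e n) + 1)) x \<partial>lborel)"
    proof (rule integral_mono)
      show "integrable lborel (\<lambda>x. M (e n) * indicat_real (cbox (lattice_vec (e n)) (lattice_vec (e n) + 1)) x)"
        by (intro integrable_mult_right integrable_real_indicator) (simp_all add: emeasure_bounded_finite[unfolded infinity_ennreal_def])
      show "norm (F n x) \<le> M (e n) * indicator (cbox (lattice_vec (e n)) (lattice_vec (e n) + 1)) x" for x
        using le'[of x "e n"] C_sub[of "e n"] M0 by (auto simp: F_def indicator_def)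
    qed (use F_int in auto)
    also have "\<dots> = M (e n)"
    proof -
      have "lattice_vec (e n) \<in> cbox (lattice_vec (e n)) (lattice_vec (e n) + 1)" by (simp add: mem_box_cart)
      then have "cbox (lattice_vec (e n)) (lattice_vec (e n) + 1) \<noteq> {}" by blast
      then show ?thesis by (simp add: content_cbox_if_cart)
    qed
    finally show ?thesis .
  qed
  have F_norm_sum: "summable (\<lambda>n. \<integral>x. norm (F n x) \<partial>lborel)"
    by (rule summable_comparison_test_ev[OF _ Me]) (use F_norm in auto)
  have "integrable lborel (\<lambda>x. suminf (\<lambda>n. F n x))"
    using F_sum F_int F_norm_sum by (intro integrable_suminf) auto
  then show "set_integrable lborel orthant h"
    using F_sum by (simp add: set_integrable_def)
  have "(\<lambda>n. integral\<^sup>L lborel (F n)) sums (\<integral>x. suminf (\<lambda>n. F n x) \<partial>lborel)"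
    using F_sum F_int F_norm_sum by (intro sums_integral) auto
  then have "(\<lambda>n. J (e n)) sums (LINT x:orthant|lborel. h x)"
    using F_sum LINT_C by (simp add: set_lebesgue_integral_def F_def)
  moreover have "summable (\<lambda>n. norm (J (e n)))"
  proof (rule summable_comparison_test_ev[OF _ Me], rule always_eventually, rule allI)
    fix n
    have "norm (integral\<^sup>L lborel (F n)) \<le> (\<integral>x. norm (F n x) \<partial>lborel)" by (rule integral_norm_bound)
    with F_norm[of n] LINT_C[of "e n"] show "norm (norm (J (e n))) \<le> M (e n)"
      by (simp add: set_lebesgue_integral_def F_def)
  qed
  ultimately have "((\<lambda>n. J (e n)) has_sum (LINT x:orthant|lborel. h x)) UNIV"
    by (intro norm_summable_imp_has_sum)
  then show "((\<lambda>k. integral (cbox 0 1) (\<lambda>t. h (lattice_vec k + t))) has_sum (LINT x:orthant|lborel. h x)) UNIV"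
    using has_sum_reindex_bij_betw[OF e, of J] by (simp add: J_def)
qed

text \<open>The orthant is a cone, so a dilation preserves it and only the Jacobian remains.\<close>

lemma orthant_integral_scale:
  fixes h :: "real^'n::finite \<Rightarrow> complex"
  assumes c: "c > 0" and "set_integrable lborel orthant h"
  shows "(LINT x:orthant|lborel. h (c *\<^sub>R x)) * of_real c ^ CARD('n) = (LINT x:orthant|lborel. h x)"
proof -
  define g where "g = (\<lambda>x. indicator orthant x *\<^sub>R h x)"
  have [measurable]: "g \<in> borel_measurable borel"
    using borel_measurable_integrable[OF assms(2)[unfolded set_integrable_def]] by (simp add: g_def)
  have ind: "indicator orthant (c *\<^sub>R x) = (indicator orthant x :: real)" for x :: "real^'n"
    using c by (auto simp: indicator_def orthant_def zero_le_mult_iff)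
  have "integral\<^sup>L lborel g = integral\<^sup>L (density (distr lborel borel (\<lambda>x. 0 + c *\<^sub>R x)) (\<lambda>_. \<bar>c\<bar>^DIM(real^'n))) g"
    using lborel_affine[of c "0::real^'n"] c by simp
  also have "\<dots> = (\<integral>x. \<bar>c\<bar>^DIM(real^'n) *\<^sub>R g (0 + c *\<^sub>R x) \<partial>lborel)"
    by (subst integral_density, simp, simp, simp, subst integral_distr) auto
  also have "\<dots> = of_real c ^ CARD('n) * (\<integral>x. g (c *\<^sub>R x) \<partial>lborel)"
    using c by (simp add: scaleR_conv_of_real)
  finally show ?thesis
    by (simp add: set_lebesgue_integral_def g_def ind mult.commute)
qed

text \<open>The flux of a decaying field \<open>G(x) x\<close> through the boundary of the cone vanishes, so its divergence
  integrates to 0. Differentiating the scaling invariance of the integral at scale 1 avoids surface integrals.\<close>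

lemma orthant_integral_euler:
  fixes G K :: "real^'n::finite \<Rightarrow> complex"
  assumes contG: "continuous_on orthant G" and contK: "continuous_on orthant K"
    and q: "q > real CARD('n)"
    and G: "\<And>x. x \<in> orthant \<Longrightarrow> norm (G x) \<le> C * (1 + norm x) powr (- q)"
    and K: "\<And>x. x \<in> orthant \<Longrightarrow> norm (K x) \<le> C * (1 + norm x) powr (- q)"
    and der: "\<And>x c. x \<in> orthant \<Longrightarrow> c \<in> {1..2} \<Longrightarrow>
      ((\<lambda>c. G (c *\<^sub>R x)) has_vector_derivative K (c *\<^sub>R x) / of_real c) (at c within {1..2})"
  shows "(LINT x:orthant|lborel. of_nat CARD('n) * G x + K x) = 0"
proof -
  define p where "p = CARD('n)"
  define B where "B = (\<lambda>x::real^'n. (1 + norm x) powr (- q))"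
  have B_anti: "B y \<le> B x" if "norm x \<le> norm y" for x y :: "real^'n"
    unfolding B_def using that q by (intro powr_mono2') (auto simp: add_pos_nonneg)
  have C: "C \<ge> 0"
  proof -
    have "0 \<le> C * (1 + norm (0::real^'n)) powr (- q)" using G[of 0] by (rule order_trans[OF norm_ge_zero]) simp
    then show ?thesis by simp
  qed
  have sumB: "(\<lambda>k::nat^'n. D * B (lattice_vec k)) summable_on UNIV" for D
    unfolding B_def by (intro summable_on_cmult_right summable_on_lattice_powr q)
  have kvn: "norm (lattice_vec k) \<le> norm (lattice_vec k + t)" if "t \<in> cbox 0 1" for k and t :: "real^'n"
    by (rule norm_le_norm_add_orthant[OF lattice_vec_orthant cbox01_orthant[OF that]])
  have integrable: "set_integrable lborel orthant h"
    if "continuous_on orthant h" "\<And>x. x \<in> orthant \<Longrightarrow> norm (h x) \<le> D * B x" "D \<ge> 0" for h :: "real^'n \<Rightarrow> complex" and D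
  proof (rule orthant_integrable[OF that(1) sumB])
    fix k and t :: "real^'n" assume t: "t \<in> cbox 0 1"
    then have "norm (h (lattice_vec k + t)) \<le> D * B (lattice_vec k + t)" by (intro that(2) orthant_add[OF lattice_vec_orthant] cbox01_orthant)
    also have "\<dots> \<le> D * B (lattice_vec k)" by (intro mult_left_mono B_anti kvn[OF t] that(3))
    finally show "norm (h (lattice_vec k + t)) \<le> D * B (lattice_vec k)" .
  qed
  have GB: "norm (G x) \<le> C * B x" and KB: "norm (K x) \<le> C * B x" if "x \<in> orthant" for x
    using G[OF that] K[OF that] by (simp_all add: B_def)
  \<comment> \<open>Scales tending to 1 from above. With scale at least 1 the decay bound at
    \<open>c *\<^sub>R x\<close> is no worse than at \<open>x\<close>, which is why the derivative
    is taken on [1, 2].\<close>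
  define c where "c = (\<lambda>n. 1 + 1 / real (Suc n))"
  have c: "c n > 0" "c n \<in> {1..2}" "c n \<noteq> 1" for n by (auto simp: c_def field_simps)
  \<comment> \<open>The integrand after dilation by \<open>r\<close>, Jacobian included: its
    integral over the orthant does not depend on \<open>r\<close>, and at \<open>r = 1\<close> its
    derivative is p G + K.\<close>
  define \<psi> where "\<psi> = (\<lambda>x r. of_real r ^ p * G (r *\<^sub>R x))"
  define \<psi>' where "\<psi>' = (\<lambda>x r. of_real r ^ (p - 1) * (of_nat p * G (r *\<^sub>R x) + K (r *\<^sub>R x)))"
  have p: "p > 0" by (simp add: p_def)
  have \<psi>: "(\<psi> x has_vector_derivative \<psi>' x r) (at r within {1..2})" if "x \<in> orthant" "r \<in> {1..2}" for x r
  proof -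
    have "((\<lambda>r. complex_of_real r ^ p) has_vector_derivative (of_nat p * of_real r ^ (p - 1))) (at r within {1..2})"
      by (rule has_vector_derivative_eq_rhs[OF has_vector_derivative_real_field[of "\<lambda>z. z ^ p"]]) 
         (auto intro!: derivative_eq_intros)
    from has_vector_derivative_mult[OF this der[OF that]]
    have "(\<psi> x has_vector_derivative (of_real r ^ p * (K (r *\<^sub>R x) / of_real r) + of_nat p * of_real r ^ (p - 1) * G (r *\<^sub>R x))) (at r within {1..2})"
      by (simp add: \<psi>_def)
    moreover have "of_real r ^ p * (K (r *\<^sub>R x) / of_real r) = of_real r ^ (p - 1) * K (r *\<^sub>R x)"
      using p that by (cases p) auto
    ultimately show ?thesis by (simp add: \<psi>'_def algebra_simps)
  qed
  have \<psi>'_le: "norm (\<psi>' x r) \<le> 2 ^ (p - 1) * ((real p + 1) * (C * B x))" if x: "x \<in> orthant" and r: "r \<in> {1..2}" for x r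
  proof -
    have rx: "r *\<^sub>R x \<in> orthant" using x r by (intro orthant_scaleR) auto
    have "norm x \<le> norm (r *\<^sub>R x)" using r mult_right_mono[of 1 r "norm x"] by simp
    then have "C * B (r *\<^sub>R x) \<le> C * B x" using C by (intro mult_left_mono B_anti)
    then have GK: "norm (G (r *\<^sub>R x)) \<le> C * B x" "norm (K (r *\<^sub>R x)) \<le> C * B x"
      using G[OF rx] K[OF rx] unfolding B_def by auto
    have "norm (of_nat p * G (r *\<^sub>R x) + K (r *\<^sub>R x)) \<le> real p * (C * B x) + C * B x"
      using GK by (intro order_trans[OF norm_triangle_ineq] add_mono) (auto simp: norm_mult intro: mult_left_mono)
    then have "norm (of_nat p * G (r *\<^sub>R x) + K (r *\<^sub>R x)) \<le> (real p + 1) * (C * B x)" by (simp add: algebra_simps)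
    moreover have "norm (complex_of_real r ^ (p - 1)) \<le> 2 ^ (p - 1)"
      using r by (simp add: norm_power power_mono)
    ultimately show ?thesis unfolding \<psi>'_def norm_mult by (intro mult_mono) auto
  qed
  \<comment> \<open>The difference quotients of \<open>\<psi>\<close> at scale 1. Each has integral
    0, and dominated convergence passes this to the derivative.\<close>
  define \<phi> where "\<phi> = (\<lambda>n x. (\<psi> x (c n) - \<psi> x 1) / of_real (c n - 1))"
  \<comment> \<open>The bound on the derivative \<open>\<psi>'\<close> over [1, 2]: 2^(p-1) bounds
    the power of \<open>r\<close>, and p + 1 counts the p copies of G and the one K.\<close>
  define E where "E = 2 ^ (p - 1) * (real p + 1) * C"
  have E: "E \<ge> 0" using C by (simp add: E_def)
  have \<phi>_le: "norm (\<phi> n x) \<le> E * B x" if x: "x \<in> orthant" for n x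
  proof -
    have "norm (\<psi> x (c n) - \<psi> x 1) \<le> (E * B x) * norm (c n - 1)"
    proof (rule differentiable_bound[of "{1..2}" "\<psi> x" "\<lambda>r h. h *\<^sub>R \<psi>' x r"])
      show "onorm (\<lambda>h. h *\<^sub>R \<psi>' x r) \<le> E * B x" if "r \<in> {1..2}" for r
      proof (rule onorm_le)
        fix h :: real
        show "norm (h *\<^sub>R \<psi>' x r) \<le> E * B x * norm h"
          using mult_right_mono[OF \<psi>'_le[OF x that], of "norm h"] by (simp add: E_def mult_ac)
      qed
    qed (use \<psi>[OF x] c in \<open>auto simp: has_vector_derivative_def\<close>)
    then show ?thesis using c(3)[of n] by (simp add: \<phi>_def norm_divide pos_divide_le_eq del: of_real_diff)
  qed
  have \<phi>_lim: "(\<lambda>n. \<phi> n x) \<longlonglongrightarrow> of_nat p * G x + K x" if x: "x \<in> orthant" for x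
  proof (rule LIMSEQ_I)
    fix \<epsilon> :: real assume \<epsilon>: "\<epsilon> > 0"
    have "(\<psi> x has_derivative (\<lambda>h. h *\<^sub>R \<psi>' x 1)) (at 1 within {1..2})"
      using \<psi>[OF x, of 1] by (simp add: has_vector_derivative_def)
    then obtain d where d: "d > 0" "\<And>r. r \<in> {1..2} \<Longrightarrow> norm (r - 1) < d \<Longrightarrow>
        norm (\<psi> x r - \<psi> x 1 - (r - 1) *\<^sub>R \<psi>' x 1) \<le> \<epsilon> / 2 * norm (r - 1)"
      unfolding has_derivative_within_alt using half_gt_zero[OF \<epsilon>] by blast
    obtain N where N: "1 / real (Suc N) < d" using d(1) reals_Archimedean by (auto simp: inverse_eq_divide)
    show "\<exists>N. \<forall>n\<ge>N. norm (\<phi> n x - (of_nat p * G x + K x)) < \<epsilon>"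
    proof (intro exI allI impI)
      fix n assume "n \<ge> N"
      then have "1 / real (Suc n) \<le> 1 / real (Suc N)" by (intro divide_left_mono) auto
      then have cd: "norm (c n - 1) < d" using N by (simp add: c_def)
      have cp: "c n - 1 > 0" by (simp add: c_def)
      have "\<phi> n x - (of_nat p * G x + K x) = (\<psi> x (c n) - \<psi> x 1 - (c n - 1) *\<^sub>R \<psi>' x 1) / of_real (c n - 1)"
        using c(3)[of n] by (simp add: \<phi>_def \<psi>'_def diff_divide_distrib scaleR_conv_of_real)
      then have "norm (\<phi> n x - (of_nat p * G x + K x)) = norm (\<psi> x (c n) - \<psi> x 1 - (c n - 1) *\<^sub>R \<psi>' x 1) / (c n - 1)"
        using cp by (simp add: norm_divide del: of_real_diff)
      also have "\<dots> \<le> \<epsilon> / 2"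
        using d(2)[OF c(2) cd] cp by (simp add: pos_divide_le_eq)
      finally show "norm (\<phi> n x - (of_nat p * G x + K x)) < \<epsilon>" using \<epsilon> by simp
    qed
  qed
  have intG: "set_integrable lborel orthant G"
    by (rule integrable[OF contG GB C])
  have contGc: "continuous_on orthant (\<lambda>x. G (r *\<^sub>R x))" if "r > 0" for r
    using that by (intro continuous_on_compose2[OF contG] continuous_intros) (auto intro: orthant_scaleR)
  have cont\<phi>: "continuous_on orthant (\<phi> n)" for n
    unfolding \<phi>_def \<psi>_def using c[of n] by (intro continuous_intros contGc) auto
  have int\<phi>: "set_integrable lborel orthant (\<phi> n)" for n
    by (rule integrable[OF cont\<phi> \<phi>_le E])
  have \<phi>0: "(LINT x:orthant|lborel. \<phi> n x) = 0" for n
  proof -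
    have "set_integrable lborel orthant (\<lambda>x. G (c n *\<^sub>R x))"
    proof (rule integrable[OF contGc[OF c(1)] _ C])
      fix x :: "real^'n" assume x: "x \<in> orthant"
      have "norm x \<le> norm (c n *\<^sub>R x)" using c(2)[of n] mult_right_mono[of 1 "c n" "norm x"] by simp
      then have "C * B (c n *\<^sub>R x) \<le> C * B x" using C by (intro mult_left_mono B_anti)
      then show "norm (G (c n *\<^sub>R x)) \<le> C * B x"
        using G[OF orthant_scaleR[OF x], of "c n"] c(1)[of n] by (auto simp: B_def)
    qed
    then have "(LINT x:orthant|lborel. of_real (c n) ^ p * G (c n *\<^sub>R x) - G x) =
       of_real (c n) ^ p * (LINT x:orthant|lborel. G (c n *\<^sub>R x)) - (LINT x:orthant|lborel. G x)"
      using intG by (subst set_integral_diff) (auto intro: set_integrable_mult_right)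
    also have "\<dots> = 0"
      using orthant_integral_scale[OF c(1) intG, of n] by (simp add: p_def mult.commute)
    finally have "(LINT x:orthant|lborel. (of_real (c n) ^ p * G (c n *\<^sub>R x) - G x) * (1 / of_real (c n - 1))) = 0"
      by (subst set_integral_mult_left) simp
    then show ?thesis by (simp add: \<phi>_def \<psi>_def)
  qed
  have "(\<lambda>n. LINT x:orthant|lborel. \<phi> n x) \<longlonglongrightarrow> (LINT x:orthant|lborel. of_nat p * G x + K x)"
    unfolding set_lebesgue_integral_def
  proof (rule integral_dominated_convergence)
    have "integrable lborel (\<lambda>x::real^'n. indicator orthant x *\<^sub>R complex_of_real (E * B x))"
      unfolding set_integrable_def[symmetric]
    proof (rule integrable)
      show "continuous_on orthant (\<lambda>x::real^'n. complex_of_real (E * B x))"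
        unfolding B_def by (intro continuous_intros) (auto simp: add_pos_nonneg add_nonneg_eq_0_iff)
    qed (use E in \<open>auto simp: B_def norm_mult\<close>)
    then show "integrable lborel (\<lambda>x::real^'n. norm (indicator orthant x *\<^sub>R complex_of_real (E * B x)))"
      by (rule integrable_norm)
    have "set_integrable lborel orthant (\<lambda>x. of_nat p * G x + K x)"
      using integrable[OF contK KB C] intG
      by (intro set_integral_add set_integrable_mult_right) auto
    then show "(\<lambda>x. indicat_real orthant x *\<^sub>R (of_nat p * G x + K x)) \<in> borel_measurable lborel"
      unfolding set_integrable_def by (rule borel_measurable_integrable)
    show "(\<lambda>x. indicat_real orthant x *\<^sub>R \<phi> n x) \<in> borel_measurable lborel" for n
      using int\<phi>[of n] unfolding set_integrable_def by (rule borel_measurable_integrable)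
    show "AE x in lborel. (\<lambda>n. indicat_real orthant x *\<^sub>R \<phi> n x) \<longlonglongrightarrow> indicat_real orthant x *\<^sub>R (of_nat p * G x + K x)"
      using \<phi>_lim by (intro AE_I2) (auto simp: indicator_def)
    show "AE x in lborel. norm (indicat_real orthant x *\<^sub>R \<phi> n x) \<le> norm (indicat_real orthant x *\<^sub>R complex_of_real (E * B x))" for n
    proof (intro AE_I2)
      fix x :: "real^'n"
      show "norm (indicat_real orthant x *\<^sub>R \<phi> n x) \<le> norm (indicat_real orthant x *\<^sub>R complex_of_real (E * B x))"
        using \<phi>_le[of x n] by (auto simp: indicator_def simp del: of_real_mult)
    qed
  qed
  then show ?thesis
    using \<phi>0 by (simp add: LIMSEQ_const_iff p_def)
qed

section \<open>Decaying functions on the orthant\<close>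

text \<open>For q > p this yields both an integrable function on the orthant and a summable lattice
  series.\<close>

definition decays :: "real \<Rightarrow> (real^'n::finite \<Rightarrow> complex) \<Rightarrow> bool" where
  "decays q g \<longleftrightarrow> continuous_on orthant g \<and> (\<exists>C\<ge>0. \<forall>x\<in>orthant. norm (g x) \<le> C * (1 + norm x) powr (- q))"

lemma decaysI: "continuous_on orthant g \<Longrightarrow> C \<ge> 0 \<Longrightarrow> (\<And>x. x \<in> orthant \<Longrightarrow> norm (g x) \<le> C * (1 + norm x) powr (- q)) \<Longrightarrow> decays q g"
  unfolding decays_def by blast

lemma decays_zero [simp]: "decays q (\<lambda>_. 0)"
  unfolding decays_def by (auto intro: exI[of _ 0])

lemma decays_add:
  assumes "decays q g" "decays q h" shows "decays q (\<lambda>x. g x + h x)"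
proof -
  obtain C D where "C \<ge> 0" "\<forall>x\<in>orthant. norm (g x) \<le> C * (1 + norm x) powr (- q)"
    "D \<ge> 0" "\<forall>x\<in>orthant. norm (h x) \<le> D * (1 + norm x) powr (- q)"
    using assms unfolding decays_def by blast
  then show ?thesis
    using assms by (intro decaysI[of _ "C + D"]) (auto simp: decays_def distrib_right intro!: continuous_intros norm_triangle_le add_mono)
qed

lemma decays_cmult:
  assumes "decays q g" shows "decays q (\<lambda>x. c * g x)"
proof -
  obtain C where "C \<ge> 0" "\<forall>x\<in>orthant. norm (g x) \<le> C * (1 + norm x) powr (- q)"
    using assms unfolding decays_def by blast
  then show ?thesis
    using assms by (intro decaysI[of _ "norm c * C"])
      (auto simp: decays_def norm_mult mult.assoc intro!: continuous_intros mult_left_mono)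
qed

lemma decays_sum: "(\<And>i. i \<in> A \<Longrightarrow> decays q (g i)) \<Longrightarrow> decays q (\<lambda>x. \<Sum>i\<in>A. g i x)"
  by (induction A rule: infinite_finite_induct) (auto intro: decays_add)

text \<open>Adding a vector of the orthant to a lattice point cannot shrink its norm, so one
  majorant serves all shifts \<open>t\<close>.\<close>

lemma decays_summable_bound:
  fixes g :: "real^'n::finite \<Rightarrow> complex"
  assumes "decays q g" "q > real CARD('n)"
  obtains M :: "nat^'n \<Rightarrow> real" where "M summable_on UNIV" "\<And>k t. t \<in> orthant \<Longrightarrow> norm (g (lattice_vec k + t)) \<le> M k"
proof -
  obtain C where C: "C \<ge> 0" "\<forall>x\<in>orthant. norm (g x) \<le> C * (1 + norm x) powr (- q)"
    using assms(1) unfolding decays_def by blast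
  show ?thesis
  proof (rule that[of "\<lambda>k. C * (1 + norm (lattice_vec k)) powr (- q)"])
    show "(\<lambda>k::nat^'n. C * (1 + norm (lattice_vec k)) powr (- q)) summable_on UNIV"
      by (intro summable_on_cmult_right summable_on_lattice_powr assms)
    fix k and t :: "real^'n" assume t: "t \<in> orthant"
    have "norm (g (lattice_vec k + t)) \<le> C * (1 + norm (lattice_vec k + t)) powr (- q)"
      using C orthant_add[OF lattice_vec_orthant t] by blast
    also have "\<dots> \<le> C * (1 + norm (lattice_vec k)) powr (- q)"
      using C assms(2) norm_le_norm_add_orthant[OF lattice_vec_orthant t, of k]
      by (intro mult_left_mono powr_mono2') (auto simp: add_pos_nonneg)
    finally show "norm (g (lattice_vec k + t)) \<le> C * (1 + norm (lattice_vec k)) powr (- q)" .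
  qed
qed

lemma decays_integrable:
  fixes g :: "real^'n::finite \<Rightarrow> complex"
  assumes "decays q g" "q > real CARD('n)"
  shows "set_integrable lborel orthant g"
proof -
  obtain M :: "nat^'n \<Rightarrow> real" where "M summable_on UNIV" "\<And>k t. t \<in> orthant \<Longrightarrow> norm (g (lattice_vec k + t)) \<le> M k"
    using decays_summable_bound[OF assms] by blast
  then show ?thesis
    using assms(1) by (intro orthant_integrable[of g M]) (auto simp: decays_def cbox01_orthant)
qed

section \<open>Logarithm and integrand\<close>

locale mahler_poly =
  fixes f :: "'n::finite mpoly" and lf :: "real^'n \<Rightarrow> complex"
  assumes mahler: "mahler f" and branch: "log_branch f lf"
begin

abbreviation F :: "real^'n \<Rightarrow> complex" where "F \<equiv> meval f"
abbreviation d :: nat where "d \<equiv> total_deg f"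

lemma d_pos: "d > 0"
proof (rule ccontr)
  assume "\<not> d > 0"
  then have "m = 0" if "m \<in> Poly_Mapping.keys f" for m
    using mono_deg_le_total_deg[OF that] by (auto simp: mono_deg_def poly_mapping_eq_iff fun_eq_iff)
  then have "f = mconst (Poly_Mapping.lookup f 0)"
    by (intro poly_mapping_eqI) (auto simp: mconst_def lookup_single when_def in_keys_iff)
  with mahler show False by (auto simp: mahler_def)
qed

lemma F_nonzero: "x \<in> orthant \<Longrightarrow> F x \<noteq> 0"
  using mahler by (simp add: mahler_def)

lemma exp_lf: "x \<in> orthant \<Longrightarrow> exp (lf x) = F x"
  using branch by (simp add: log_branch_def)

lemma lf_cont: "continuous_on orthant lf"
  using branch by (simp add: log_branch_def)

lemma polyfun_F: "polyfun (int d) F"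
  by (rule polyfun_meval)

lemma lf_has_vector_derivative:
  assumes "\<And>u. u \<in> S \<Longrightarrow> x + u *\<^sub>R v \<in> orthant" "u \<in> S"
  shows "((\<lambda>u. lf (x + u *\<^sub>R v)) has_vector_derivative
    (\<Sum>i\<in>UNIV. of_real (v $ i) * pd i F (x + u *\<^sub>R v)) / F (x + u *\<^sub>R v)) (at u within S)"
proof (rule has_vector_derivative_log[where g = "\<lambda>u. F (x + u *\<^sub>R v)"])
  show "continuous_on S (\<lambda>u. lf (x + u *\<^sub>R v))"
    by (intro continuous_on_compose2[OF lf_cont] continuous_intros) (use assms in auto)
  show "((\<lambda>u. F (x + u *\<^sub>R v)) has_vector_derivative (\<Sum>i\<in>UNIV. of_real (v $ i) * pd i F (x + u *\<^sub>R v))) (at u within S)"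
    by (rule polyfun_has_vector_derivative[OF polyfun_F])
qed (use assms exp_lf in auto)

text \<open>Along a ray the derivative of \<open>lf - d ln r\<close> is \<open>eul d F / (r F)\<close>, which is \<open>O(1/r\<^sup>2)\<close> because
  Euler's identity kills the top-degree part. In particular the argument of \<open>f\<close> stays bounded.\<close>

lemma lf_asymptotics:
  obtains C where "C \<ge> 0" "\<And>x. x \<in> orthant \<Longrightarrow> norm (lf x - of_real (real d * ln (1 + norm x))) \<le> C"
proof -
  obtain c where c: "c > 0" "\<And>x. x \<in> orthant \<Longrightarrow> norm (F x) \<ge> c * (1 + norm x) ^ d"
    using mahler_lower_bound[OF mahler] by blast
  obtain C1 where C1: "C1 \<ge> 0" "\<And>x. norm (eul (real d) F x) \<le> C1 * (1 + norm x) powr of_int (int d - 1)"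
    using polyfun_bound[OF polyfun_eul[OF polyfun_F]] by auto
  have "compact (orthant \<inter> cball (0::real^'n) 1)" by (intro closed_Int_compact orthant_closed) auto
  moreover have "continuous_on (orthant \<inter> cball (0::real^'n) 1) lf"
    by (rule continuous_on_subset[OF lf_cont]) auto
  ultimately have "bounded (lf ` (orthant \<inter> cball (0::real^'n) 1))"
    by (intro compact_imp_bounded compact_continuous_image)
  then obtain K where K: "K > 0" "\<And>x. x \<in> orthant \<Longrightarrow> norm x \<le> 1 \<Longrightarrow> norm (lf x) \<le> K"
    unfolding bounded_pos by auto
  show ?thesis
  proof (rule that[of "C1 / c + K + real d"])
    show "C1 / c + K + real d \<ge> 0" using C1 c K by simp
    fix x :: "real^'n" assume x: "x \<in> orthant"
    show "norm (lf x - of_real (real d * ln (1 + norm x))) \<le> C1 / c + K + real d"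
    proof (cases "norm x \<le> 1")
      case True
      have "ln (1 + norm x) \<le> norm x" by (rule ln_add_one_self_le_self) simp
      then have "real d * ln (1 + norm x) \<le> real d * 1" using True by (intro mult_left_mono) auto
      then have "norm (complex_of_real (real d * ln (1 + norm x))) \<le> real d" by (simp del: of_real_mult)
      moreover have "norm (lf x - of_real (real d * ln (1 + norm x))) \<le> norm (lf x) + norm (complex_of_real (real d * ln (1 + norm x)))"
        by (rule norm_triangle_ineq4)
      moreover have "C1 / c \<ge> 0" using C1 c by simp
      ultimately show ?thesis using K(2)[OF x True] by linarith
    next
      case False
      define r where "r = norm x"
      define \<theta> where "\<theta> = (1 / r) *\<^sub>R x"
      have r: "r > 1" using False by (simp add: r_def)
      have \<theta>: "\<theta> \<in> orthant" "norm \<theta> = 1" "r *\<^sub>R \<theta> = x"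
        using r x by (auto simp: \<theta>_def r_def intro!: orthant_scaleR)
      define \<phi> where "\<phi> = (\<lambda>\<rho>. lf (0 + \<rho> *\<^sub>R \<theta>) - of_real (real d * ln \<rho>))"
      define \<phi>' where "\<phi>' = (\<lambda>\<rho>. (\<Sum>i\<in>UNIV. of_real (\<theta> $ i) * pd i F (0 + \<rho> *\<^sub>R \<theta>)) / F (0 + \<rho> *\<^sub>R \<theta>) - of_real (real d * (1 / \<rho>)))"
      have der: "(\<phi> has_vector_derivative \<phi>' \<rho>) (at \<rho> within {1..r})" if "\<rho> \<in> {1..r}" for \<rho>
      proof -
        have "((\<lambda>\<rho>. real d * ln \<rho>) has_real_derivative real d * (1 / \<rho>)) (at \<rho> within {1..r})"
          using that by (intro DERIV_cmult) (auto intro!: derivative_eq_intros)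
        then show ?thesis
          unfolding \<phi>_def \<phi>'_def using that orthant_scaleR[OF \<theta>(1)]
          by (intro has_vector_derivative_diff lf_has_vector_derivative has_vector_derivative_of_real) auto
      qed
      \<comment> \<open>The comparison function -(C1/c)/rho has derivative (C1/c)/rho^2, and it
        increases by at most C1/c on [1, r], whatever r is.\<close>
      have "norm (\<phi> r - \<phi> 1) \<le> (- (C1 / c) / r) - (- (C1 / c) / 1)"
      proof (rule differentiable_bound_general)
        show "continuous_on {1..r} \<phi>"
          using has_vector_derivative_continuous[OF der] by (auto simp: continuous_on_eq_continuous_within)
        show "continuous_on {1..r} (\<lambda>\<rho>. - (C1 / c) / \<rho>)" by (intro continuous_intros) auto
        fix \<rho> assume \<rho>: "1 < \<rho>" "\<rho> < r"
        have "at \<rho> within {1..r} = at \<rho>" using \<rho> by (intro at_within_interior) auto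
        then show "(\<phi> has_vector_derivative \<phi>' \<rho>) (at \<rho>)" using der[of \<rho>] \<rho> by simp
        show "((\<lambda>\<rho>. - (C1 / c) / \<rho>) has_vector_derivative (C1 / c) / \<rho>\<^sup>2) (at \<rho>)"
          unfolding has_real_derivative_iff_has_vector_derivative[symmetric]
          using \<rho> by (auto intro!: derivative_eq_intros simp: power2_eq_square)
        define y where "y = \<rho> *\<^sub>R \<theta>"
        have y: "y \<in> orthant" "norm y = \<rho>" using \<theta> \<rho> by (auto simp: y_def intro: orthant_scaleR)
        have "\<phi>' \<rho> = eul (real d) F y / (of_real \<rho> * F y)"
        proof -
          have "(\<Sum>i\<in>UNIV. of_real (y $ i) * pd i F y) = of_real \<rho> * (\<Sum>i\<in>UNIV. of_real (\<theta> $ i) * pd i F y)"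
            by (simp add: y_def sum_distrib_left mult.assoc)
          then show ?thesis
            using \<rho> F_nonzero[OF y(1)] by (simp add: \<phi>'_def eul_def y_def[symmetric] field_simps)
        qed
        then have "norm (\<phi>' \<rho>) = norm (eul (real d) F y) / (\<rho> * norm (F y))"
          using \<rho> by (simp add: norm_divide norm_mult)
        also have "\<dots> \<le> (C1 * ((1 + \<rho>) ^ d / (1 + \<rho>))) / (\<rho> * (c * (1 + \<rho>) ^ d))"
          using C1(2)[of y] c(2)[OF y(1)] c(1) y \<rho> C1(1)
          by (intro frac_le mult_left_mono) (auto simp: powr_diff powr_realpow)
        also have "\<dots> = (C1 / c) / (\<rho> * (1 + \<rho>))"
        proof -
          have "(1 + \<rho>) ^ d \<noteq> 0" using \<rho> by simp
          then show ?thesis by (simp add: mult_ac)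
        qed
        also have "\<dots> \<le> (C1 / c) / (\<rho>\<^sup>2)"
          using \<rho> c C1 by (intro divide_left_mono) (auto simp: power2_eq_square)
        finally show "norm (\<phi>' \<rho>) \<le> (C1 / c) / \<rho>\<^sup>2" .
      qed (use r in auto)
      also have "\<dots> \<le> C1 / c" using C1 c r by simp
      finally have 1: "norm (\<phi> r - \<phi> 1) \<le> C1 / c" .
      have 2: "norm (lf \<theta>) \<le> K" using K(2)[OF \<theta>(1)] \<theta> by simp
      \<comment> \<open>Along the ray the comparison is with ln r, in the statement with ln (1 + r);
        the two differ by at most 1.\<close>
      have "ln (1 + r) - ln r = ln (1 + 1 / r)" using r ln_div[of "1 + r" r] by (simp add: add_divide_distrib add.commute)
      also have "\<dots> \<le> 1 / r" using r by (intro ln_add_one_self_le_self) auto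
      also have "\<dots> \<le> 1" using r by simp
      finally have "real d * (ln (1 + r) - ln r) \<le> real d * 1" by (intro mult_left_mono) auto
      moreover have "0 \<le> real d * (ln (1 + r) - ln r)" using r by (intro mult_nonneg_nonneg) auto
      ultimately have 3: "norm (complex_of_real (real d * (ln (1 + r) - ln r))) \<le> real d" by (simp del: of_real_mult)
      \<comment> \<open>Here \<open>lf \<theta>\<close> is \<open>\<phi> 1\<close>, since ln 1 =
        0.\<close>
      have "lf x - of_real (real d * ln (1 + norm x)) = (\<phi> r - \<phi> 1) + lf \<theta> - complex_of_real (real d * (ln (1 + r) - ln r))"
        using \<theta>(3) by (simp add: \<phi>_def r_def algebra_simps)
      also have "norm \<dots> \<le> norm (\<phi> r - \<phi> 1) + norm (lf \<theta>) + norm (complex_of_real (real d * (ln (1 + r) - ln r)))"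
        by (intro order_trans[OF norm_triangle_ineq4] add_right_mono norm_triangle_ineq)
      finally show ?thesis using 1 2 3 by linarith
    qed
  qed
qed

text \<open>The numerator is a function, because the recursions replace it by its partial
  derivatives, by its image under the Euler operator and by products with derivatives of f.\<close>

definition integrand :: "(real^'n \<Rightarrow> complex) \<Rightarrow> real^'n \<Rightarrow> complex \<Rightarrow> complex" where
  "integrand h x s = h x * exp (- s * lf x)"

lemma integrand_zero [simp]: "integrand (\<lambda>_. 0) x s = 0"
  by (simp add: integrand_def)

text \<open>By \<open>lf_asymptotics\<close> the exponent -s \<open>lf x\<close> differs from -s d
  ln (1 + |x|) by at most |s| times a constant. This includes the contribution of the argument of f
  paired with Im s, and it explains the factor \<open>exp (\<bar>R\<bar> * C0)\<close>. The constant
  is uniform in s on bounded parts of a half-plane.\<close>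

lemma integrand_bound:
  assumes "polyfun D h"
  shows "\<exists>C\<ge>0. \<forall>x\<in>orthant. \<forall>s. \<sigma> \<le> Re s \<longrightarrow> norm s \<le> R \<longrightarrow>
      norm (integrand h x s) \<le> C * (1 + norm x) powr (- (real d * \<sigma> - of_int D))"
proof -
  obtain C0 where C0: "C0 \<ge> 0" "\<And>x. x \<in> orthant \<Longrightarrow> norm (lf x - of_real (real d * ln (1 + norm x))) \<le> C0"
    using lf_asymptotics by blast
  obtain C where C: "C \<ge> 0" "\<And>x. norm (h x) \<le> C * (1 + norm x) powr of_int D"
    using polyfun_bound[OF assms] by blast
  show ?thesis
  proof (intro exI[of _ "C * exp (\<bar>R\<bar> * C0)"] conjI ballI allI impI)
    fix x :: "real^'n" and s :: complex assume x: "x \<in> orthant" and s: "Re s \<ge> \<sigma>" "norm s \<le> R"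
    define L where "L = real d * ln (1 + norm x)"
    have L: "L \<ge> 0" by (simp add: L_def)
    have p1: "1 + norm x > 0" by (simp add: add_pos_nonneg)
    have "norm (s * (lf x - of_real L)) \<le> R * C0"
      using C0(2)[OF x] s C0(1) norm_ge_zero[of s] unfolding norm_mult L_def
      by (intro mult_mono norm_ge_zero) linarith+
    then have "\<bar>Re (s * (lf x - of_real L))\<bar> \<le> R * C0" using abs_Re_le_cmod order_trans by blast
    moreover have "s * lf x = s * (lf x - of_real L) + of_real L * s" by (simp add: algebra_simps)
    then have "Re (s * lf x) = Re (s * (lf x - of_real L)) + L * Re s"
      by (metis Re_complex_of_real Im_complex_of_real plus_complex.sel(1) times_complex.sel(1) mult_zero_left diff_zero)
    moreover have "L * \<sigma> \<le> L * Re s" using L s by (intro mult_left_mono)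
    moreover have "R \<ge> 0" using s norm_ge_zero order_trans by blast
    ultimately have "- Re (s * lf x) \<le> \<bar>R\<bar> * C0 - L * \<sigma>" by simp
    then have "norm (exp (- s * lf x)) \<le> exp (\<bar>R\<bar> * C0 - L * \<sigma>)"
      by (simp add: norm_exp_eq_Re)
    also have "\<dots> = exp (\<bar>R\<bar> * C0) * (1 + norm x) powr (- (real d * \<sigma>))"
      using p1 by (simp add: L_def powr_def exp_add[symmetric] mult_ac)
    finally have "norm (integrand h x s) \<le> (C * (1 + norm x) powr of_int D) * (exp (\<bar>R\<bar> * C0) * (1 + norm x) powr (- (real d * \<sigma>)))"
      unfolding integrand_def norm_mult using C by (intro mult_mono) auto
    also have "\<dots> = C * exp (\<bar>R\<bar> * C0) * (1 + norm x) powr (of_int D + - (real d * \<sigma>))"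
      by (simp only: powr_add mult_ac)
    finally show "norm (integrand h x s) \<le> C * exp (\<bar>R\<bar> * C0) * (1 + norm x) powr (- (real d * \<sigma> - of_int D))"
      by simp
  qed (use C in auto)
qed

lemma integrand_compose_cont:
  assumes "polyfun D h" "continuous_on A \<phi>" "\<phi> ` A \<subseteq> orthant" "continuous_on A \<sigma>"
  shows "continuous_on A (\<lambda>y. integrand h (\<phi> y) (\<sigma> y))"
proof -
  have "continuous_on A (\<lambda>y. lf (\<phi> y))" "continuous_on A (\<lambda>y. h (\<phi> y))"
    using continuous_on_compose2[OF lf_cont assms(2,3)]
      continuous_on_compose2[OF continuous_on_polyfun[OF assms(1)] assms(2) subset_UNIV] by auto
  then show ?thesis
    unfolding integrand_def by (intro continuous_intros assms(4))
qed

lemma integrand_cont: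
  assumes "polyfun D h" "a \<in> orthant"
  shows "continuous_on orthant (\<lambda>x. integrand h (a + x) s)"
  by (rule integrand_compose_cont[OF assms(1)]) (auto intro!: continuous_intros orthant_add[OF assms(2)])

lemma integrand_decays:
  assumes "polyfun D h" "a \<in> orthant" "0 \<le> q" "q \<le> real d * Re s - of_int D"
  shows "decays q (\<lambda>x. integrand h (a + x) s)"
proof -
  obtain C where C: "C \<ge> 0" "\<And>x. x \<in> orthant \<Longrightarrow> norm (integrand h x s) \<le> C * (1 + norm x) powr (- (real d * Re s - of_int D))"
    using integrand_bound[OF assms(1), of "Re s" "norm s"] by auto
  show ?thesis
  proof (rule decaysI[OF integrand_cont[OF assms(1,2)] C(1)])
    fix x :: "real^'n" assume x: "x \<in> orthant"
    have "norm (integrand h (a + x) s) \<le> C * (1 + norm (a + x)) powr (- (real d * Re s - of_int D))"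
      using C(2)[OF orthant_add[OF assms(2) x]] by simp
    also have "\<dots> \<le> C * (1 + norm (a + x)) powr (- q)"
      using assms(4) by (intro mult_left_mono[OF _ C(1)] powr_mono) auto
    also have "\<dots> \<le> C * (1 + norm x) powr (- q)"
      using assms(3) norm_le_norm_add_orthant[OF x assms(2)]
      by (intro mult_left_mono[OF _ C(1)] powr_mono2') (auto simp: add_pos_nonneg add.commute)
    finally show "norm (integrand h (a + x) s) \<le> C * (1 + norm x) powr (- q)" .
  qed
qed

lemma integrand_hcont:
  assumes "polyfun D h" "b \<in> orthant"
  shows "hcont H (\<lambda>a s. integrand h (b + a) s)"
  unfolding hcont_def case_prod_beta
proof (intro conjI ballI)
  show "continuous_on (orthant \<times> H) (\<lambda>y. integrand h (b + fst y) (snd y))"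
    by (rule integrand_compose_cont[OF assms(1)]) (auto intro!: continuous_intros orthant_add[OF assms(2)])
  show "(\<lambda>s. integrand h (b + a) s) holomorphic_on H" for a
    unfolding integrand_def by (intro holomorphic_intros)
qed

text \<open>Product rule for h f^(-s). Its two kinds of term, degree D - 1 at s and degree D + d - 1
  at s + 1 with a factor s, are the source of both recursions.\<close>

lemma integrand_has_vector_derivative:
  assumes h: "polyfun D h" and x: "\<And>u. u \<in> S \<Longrightarrow> x + u *\<^sub>R v \<in> orthant" "u \<in> S"
  shows "((\<lambda>u. integrand h (x + u *\<^sub>R v) s) has_vector_derivative
    (\<Sum>i\<in>UNIV. of_real (v $ i) * (integrand (pd i h) (x + u *\<^sub>R v) s - s * integrand (\<lambda>x. h x * pd i F x) (x + u *\<^sub>R v) (s + 1)))) (at u within S)"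
proof -
  let ?y = "x + u *\<^sub>R v"
  let ?lf' = "(\<Sum>i\<in>UNIV. of_real (v $ i) * pd i F ?y) / F ?y"
  have e: "exp (- (s + 1) * lf ?y) = exp (- s * lf ?y) / F ?y"
  proof -
    have "- (s + 1) * lf ?y = - s * lf ?y - lf ?y" by (simp add: algebra_simps)
    then show ?thesis using exp_lf[OF x(1)[OF x(2)]] by (simp only: exp_diff)
  qed
  have "((\<lambda>u. - s * lf (x + u *\<^sub>R v)) has_vector_derivative (- s * ?lf')) (at u within S)"
    by (intro has_vector_derivative_mult_right lf_has_vector_derivative x)
  from field_vector_diff_chain_within[OF this, of exp]
  have "((\<lambda>u. exp (- s * lf (x + u *\<^sub>R v))) has_vector_derivative (- s * ?lf' * exp (- s * lf ?y))) (at u within S)"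
    by (auto simp: o_def DERIV_exp has_field_derivative_at_within)
  from has_vector_derivative_mult[OF polyfun_has_vector_derivative[OF h] this]
  have "((\<lambda>u. integrand h (x + u *\<^sub>R v) s) has_vector_derivative
      (h ?y * (- s * ?lf' * exp (- s * lf ?y)) + (\<Sum>i\<in>UNIV. of_real (v $ i) * pd i h ?y) * exp (- s * lf ?y))) (at u within S)"
    by (simp add: integrand_def)
  moreover have "h ?y * (- s * ?lf' * exp (- s * lf ?y)) + (\<Sum>i\<in>UNIV. of_real (v $ i) * pd i h ?y) * exp (- s * lf ?y) =
     (\<Sum>i\<in>UNIV. of_real (v $ i) * (integrand (pd i h) ?y s - s * integrand (\<lambda>x. h x * pd i F x) ?y (s + 1)))"
    unfolding integrand_def e sum_distrib_left sum_distrib_right sum_divide_distrib sum.distrib[symmetric]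
    using F_nonzero[OF x(1)[OF x(2)]] by (intro sum.cong refl) (simp add: field_simps)
  ultimately show ?thesis by simp
qed

section \<open>Base identities in the half-plane of convergence\<close>

definition zeta_series :: "(real^'n \<Rightarrow> complex) \<Rightarrow> real^'n \<Rightarrow> complex \<Rightarrow> complex" where
  "zeta_series h a s = (\<Sum>\<^sub>\<infinity>k\<in>UNIV. integrand h (a + lattice_vec k) s)"

definition Z_integral :: "(real^'n \<Rightarrow> complex) \<Rightarrow> real^'n \<Rightarrow> complex \<Rightarrow> complex" where
  "Z_integral h a s = (LINT x:orthant|lborel. integrand h (a + x) s)"

text \<open>This is \<open>Re s > (D + p - m)/d\<close>; each step of the recursions below raises \<open>m\<close> by 1.\<close>

definition half_plane :: "nat \<Rightarrow> int \<Rightarrow> complex set" where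
  "half_plane m D = {s. Re s * real d > of_int D + real CARD('n) - real m}"

lemma open_half_plane: "open (half_plane m D)"
proof -
  have "half_plane m D = (\<lambda>s. Re s * real d) -` {of_int D + real CARD('n) - real m<..}" by (auto simp: half_plane_def)
  then show ?thesis by (auto intro!: open_vimage continuous_intros)
qed

lemma half_plane_mono: "half_plane m D \<subseteq> half_plane (Suc m) D"
  by (auto simp: half_plane_def)

lemma half_plane_exhaust: "\<exists>m. s \<in> half_plane m D"
proof -
  obtain m where "of_int D + real CARD('n) - Re s * real d < real m" using reals_Archimedean2 by blast
  then show ?thesis by (intro exI[of _ m]) (simp add: half_plane_def)
qed

text \<open>The identity d (s + 1) - (D + d - 1) = d s - (D - 1) shows that both kinds of term reach
  the same half-plane, one stage further to the left.\<close>

lemma half_plane_Suc_iff: "s \<in> half_plane (Suc m) D \<longleftrightarrow> s \<in> half_plane m (D - 1)" "s \<in> half_plane (Suc m) D \<longleftrightarrow> s + 1 \<in> half_plane m (D + int d - 1)"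
  by (auto simp: half_plane_def algebra_simps)

lemma half_plane_step: "s \<in> half_plane m D \<Longrightarrow> s \<in> half_plane m (D - 1)" "s \<in> half_plane m D \<Longrightarrow> s + 1 \<in> half_plane m (D + int d - 1)"
  using half_plane_mono[of m D] half_plane_Suc_iff by blast+

lemma half_plane_nonempty: "half_plane m D \<noteq> {}"
proof -
  have "(\<bar>real_of_int D\<bar> + real CARD('n) + 1) * 1 \<le> (\<bar>real_of_int D\<bar> + real CARD('n) + 1) * real d"
    using d_pos by (intro mult_left_mono) auto
  then have "of_real (\<bar>real_of_int D\<bar> + real CARD('n) + 1) \<in> half_plane m D"
    by (simp add: half_plane_def)
  then show ?thesis by blast
qed

text \<open>For D >= 0 the region of convergence avoids the poles of \<open>Gamma s\<close>. For D <
  0 it may meet them, but then the numerator is zero; this is the reason for the recurring case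
  distinction on \<open>D \<ge> 0\<close>.\<close>

lemma half_plane_0_Re_pos: "s \<in> half_plane 0 D \<Longrightarrow> D \<ge> 0 \<Longrightarrow> Re s > 0"
  using d_pos by (auto simp: half_plane_def) (smt (verit) mult_nonneg_nonneg mult_nonpos_nonneg of_int_0_le_iff of_nat_0_less_iff zero_less_card_finite)

lemma polyfun_prod_pd: "polyfun D h \<Longrightarrow> polyfun (D + int d - 1) (\<lambda>x. h x * pd i F x)"
  using polyfun_mult[OF _ polyfun_pd[OF polyfun_F]] by (simp add: algebra_simps)

lemma polyfun_prod_eul: "polyfun D h \<Longrightarrow> polyfun (D + int d - 1) (\<lambda>x. - h x * eul (real d) F x)"
  using polyfun_mult[OF polyfun_uminus polyfun_eul[OF polyfun_F], of D h] by (simp add: algebra_simps)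

text \<open>A common decay exponent for the terms produced by one differentiation.\<close>

lemma integrand_decays_half_plane:
  assumes "polyfun D h" "s \<in> half_plane 0 D" "a \<in> orthant"
  obtains q where "q > real CARD('n)" "decays q (\<lambda>x. integrand h (a + x) s)"
    "\<And>k. polyfun (D - 1) k \<Longrightarrow> decays q (\<lambda>x. integrand k (a + x) s)"
    "\<And>k. polyfun (D + int d - 1) k \<Longrightarrow> decays q (\<lambda>x. integrand k (a + x) (s + 1))"
proof (rule that[of "real d * Re s - of_int D"])
  let ?q = "real d * Re s - of_int D"
  show q: "?q > real CARD('n)" using assms by (simp add: half_plane_def algebra_simps)
  then have q0: "?q \<ge> 0" by linarith
  show "decays ?q (\<lambda>x. integrand h (a + x) s)" by (rule integrand_decays[OF assms(1,3) q0]) simp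
  show "decays ?q (\<lambda>x. integrand k (a + x) s)" if "polyfun (D - 1) k" for k
    by (rule integrand_decays[OF that assms(3) q0]) simp
  show "decays ?q (\<lambda>x. integrand k (a + x) (s + 1))" if "polyfun (D + int d - 1) k" for k
    by (rule integrand_decays[OF that assms(3) q0]) (simp add: algebra_simps)
qed

lemma integrand_lattice_bound:
  assumes "polyfun D h" "s \<in> half_plane 0 D"
  obtains M :: "nat^'n \<Rightarrow> real" where "M summable_on UNIV" "\<And>k a. a \<in> orthant \<Longrightarrow> norm (integrand h (a + lattice_vec k) s) \<le> M k"
proof -
  obtain q where q: "q > real CARD('n)" "decays q (\<lambda>x. integrand h (0 + x) s)"
    using integrand_decays_half_plane[OF assms orthant_zero] by metis
  obtain M :: "nat^'n \<Rightarrow> real" where "M summable_on UNIV" "\<And>k t. t \<in> orthant \<Longrightarrow> norm (integrand h (0 + (lattice_vec k + t)) s) \<le> M k"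
    using decays_summable_bound[OF q(2,1)] by metis
  then show ?thesis by (intro that[of M]) (auto simp: add.commute)
qed

lemma integrand_summable:
  assumes "polyfun D h" "s \<in> half_plane 0 D" "a \<in> orthant"
  shows "(\<lambda>k. integrand h (a + lattice_vec k) s) summable_on UNIV"
proof -
  obtain M :: "nat^'n \<Rightarrow> real" where M: "M summable_on UNIV" "\<And>k a. a \<in> orthant \<Longrightarrow> norm (integrand h (a + lattice_vec k) s) \<le> M k"
    using integrand_lattice_bound[OF assms(1,2)] by metis
  show ?thesis
    using M(2)[OF assms(3)] by (intro abs_summable_summable[OF Infinite_Sum.abs_summable_on_comparison_test'[OF M(1)]])
qed

lemma hcont_zeta_series:
  assumes h: "polyfun D h"
  shows "hcont (half_plane 0 D) (zeta_series h)"
  unfolding zeta_series_def[abs_def]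
proof (rule hcont_infsum[OF open_half_plane])
  show "hcont (half_plane 0 D) (\<lambda>a s. integrand h (a + lattice_vec k) s)" for k
    using integrand_hcont[OF h lattice_vec_orthant[of k]] by (simp add: add.commute)
  fix s0 assume s0: "s0 \<in> half_plane 0 D"
  define \<sigma>0 where "\<sigma>0 = (of_int D + real CARD('n)) / real d"
  \<comment> \<open>Half the distance to the line of convergence, so that the closed disc of radius
    \<open>r\<close> lies in Re s >= \<open>\<sigma>\<close> with \<open>\<sigma>\<close> still to
    the right of that line.\<close>
  define r where "r = (Re s0 - \<sigma>0) / 2"
  have d: "real d > 0" using d_pos by simp
  have r: "r > 0" using s0 d by (simp add: r_def \<sigma>0_def half_plane_def pos_divide_less_eq)
  define \<sigma> where "\<sigma> = Re s0 - r"
  have "\<sigma> > \<sigma>0" using r by (simp add: \<sigma>_def r_def field_simps)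
  then have q: "real d * \<sigma> - of_int D > real CARD('n)"
    using d by (simp add: \<sigma>0_def pos_divide_less_eq algebra_simps)
  obtain C where C: "C \<ge> 0" "\<And>x s. x \<in> orthant \<Longrightarrow> \<sigma> \<le> Re s \<Longrightarrow> norm s \<le> norm s0 + r \<Longrightarrow>
      norm (integrand h x s) \<le> C * (1 + norm x) powr (- (real d * \<sigma> - of_int D))"
    using integrand_bound[OF h, of \<sigma> "norm s0 + r"] by auto
  have "\<forall>k. \<forall>a\<in>orthant. \<forall>s\<in>cball s0 r. norm (integrand h (a + lattice_vec k) s) \<le> C * (1 + norm (lattice_vec k)) powr (- (real d * \<sigma> - of_int D))"
  proof (intro allI ballI)
    fix k and a :: "real^'n" and s assume a: "a \<in> orthant" and s: "s \<in> cball s0 r"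
    have "\<bar>Re (s0 - s)\<bar> \<le> r" using s abs_Re_le_cmod[of "s0 - s"] by (simp add: dist_norm)
    moreover have "norm s \<le> norm s0 + norm (s0 - s)" by (metis norm_triangle_sub norm_minus_commute)
    ultimately have s': "\<sigma> \<le> Re s" "norm s \<le> norm s0 + r" using s by (auto simp: \<sigma>_def dist_norm)
    have "norm (integrand h (a + lattice_vec k) s) \<le> C * (1 + norm (a + lattice_vec k)) powr (- (real d * \<sigma> - of_int D))"
      by (rule C(2)[OF orthant_add[OF a lattice_vec_orthant] s'])
    also have "\<dots> \<le> C * (1 + norm (lattice_vec k)) powr (- (real d * \<sigma> - of_int D))"
      using q norm_le_norm_add_orthant[OF lattice_vec_orthant a, of k]
      by (intro mult_left_mono[OF _ C(1)] powr_mono2') (auto simp: add_pos_nonneg add.commute)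
    finally show "norm (integrand h (a + lattice_vec k) s) \<le> C * (1 + norm (lattice_vec k)) powr (- (real d * \<sigma> - of_int D))" .
  qed
  moreover have "(\<lambda>k::nat^'n. C * (1 + norm (lattice_vec k)) powr (- (real d * \<sigma> - of_int D))) summable_on UNIV"
    by (intro summable_on_cmult_right summable_on_lattice_powr q)
  ultimately show "\<exists>r M. r > 0 \<and> M summable_on UNIV \<and> (\<forall>k. \<forall>a\<in>orthant. \<forall>s\<in>cball s0 r. norm (integrand h (a + lattice_vec k) s) \<le> M k)"
    using r by blast
qed

text \<open>Raabe's formula where everything converges: cut the orthant into unit cells and
  interchange the sum over cells with the integral over the cube.\<close>

lemma Z_integral_eq_integral_zeta_series:
  assumes h: "polyfun D h" and s: "s \<in> half_plane 0 D" and a: "a \<in> orthant"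
  shows "Z_integral h a s = integral (cbox 0 1) (\<lambda>t. zeta_series h (a + t) s)"
proof -
  obtain M :: "nat^'n \<Rightarrow> real" where M: "M summable_on UNIV" "\<And>k a. a \<in> orthant \<Longrightarrow> norm (integrand h (a + lattice_vec k) s) \<le> M k"
    using integrand_lattice_bound[OF h s] by metis
  have le: "norm (integrand h (a + (lattice_vec k + t)) s) \<le> M k" if "t \<in> cbox 0 1" for k t
    using M(2)[OF orthant_add[OF a cbox01_orthant[OF that]], of k] by (simp add: add_ac)
  have "((\<lambda>k. integral (cbox 0 1) (\<lambda>t. integrand h (a + (lattice_vec k + t)) s)) has_sum Z_integral h a s) UNIV"
    unfolding Z_integral_def by (rule orthant_integral_has_sum[OF integrand_cont[OF h a] M(1) le])
  moreover have "((\<lambda>k. integral (cbox 0 1) (\<lambda>t. integrand h (a + (lattice_vec k + t)) s)) has_sum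
      integral (cbox 0 1) (\<lambda>t. \<Sum>\<^sub>\<infinity>k\<in>UNIV. integrand h (a + (lattice_vec k + t)) s)) UNIV"
  proof (rule has_sum_integral_cbox[OF _ le M(1)])
    show "continuous_on (cbox 0 1) (\<lambda>t. integrand h (a + (lattice_vec k + t)) s)" for k
      by (rule continuous_on_compose2[OF integrand_cont[OF h a]]) (auto intro!: continuous_intros orthant_add[OF lattice_vec_orthant cbox01_orthant])
  qed auto
  moreover have "(\<Sum>\<^sub>\<infinity>k\<in>UNIV. integrand h (a + (lattice_vec k + t)) s) = zeta_series h (a + t) s" for t
    by (simp add: zeta_series_def add_ac)
  ultimately show ?thesis by (simp add: has_sum_unique)
qed

text \<open>The fundamental theorem of calculus along the segment from \<open>a\<close> to
  \<open>a + v\<close>, applied to each term of the series. The majorants of the differentiated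
  terms do not depend on \<open>u\<close>, which permits summation under the integral.\<close>

lemma zeta_series_ftc:
  assumes h: "polyfun D h" and s: "s \<in> half_plane 0 D" and a: "a \<in> orthant" and v: "v \<in> orthant"
  shows "zeta_series h (a + v) s = zeta_series h a s + integral {0..1} (\<lambda>u. \<Sum>i\<in>UNIV. of_real (v $ i) *
     (zeta_series (pd i h) (a + u *\<^sub>R v) s - s * zeta_series (\<lambda>x. h x * pd i F x) (a + u *\<^sub>R v) (s + 1)))"
proof -
  define A where "A = (\<lambda>i k u. integrand (pd i h) (a + u *\<^sub>R v + lattice_vec k) s)"
  define B where "B = (\<lambda>i k u. integrand (\<lambda>x. h x * pd i F x) (a + u *\<^sub>R v + lattice_vec k) (s + 1))"
  define G where "G = (\<lambda>k u. \<Sum>i\<in>UNIV. of_real (v $ i) * (A i k u - s * B i k u))"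
  have orth: "a + u *\<^sub>R v \<in> orthant" if "u \<in> {0..1}" for u
    using that by (auto intro!: orthant_add[OF a] orthant_scaleR[OF v])
  have pA: "polyfun (D - 1) (pd i h)" and pB: "polyfun (D + int d - 1) (\<lambda>x. h x * pd i F x)" for i
    by (rule polyfun_pd[OF h], rule polyfun_prod_pd[OF h])
  have sA: "s \<in> half_plane 0 (D - 1)" and sB: "s + 1 \<in> half_plane 0 (D + int d - 1)" using half_plane_step s by auto
  have contA: "continuous_on {0..1} (A i k)" and contB: "continuous_on {0..1} (B i k)" for i k
    unfolding A_def B_def
    by (rule integrand_compose_cont[OF pA] integrand_compose_cont[OF pB], auto intro!: continuous_intros orthant_add[OF orth])+
  have "\<exists>M :: nat^'n \<Rightarrow> real. M summable_on UNIV \<and> (\<forall>k u. u \<in> {0..1} \<longrightarrow> norm (A i k u) \<le> M k)" for i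
    using integrand_lattice_bound[OF pA sA] orth unfolding A_def by metis
  then obtain MA :: "'n \<Rightarrow> nat^'n \<Rightarrow> real" where MA: "\<And>i. MA i summable_on UNIV" "\<And>i k u. u \<in> {0..1} \<Longrightarrow> norm (A i k u) \<le> MA i k"
    by metis
  have "\<exists>M :: nat^'n \<Rightarrow> real. M summable_on UNIV \<and> (\<forall>k u. u \<in> {0..1} \<longrightarrow> norm (B i k u) \<le> M k)" for i
    using integrand_lattice_bound[OF pB sB] orth unfolding B_def by metis
  then obtain MB :: "'n \<Rightarrow> nat^'n \<Rightarrow> real" where MB: "\<And>i. MB i summable_on UNIV" "\<And>i k u. u \<in> {0..1} \<Longrightarrow> norm (B i k u) \<le> MB i k"
    by metis
  define M where "M = (\<lambda>k. \<Sum>i\<in>UNIV. \<bar>v $ i\<bar> * (MA i k + norm s * MB i k))"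
  have M: "M summable_on UNIV"
    unfolding M_def by (intro summable_on_finite_sum summable_on_cmult_right summable_on_add MA MB)
  have GM: "norm (G k u) \<le> M k" if u: "u \<in> {0..1}" for k u
    unfolding G_def M_def
  proof (rule sum_norm_le)
    fix i
    have "norm (A i k u - s * B i k u) \<le> norm (A i k u) + norm (s * B i k u)" by (rule norm_triangle_ineq4)
    also have "\<dots> \<le> MA i k + norm s * MB i k"
      unfolding norm_mult by (intro add_mono mult_left_mono MA MB u) auto
    finally show "norm (of_real (v $ i) * (A i k u - s * B i k u)) \<le> \<bar>v $ i\<bar> * (MA i k + norm s * MB i k)"
      unfolding norm_mult norm_of_real by (intro mult_left_mono) auto
  qed
  have step: "integrand h (a + v + lattice_vec k) s - integrand h (a + lattice_vec k) s = integral {0..1} (G k)" for k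
  proof -
    have "((\<lambda>u. integrand h (a + lattice_vec k + u *\<^sub>R v) s) has_vector_derivative G k u) (at u within {0..1})" if "u \<in> {0..1}" for u
    proof -
      have "a + lattice_vec k + w *\<^sub>R v \<in> orthant" if "w \<in> {0..1}" for w
        using orthant_add[OF orth[OF that] lattice_vec_orthant[of k]] by (simp add: add_ac)
      from integrand_has_vector_derivative[OF h this \<open>u \<in> {0..1}\<close>, of s]
      show ?thesis by (simp add: G_def A_def B_def add_ac)
    qed
    then have "(G k has_integral integrand h (a + lattice_vec k + 1 *\<^sub>R v) s - integrand h (a + lattice_vec k + 0 *\<^sub>R v) s) {0..1}"
      by (intro fundamental_theorem_of_calculus) auto
    then show ?thesis by (simp add: integral_unique add_ac)
  qed
  have "((\<lambda>k. integral (cbox 0 1) (G k)) has_sum integral (cbox 0 1) (\<lambda>u. \<Sum>\<^sub>\<infinity>k\<in>UNIV. G k u)) UNIV"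
  proof (rule has_sum_integral_cbox[OF _ _ M])
    show "continuous_on (cbox 0 1) (G k)" for k
      unfolding G_def using contA contB by (intro continuous_intros) auto
  qed (use GM in auto)
  then have "((\<lambda>k. integrand h (a + v + lattice_vec k) s - integrand h (a + lattice_vec k) s) has_sum integral {0..1} (\<lambda>u. \<Sum>\<^sub>\<infinity>k\<in>UNIV. G k u)) UNIV"
    by (simp add: step)
  moreover have "((\<lambda>k. integrand h (a + v + lattice_vec k) s - integrand h (a + lattice_vec k) s) has_sum zeta_series h (a + v) s - zeta_series h a s) UNIV"
    unfolding zeta_series_def by (intro has_sum_diff has_sum_infsum integrand_summable[OF h s] orthant_add a v)
  ultimately have "zeta_series h (a + v) s - zeta_series h a s = integral {0..1} (\<lambda>u. \<Sum>\<^sub>\<infinity>k\<in>UNIV. G k u)"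
    by (intro has_sum_unique)
  also have "\<dots> = integral {0..1} (\<lambda>u. \<Sum>i\<in>UNIV. of_real (v $ i) *
     (zeta_series (pd i h) (a + u *\<^sub>R v) s - s * zeta_series (\<lambda>x. h x * pd i F x) (a + u *\<^sub>R v) (s + 1)))"
  proof (rule integral_cong)
    fix u :: real assume u: "u \<in> {0..1}"
    have "((\<lambda>k. G k u) has_sum (\<Sum>i\<in>UNIV. of_real (v $ i) *
     (zeta_series (pd i h) (a + u *\<^sub>R v) s - s * zeta_series (\<lambda>x. h x * pd i F x) (a + u *\<^sub>R v) (s + 1)))) UNIV"
      unfolding G_def A_def B_def zeta_series_def
      by (intro has_sum_finite_sum has_sum_cmult_right has_sum_diff
          has_sum_infsum[OF integrand_summable[OF pA sA orth[OF u]]] has_sum_infsum[OF integrand_summable[OF pB sB orth[OF u]]])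
    then show "(\<Sum>\<^sub>\<infinity>k\<in>UNIV. G k u) = (\<Sum>i\<in>UNIV. of_real (v $ i) *
     (zeta_series (pd i h) (a + u *\<^sub>R v) s - s * zeta_series (\<lambda>x. h x * pd i F x) (a + u *\<^sub>R v) (s + 1)))"
      by (rule infsumI)
  qed
  finally show ?thesis by (simp add: algebra_simps)
qed

text \<open>The linear form d s - D - p. For D = deg g, the equation
  \<open>pole_form D s = - of_nat l\<close> describes the l-th candidate pole.\<close>

definition pole_form :: "int \<Rightarrow> complex \<Rightarrow> complex" where
  "pole_form D s = of_nat d * s - of_int D - of_nat CARD('n)"

text \<open>The radial derivative of the shifted integrand carries the factor x, whereas Euler's
  identity at a + x needs the factor a + x. Writing x = (a + x) - a produces the sums weighted by
  \<open>a $ i\<close>. The leading terms D h and d F combine with the dimension p to give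
  \<open>pole_form D s\<close>.\<close>

lemma Z_integral_euler:
  assumes h: "polyfun D h" and s: "s \<in> half_plane 0 D" and a: "a \<in> orthant"
  shows "pole_form D s * Z_integral h a s = Z_integral (eul (of_int D) h) a s - (\<Sum>i\<in>UNIV. of_real (a $ i) * Z_integral (pd i h) a s)
    + s * (Z_integral (\<lambda>x. - h x * eul (real d) F x) a (s + 1) + (\<Sum>i\<in>UNIV. of_real (a $ i) * Z_integral (\<lambda>x. h x * pd i F x) a (s + 1)))"
proof -
  obtain q where q: "q > real CARD('n)" "decays q (\<lambda>x. integrand h (a + x) s)"
    "\<And>k. polyfun (D - 1) k \<Longrightarrow> decays q (\<lambda>x. integrand k (a + x) s)"
    "\<And>k. polyfun (D + int d - 1) k \<Longrightarrow> decays q (\<lambda>x. integrand k (a + x) (s + 1))"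
    using integrand_decays_half_plane[OF h s a] by blast
  define T1 where "T1 = (\<lambda>x. integrand (eul (of_int D) h) (a + x) s)"
  define T2 where "T2 = (\<lambda>i x. integrand (pd i h) (a + x) s)"
  define T3 where "T3 = (\<lambda>x. integrand (\<lambda>x. - h x * eul (real d) F x) (a + x) (s + 1))"
  define T4 where "T4 = (\<lambda>i x. integrand (\<lambda>x. h x * pd i F x) (a + x) (s + 1))"
  define G where "G = (\<lambda>x. integrand h (a + x) s)"
  define K where "K = (\<lambda>x. \<Sum>i\<in>UNIV. of_real (x $ i) * (T2 i x - s * T4 i x))"
  have T: "decays q G" "decays q T1" "\<And>i. decays q (T2 i)" "decays q T3" "\<And>i. decays q (T4 i)"
    using q polyfun_eul[OF h] polyfun_pd[OF h] polyfun_prod_eul[OF h] polyfun_prod_pd[OF h]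
    by (simp_all add: G_def T1_def T2_def T3_def T4_def)
  \<comment> \<open>The radial derivative after this substitution, as a combination of the
    integrands in the statement; each of them decays with exponent \<open>q\<close> and can be
    integrated separately.\<close>
  define K' where "K' = (\<lambda>x. (T1 x + (\<Sum>i\<in>UNIV. (- of_real (a $ i)) * T2 i x)) + (s * (T3 x + (\<Sum>i\<in>UNIV. of_real (a $ i) * T4 i x)) + (of_int D - s * of_nat d) * G x))"
  have K': "K x = K' x" if x: "x \<in> orthant" for x
  proof -
    let ?y = "a + x" and ?E = "exp (- s * lf (a + x))"
    have e: "exp (- (s + 1) * lf ?y) = ?E / F ?y"
    proof -
      have "- (s + 1) * lf ?y = - s * lf ?y - lf ?y" by (simp add: algebra_simps)
      then show ?thesis using exp_lf[OF orthant_add[OF a x]] by (simp only: exp_diff)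
    qed
    have nz: "F ?y \<noteq> 0" by (rule F_nonzero[OF orthant_add[OF a x]])
    have 1: "(\<Sum>i\<in>UNIV. of_real (x $ i) * pd i k ?y) = eul r k ?y + of_real r * k ?y - (\<Sum>i\<in>UNIV. of_real (a $ i) * pd i k ?y)" for k r
      by (simp add: eul_def sum.distrib algebra_simps flip: sum_subtractf)
    have "K x = (\<Sum>i\<in>UNIV. of_real (x $ i) * pd i h ?y) * ?E - s * h ?y * (\<Sum>i\<in>UNIV. of_real (x $ i) * pd i F ?y) * (?E / F ?y)"
      unfolding K_def T2_def T4_def integrand_def e by (simp add: sum_subtractf sum_distrib_left sum_distrib_right algebra_simps)
    also have "\<dots> = K' x"
      unfolding 1[of h "of_int D"] 1[of F "real d"] K'_def T1_def T2_def T3_def T4_def G_def integrand_def e using nz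
      by (simp add: field_simps sum_distrib_left sum_distrib_right sum_negf sum_divide_distrib)
    finally show ?thesis .
  qed
  have decK': "decays q K'"
    unfolding K'_def by (intro decays_add decays_cmult decays_sum T)
  obtain C1 where C1: "C1 \<ge> 0" "\<forall>x\<in>orthant. norm (G x) \<le> C1 * (1 + norm x) powr (- q)" "continuous_on orthant G"
    using T(1) unfolding decays_def by blast
  obtain C2 where C2: "C2 \<ge> 0" "\<forall>x\<in>orthant. norm (K' x) \<le> C2 * (1 + norm x) powr (- q)" "continuous_on orthant K'"
    using decK' unfolding decays_def by blast
  have "(LINT x:orthant|lborel. of_nat CARD('n) * G x + K x) = 0"
  proof (rule orthant_integral_euler[where C = "C1 + C2" and q = q])
    show "continuous_on orthant K"
      using C2(3) K' by (simp cong: continuous_on_cong)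
    show "norm (G x) \<le> (C1 + C2) * (1 + norm x) powr (- q)" if "x \<in> orthant" for x
      using C1(2)[rule_format, OF that] C2(1) by (simp add: distrib_right add_increasing2)
    show "norm (K x) \<le> (C1 + C2) * (1 + norm x) powr (- q)" if "x \<in> orthant" for x
      using C2(2)[rule_format, OF that] C1(1) K'[OF that] by (simp add: distrib_right add_increasing)
    fix x :: "real^'n" and c :: real assume x: "x \<in> orthant" and c: "c \<in> {1..2}"
    have "a + u *\<^sub>R x \<in> orthant" if "u \<in> {1..2}" for u
      using that by (auto intro!: orthant_add[OF a] orthant_scaleR[OF x])
    from integrand_has_vector_derivative[OF h this c, of s]
    have "((\<lambda>c. G (c *\<^sub>R x)) has_vector_derivative (\<Sum>i\<in>UNIV. of_real (x $ i) * (T2 i (c *\<^sub>R x) - s * T4 i (c *\<^sub>R x)))) (at c within {1..2})"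
      by (simp add: G_def T2_def T4_def)
    moreover have "K (c *\<^sub>R x) / of_real c = (\<Sum>i\<in>UNIV. of_real (x $ i) * (T2 i (c *\<^sub>R x) - s * T4 i (c *\<^sub>R x)))"
      using c unfolding K_def by (simp add: sum_divide_distrib)
    ultimately show "((\<lambda>c. G (c *\<^sub>R x)) has_vector_derivative K (c *\<^sub>R x) / of_real c) (at c within {1..2})" by simp
  qed (use C1 q in auto)
  also have "(LINT x:orthant|lborel. of_nat CARD('n) * G x + K x) = (LINT x:orthant|lborel. of_nat CARD('n) * G x + K' x)"
    using K' by (intro set_lebesgue_integral_cong) (auto simp: borel_closed orthant_closed)
  finally have 0: "(LINT x:orthant|lborel. of_nat CARD('n) * G x + K' x) = 0" .
  have I: "set_integrable lborel orthant g" if "decays q g" for g :: "real^'n \<Rightarrow> complex"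
    by (rule decays_integrable[OF that q(1)])
  have add: "(LINT x:orthant|lborel. g x + k x) = (LINT x:orthant|lborel. g x) + (LINT x:orthant|lborel. k x)"
    if "decays q g" "decays q k" for g k :: "real^'n \<Rightarrow> complex"
    by (rule set_integral_add(2)[OF I[OF that(1)] I[OF that(2)]])
  have sum: "(LINT x:orthant|lborel. (\<Sum>i\<in>UNIV. g i x)) = (\<Sum>i\<in>UNIV. LINT x:orthant|lborel. g i x)"
    if "\<And>i. decays q (g i)" for g :: "'n \<Rightarrow> real^'n \<Rightarrow> complex"
    using I[OF that] unfolding set_lebesgue_integral_def set_integrable_def scaleR_sum_right by (intro Bochner_Integration.integral_sum) auto
  have Z: "Z_integral h a s = (LINT x:orthant|lborel. G x)" "Z_integral (eul (of_int D) h) a s = (LINT x:orthant|lborel. T1 x)"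
    "\<And>i. Z_integral (pd i h) a s = (LINT x:orthant|lborel. T2 i x)"
    "Z_integral (\<lambda>x. - h x * eul (real d) F x) a (s + 1) = (LINT x:orthant|lborel. T3 x)"
    "\<And>i. Z_integral (\<lambda>x. h x * pd i F x) a (s + 1) = (LINT x:orthant|lborel. T4 i x)"
    by (simp_all only: Z_integral_def G_def T1_def T2_def T3_def T4_def)
  have "(LINT x:orthant|lborel. of_nat CARD('n) * G x + K' x) =
    of_nat CARD('n) * Z_integral h a s + ((Z_integral (eul (of_int D) h) a s + (\<Sum>i\<in>UNIV. (- of_real (a $ i)) * Z_integral (pd i h) a s))
    + (s * (Z_integral (\<lambda>x. - h x * eul (real d) F x) a (s + 1) + (\<Sum>i\<in>UNIV. of_real (a $ i) * Z_integral (\<lambda>x. h x * pd i F x) a (s + 1)))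
    + (of_int D - s * of_nat d) * Z_integral h a s))"
    unfolding Z K'_def
    by (subst add; (intro decays_add decays_cmult decays_sum T)?)+
       (simp only: add sum decays_add decays_cmult decays_sum T set_integral_mult_right)
  with 0 show ?thesis
    by (simp add: pole_form_def algebra_simps sum_negf eq_neg_iff_add_eq_0)
qed

section \<open>Entire continuation\<close>

text \<open>The reciprocal Gamma factor has its simple zeros exactly at the possible poles, and \<open>Gamma s\<close> absorbs the
  factors \<open>s (s + 1) \<dots> (s + j - 1)\<close> created by differentiating \<open>f\<^sup>-\<^sup>s\<close>. With this normalisation the
  continuations are entire and the recursions have no denominators.\<close>

definition normalizer :: "int \<Rightarrow> complex \<Rightarrow> complex" where
  "normalizer D s = Gamma s * rGamma (pole_form D s)"

lemma pole_form_step: "pole_form (D - 1) s = pole_form D s + 1" "pole_form (D + int d - 1) (s + 1) = pole_form D s + 1"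
  by (simp_all add: pole_form_def algebra_simps)

lemma pole_form_holomorphic: "pole_form D holomorphic_on A"
  unfolding pole_form_def[abs_def] by (intro holomorphic_intros)

text \<open>The functional equation of \<open>rGamma\<close>: it supplies the factor that stands on
  the left of \<open>Z_integral_euler\<close>.\<close>

lemma normalizer_step1: "normalizer D s = pole_form D s * normalizer (D - 1) s"
  using rGamma_plus1[of "pole_form D s"] by (simp add: normalizer_def pole_form_step)

text \<open>The factor s of the terms at s + 1 is absorbed by Gamma (s + 1) = s Gamma s; the
  hypothesis keeps s away from the poles of Gamma.\<close>

lemma normalizer_step2: "Re s > 0 \<Longrightarrow> normalizer (D + int d - 1) (s + 1) = s * normalizer (D - 1) s"
  unfolding normalizer_def pole_form_step(2)[of D s] pole_form_step(1)[of D s]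
  by (subst Gamma_plus1) (auto elim!: nonpos_Ints_cases)

lemma normalizer_holomorphic: "D \<ge> 0 \<Longrightarrow> normalizer D holomorphic_on half_plane 0 D"
  unfolding normalizer_def[abs_def]
  by (intro holomorphic_on_mult holomorphic_Gamma holomorphic_rGamma' pole_form_holomorphic)
     (auto elim!: nonpos_Ints_cases dest!: half_plane_0_Re_pos)

lemma Z_integral_zero [simp]: "Z_integral (\<lambda>_. 0) a s = 0"
  by (simp add: Z_integral_def set_lebesgue_integral_def)

lemma zeta_series_zero [simp]: "zeta_series (\<lambda>_. 0) a s = 0"
  by (simp add: zeta_series_def)

section \<open>Continuation of the integral\<close>

lemma hcont_Z_integral:
  assumes h: "polyfun D h"
  shows "hcont (half_plane 0 D) (Z_integral h)"
proof (rule hcont_cong)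
  show "hcont (half_plane 0 D) (\<lambda>a s. integral (cbox 0 1) (\<lambda>t. of_real 1 * zeta_series h (a + t) s))"
    by (intro hcont_integral[OF open_half_plane hcont_zeta_series[OF h]] continuous_intros) (rule cbox01_orthant)
qed (simp add: Z_integral_eq_integral_zeta_series[OF h])

text \<open>Stage m is meant for \<open>half_plane m D\<close>. The successor equation is
  \<open>Z_integral_euler\<close> multiplied by \<open>normalizer (D - 1) s\<close>: by the two
  normaliser steps \<open>pole_form D s\<close> and s disappear into the normalisers.\<close>

primrec Z_cont :: "nat \<Rightarrow> int \<Rightarrow> (real^'n \<Rightarrow> complex) \<Rightarrow> real^'n \<Rightarrow> complex \<Rightarrow> complex" where
  "Z_cont 0 D h a s = normalizer D s * Z_integral h a s"
| "Z_cont (Suc m) D h a s =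
     Z_cont m (D - 1) (eul (of_int D) h) a s - (\<Sum>i\<in>UNIV. of_real (a $ i) * Z_cont m (D - 1) (pd i h) a s)
     + (Z_cont m (D + int d - 1) (\<lambda>x. - h x * eul (real d) F x) a (s + 1)
        + (\<Sum>i\<in>UNIV. of_real (a $ i) * Z_cont m (D + int d - 1) (\<lambda>x. h x * pd i F x) a (s + 1)))"

lemma hcont_shift: "hcont (half_plane m (D + int d - 1)) \<Theta> \<Longrightarrow> hcont (half_plane (Suc m) D) (\<lambda>a s. \<Theta> a (s + 1))"
  by (rule hcont_compose) (auto simp: half_plane_Suc_iff(2) intro!: holomorphic_intros)

lemma hcont_drop: "hcont (half_plane m (D - 1)) \<Theta> \<Longrightarrow> hcont (half_plane (Suc m) D) \<Theta>"
  by (rule hcont_subset) (auto simp: half_plane_Suc_iff(1))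

lemma hcont_Z_cont: "polyfun D h \<Longrightarrow> hcont (half_plane m D) (Z_cont m D h)"
proof (induction m arbitrary: D h)
  case 0
  show ?case
  proof (cases "D \<ge> 0")
    case True
    then show ?thesis
      using hcont_mult[OF hcont_hol[OF normalizer_holomorphic] hcont_Z_integral[OF 0]] by simp
  next
    \<comment> \<open>A negative degree bound leaves only the zero function, so the possible poles
      of the normaliser do no harm.\<close>
    case False
    then have "h = (\<lambda>_. 0)" using polyfun_neg[OF 0] by simp
    then show ?thesis by simp
  qed
next
  case (Suc m)
  have c: "hcont A (\<lambda>(a::real^'n) _. complex_of_real (a $ i))" for A i
    by (intro hcont_param continuous_intros)
  show ?case
    unfolding Z_cont.simps
    by (intro hcont_add hcont_diff hcont_sum hcont_mult c hcont_drop hcont_shift Suc.IH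
        polyfun_pd polyfun_eul polyfun_prod_pd polyfun_prod_eul Suc.prems)
qed

lemma Z_cont_step:
  "polyfun D h \<Longrightarrow> a \<in> orthant \<Longrightarrow> s \<in> half_plane m D \<Longrightarrow> Z_cont (Suc m) D h a s = Z_cont m D h a s"
proof (induction m arbitrary: D h s)
  case 0
  show ?case
  proof (cases "D \<ge> 0")
    case True
    then have "Re s > 0" using half_plane_0_Re_pos 0 by blast
    then have "Z_cont (Suc 0) D h a s = normalizer (D - 1) s * (pole_form D s * Z_integral h a s)"
      unfolding Z_integral_euler[OF 0(1,3,2)] Z_cont.simps normalizer_step2[OF \<open>Re s > 0\<close>]
      by (simp add: sum_distrib_left algebra_simps)
    then show ?thesis by (simp add: normalizer_step1[of D])
  next
    case False
    then have "h = (\<lambda>_. 0)" using polyfun_neg[OF 0(1)] by simp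
    then show ?thesis by simp
  qed
next
  case (Suc m)
  have s: "s \<in> half_plane m (D - 1)" "s + 1 \<in> half_plane m (D + int d - 1)"
    using Suc.prems(3) half_plane_Suc_iff by blast+
  note IH1 = Suc.IH[OF _ Suc.prems(2) s(1)] and IH2 = Suc.IH[OF _ Suc.prems(2) s(2)]
  show ?case
    unfolding Z_cont.simps(2)[of "Suc m"] Z_cont.simps(2)[of m D h]
    using IH1[OF polyfun_eul[OF Suc.prems(1)]] IH1[OF polyfun_pd[OF Suc.prems(1)]]
      IH2[OF polyfun_prod_eul[OF Suc.prems(1)]] IH2[OF polyfun_prod_pd[OF Suc.prems(1)]]
    by (simp only:)
qed

definition Z_ext :: "int \<Rightarrow> (real^'n \<Rightarrow> complex) \<Rightarrow> real^'n \<Rightarrow> complex \<Rightarrow> complex" where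
  "Z_ext D h a s = Z_cont (LEAST m. s \<in> half_plane m D) D h a s"

lemma
  assumes "polyfun D h"
  shows hcont_Z_ext: "hcont UNIV (Z_ext D h)"
    and Z_ext_eq: "a \<in> orthant \<Longrightarrow> s \<in> half_plane 0 D \<Longrightarrow> Z_ext D h a s = normalizer D s * Z_integral h a s"
  using hcont_glue[of "\<lambda>m. half_plane m D" "\<lambda>m. Z_cont m D h", OF open_half_plane half_plane_mono half_plane_exhaust hcont_Z_cont[OF assms] Z_cont_step[OF assms]]
  by (simp_all add: Z_ext_def[abs_def] del: Z_cont.simps(2))

section \<open>Continuation of the lattice sum, with pairs (t, u) parametrising the points a + u
  t\<close>

abbreviation cube_wedge :: "((real^'n) \<times> real) set" where
  "cube_wedge \<equiv> cbox (0, 0) (1, 1)"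

text \<open>The cube average of \<open>zeta_series_ftc\<close> is Z by Raabe's formula; solving for
  the undifferentiated term and normalising gives the successor equation.
  \<open>pole_form D s\<close> stays in front because \<open>normalizer D s\<close> is that factor
  times the normaliser of the terms on the right.\<close>

primrec zeta_cont :: "nat \<Rightarrow> int \<Rightarrow> (real^'n \<Rightarrow> complex) \<Rightarrow> real^'n \<Rightarrow> complex \<Rightarrow> complex" where
  "zeta_cont 0 D h a s = normalizer D s * zeta_series h a s"
| "zeta_cont (Suc m) D h a s = Z_ext D h a s - pole_form D s * (\<Sum>i\<in>UNIV.
     integral cube_wedge (\<lambda>y. of_real (fst y $ i) * zeta_cont m (D - 1) (pd i h) (a + snd y *\<^sub>R fst y) s)
     - integral cube_wedge (\<lambda>y. of_real (fst y $ i) * zeta_cont m (D + int d - 1) (\<lambda>x. h x * pd i F x) (a + snd y *\<^sub>R fst y) (s + 1)))"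

lemma wedge_orthant: "y \<in> cube_wedge \<Longrightarrow> snd y *\<^sub>R fst y \<in> orthant"
  by (cases y) (auto simp: cbox_Pair_eq intro!: orthant_scaleR[OF cbox01_orthant])

lemma hcont_wedge:
  assumes "open H" "hcont H \<Theta>"
  shows "hcont H (\<lambda>a s. integral cube_wedge (\<lambda>y. of_real (fst y $ i) * \<Theta> (a + snd y *\<^sub>R fst y) s))"
  by (rule hcont_integral[OF assms, where w = "\<lambda>y. fst y $ i" and \<phi> = "\<lambda>y. snd y *\<^sub>R fst y"])
     (auto intro!: continuous_intros wedge_orthant)

lemma hcont_zeta_cont: "polyfun D h \<Longrightarrow> hcont (half_plane m D) (zeta_cont m D h)"
proof (induction m arbitrary: D h)
  case 0
  show ?case
  proof (cases "D \<ge> 0")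
    case True
    then show ?thesis
      using hcont_mult[OF hcont_hol[OF normalizer_holomorphic] hcont_zeta_series[OF 0]] by simp
  next
    case False
    then have "h = (\<lambda>_. 0)" using polyfun_neg[OF 0] by simp
    then show ?thesis by simp
  qed
next
  case (Suc m)
  note 1 = Suc.IH[OF polyfun_pd[OF Suc.prems]] and 2 = Suc.IH[OF polyfun_prod_pd[OF Suc.prems]]
  show ?case
    unfolding zeta_cont.simps
    by (intro hcont_diff hcont_mult hcont_sum hcont_hol[OF pole_form_holomorphic] hcont_subset[OF hcont_Z_ext[OF Suc.prems] subset_UNIV]
        hcont_drop[OF hcont_wedge[OF open_half_plane 1]] hcont_shift[OF hcont_wedge[OF open_half_plane 2]])
qed

text \<open>Only the base case carries content: averaging \<open>zeta_series_ftc\<close> over the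
  cube and using Raabe's formula in the half-plane of convergence. Later stages agree because their
  ingredients do.\<close>

lemma zeta_cont_step:
  "polyfun D h \<Longrightarrow> a \<in> orthant \<Longrightarrow> s \<in> half_plane m D \<Longrightarrow> zeta_cont (Suc m) D h a s = zeta_cont m D h a s"
proof (induction m arbitrary: D h a s)
  case 0
  show ?case
  proof (cases "D \<ge> 0")
    case True
    then have Re: "Re s > 0" using half_plane_0_Re_pos 0 by blast
    define A where "A = (\<lambda>i y. of_real (fst y $ i) * zeta_series (pd i h) (a + snd y *\<^sub>R fst y) s)"
    define B where "B = (\<lambda>i y. of_real (fst y $ i) * zeta_series (\<lambda>x. h x * pd i F x) (a + snd y *\<^sub>R fst y) (s + 1))"
    have s: "s \<in> half_plane 0 (D - 1)" "s + 1 \<in> half_plane 0 (D + int d - 1)" using half_plane_step 0 by blast+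
    have cont: "continuous_on cube_wedge (\<lambda>y. of_real (fst y $ i) * \<Theta> (a + snd y *\<^sub>R fst y) z)"
      if "hcont H \<Theta>" "z \<in> H" for \<Theta> H z i
    proof -
      have "continuous_on cube_wedge (\<lambda>y. \<Theta> (fst (a + snd y *\<^sub>R fst y, z)) (snd (a + snd y *\<^sub>R fst y, z)))"
        using that(2) by (intro continuous_on_compose2[OF hcont_continuous[OF that(1)]])
          (auto intro!: continuous_intros orthant_add[OF 0(2) wedge_orthant])
      then show ?thesis by (auto intro!: continuous_intros)
    qed
    have contA: "continuous_on cube_wedge (A i)" for i
      unfolding A_def by (rule cont[OF hcont_zeta_series[OF polyfun_pd[OF 0(1)]] s(1)])
    have contB: "continuous_on cube_wedge (B i)" for i
      unfolding B_def by (rule cont[OF hcont_zeta_series[OF polyfun_prod_pd[OF 0(1)]] s(2)])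
    have "integral (cbox 0 1) (\<lambda>t. zeta_series h (a + t) s) = zeta_series h a s + integral cube_wedge (\<lambda>(t, u). \<Sum>i\<in>UNIV. A i (t, u) - s * B i (t, u))"
    proof (rule integral_unit_cube_ftc)
      show "continuous_on cube_wedge (\<lambda>(t, u). \<Sum>i\<in>UNIV. A i (t, u) - s * B i (t, u))"
        unfolding case_prod_beta prod.collapse by (intro continuous_intros contA contB)
      fix t :: "real^'n" assume "t \<in> cbox 0 1"
      from zeta_series_ftc[OF 0(1,3,2) cbox01_orthant[OF this]]
      show "zeta_series h (a + t) s = zeta_series h a s + integral {0..1} (\<lambda>u. \<Sum>i\<in>UNIV. A i (t, u) - s * B i (t, u))"
        by (simp add: A_def B_def algebra_simps)
    qed
    also have "integral cube_wedge (\<lambda>(t, u). \<Sum>i\<in>UNIV. A i (t, u) - s * B i (t, u)) =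
        (\<Sum>i\<in>UNIV. integral cube_wedge (A i) - s * integral cube_wedge (B i))"
      unfolding case_prod_beta prod.collapse
      by (intro integral_unique has_integral_sum has_integral_diff has_integral_mult_right
          integrable_integral integrable_continuous contA contB) auto
    finally have Z: "Z_integral h a s = zeta_series h a s + (\<Sum>i\<in>UNIV. integral cube_wedge (A i) - s * integral cube_wedge (B i))"
      by (simp add: Z_integral_eq_integral_zeta_series[OF 0(1,3,2)])
    have i1: "integral cube_wedge (\<lambda>y. of_real (fst y $ i) * (normalizer (D - 1) s * zeta_series (pd i h) (a + snd y *\<^sub>R fst y) s)) =
        normalizer (D - 1) s * integral cube_wedge (A i)" for i
      unfolding A_def by (subst integral_mult_right[symmetric]) (simp add: mult_ac)
    have i2: "integral cube_wedge (\<lambda>y. of_real (fst y $ i) * (normalizer (D + int d - 1) (s + 1) * zeta_series (\<lambda>x. h x * pd i F x) (a + snd y *\<^sub>R fst y) (s + 1))) =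
        normalizer (D - 1) s * (s * integral cube_wedge (B i))" for i
      unfolding B_def normalizer_step2[OF Re] mult.assoc[symmetric]
      by (subst integral_mult_right[symmetric]) (simp add: mult_ac)
    have "zeta_cont (Suc 0) D h a s = normalizer D s * Z_integral h a s - pole_form D s * (\<Sum>i\<in>UNIV. normalizer (D - 1) s * integral cube_wedge (A i) - normalizer (D - 1) s * (s * integral cube_wedge (B i)))"
      by (simp only: zeta_cont.simps i1 i2 Z_ext_eq[OF 0])
    also have "\<dots> = normalizer D s * Z_integral h a s - normalizer D s * (\<Sum>i\<in>UNIV. integral cube_wedge (A i) - s * integral cube_wedge (B i))"
      unfolding normalizer_step1[of D] by (simp add: sum_distrib_left right_diff_distrib mult.assoc)
    finally show ?thesis unfolding Z by (simp add: distrib_left)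
  next
    case False
    then have "h = (\<lambda>_. 0)" using polyfun_neg[OF 0(1)] by simp
    then show ?thesis using Z_ext_eq[OF 0] by simp
  qed
next
  case (Suc m)
  have s: "s \<in> half_plane m (D - 1)" "s + 1 \<in> half_plane m (D + int d - 1)"
    using Suc.prems(3) half_plane_Suc_iff by blast+
  note orth = orthant_add[OF Suc.prems(2) wedge_orthant]
  have "integral cube_wedge (\<lambda>y. of_real (fst y $ i) * zeta_cont (Suc m) (D - 1) (pd i h) (a + snd y *\<^sub>R fst y) s) =
      integral cube_wedge (\<lambda>y. of_real (fst y $ i) * zeta_cont m (D - 1) (pd i h) (a + snd y *\<^sub>R fst y) s)" for i
    by (intro integral_cong) (simp only: Suc.IH[OF polyfun_pd[OF Suc.prems(1)] orth s(1)])
  moreover have "integral cube_wedge (\<lambda>y. of_real (fst y $ i) * zeta_cont (Suc m) (D + int d - 1) (\<lambda>x. h x * pd i F x) (a + snd y *\<^sub>R fst y) (s + 1)) =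
      integral cube_wedge (\<lambda>y. of_real (fst y $ i) * zeta_cont m (D + int d - 1) (\<lambda>x. h x * pd i F x) (a + snd y *\<^sub>R fst y) (s + 1))" for i
    by (intro integral_cong) (simp only: Suc.IH[OF polyfun_prod_pd[OF Suc.prems(1)] orth s(2)])
  ultimately show ?case
    unfolding zeta_cont.simps(2)[of "Suc m"] zeta_cont.simps(2)[of m D h] by (simp only:)
qed

definition zeta_ext :: "int \<Rightarrow> (real^'n \<Rightarrow> complex) \<Rightarrow> real^'n \<Rightarrow> complex \<Rightarrow> complex" where
  "zeta_ext D h a s = zeta_cont (LEAST m. s \<in> half_plane m D) D h a s"

lemma
  assumes "polyfun D h"
  shows hcont_zeta_ext: "hcont UNIV (zeta_ext D h)"
    and zeta_ext_eq: "a \<in> orthant \<Longrightarrow> s \<in> half_plane 0 D \<Longrightarrow> zeta_ext D h a s = normalizer D s * zeta_series h a s"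
  using hcont_glue[of "\<lambda>m. half_plane m D" "\<lambda>m. zeta_cont m D h", OF open_half_plane half_plane_mono half_plane_exhaust hcont_zeta_cont[OF assms] zeta_cont_step[OF assms]]
  by (simp_all add: zeta_ext_def[abs_def] del: zeta_cont.simps(2))

text \<open>Both sides are entire in s: the right one because averaging over the cube preserves
  \<open>hcont\<close>. They agree where the series converges.\<close>

lemma raabe:
  assumes h: "polyfun D h" and a: "a \<in> orthant"
  shows "Z_ext D h a s = integral (cbox 0 1) (\<lambda>t. zeta_ext D h (a + t) s)"
proof (rule entire_eqI[OF hcont_Z_ext[OF h] _ open_half_plane half_plane_nonempty _ a])
  have "hcont UNIV (\<lambda>a s. integral (cbox 0 1) (\<lambda>t. of_real 1 * zeta_ext D h (a + t) s))"
    by (intro hcont_integral hcont_zeta_ext[OF h] continuous_intros) (auto intro: cbox01_orthant)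
  then show "hcont UNIV (\<lambda>a s. integral (cbox 0 1) (\<lambda>t. zeta_ext D h (a + t) s))" by simp
  fix s assume s: "s \<in> half_plane 0 D"
  have "integral (cbox 0 1) (\<lambda>t. zeta_ext D h (a + t) s) = integral (cbox 0 1) (\<lambda>t. normalizer D s * zeta_series h (a + t) s)"
    by (intro integral_cong zeta_ext_eq[OF h orthant_add[OF a cbox01_orthant] s])
  then show "Z_ext D h a s = integral (cbox 0 1) (\<lambda>t. zeta_ext D h (a + t) s)"
    by (simp add: Z_ext_eq[OF h a s] Z_integral_eq_integral_zeta_series[OF h s a])
qed

text \<open>The continued form of \<open>zeta_series_ftc\<close>. After normalisation the factor s
  is gone and \<open>pole_form D s\<close> stands in front, so at a zero of that form the function
  is constant in the shift.\<close>

lemma zeta_ext_ftc: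
  assumes h: "polyfun D h" and a: "a \<in> orthant" and v: "v \<in> orthant"
  shows "zeta_ext D h (a + v) s = zeta_ext D h a s + pole_form D s * integral {0..1} (\<lambda>u. \<Sum>i\<in>UNIV. of_real (v $ i) *
     (zeta_ext (D - 1) (pd i h) (a + u *\<^sub>R v) s - zeta_ext (D + int d - 1) (\<lambda>x. h x * pd i F x) (a + u *\<^sub>R v) (s + 1)))"
proof -
  define R where "R = (\<lambda>a s. \<Sum>i\<in>UNIV. of_real (v $ i) * (zeta_ext (D - 1) (pd i h) a s - zeta_ext (D + int d - 1) (\<lambda>x. h x * pd i F x) a (s + 1)))"
  have hR: "hcont UNIV R"
    unfolding R_def
    by (intro hcont_sum hcont_mult hcont_hol holomorphic_intros hcont_diff hcont_zeta_ext polyfun_pd h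
        hcont_compose[OF hcont_zeta_ext[OF polyfun_prod_pd[OF h]]]) auto
  have "hcont UNIV (\<lambda>a s. integral (cbox 0 1) (\<lambda>u::real. of_real 1 * R (a + u *\<^sub>R v) s))"
    by (rule hcont_integral[OF open_UNIV hR]) (auto intro!: continuous_intros orthant_scaleR[OF v])
  then have hI: "hcont UNIV (\<lambda>a s. integral {0..1} (\<lambda>u. R (a + u *\<^sub>R v) s))" by simp
  have "zeta_ext D h (a + v) s = zeta_ext D h a s + pole_form D s * integral {0..1} (\<lambda>u. R (a + u *\<^sub>R v) s)"
  proof (rule entire_eqI[where A = "\<lambda>a s. zeta_ext D h (a + v) s", OF _ _ open_half_plane[of 0 D] half_plane_nonempty _ a])
    have "continuous_on (orthant \<times> UNIV) (\<lambda>y. zeta_ext D h (fst (fst y + v, snd y)) (snd (fst y + v, snd y)))"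
      by (rule continuous_on_compose2[OF hcont_continuous[OF hcont_zeta_ext[OF h]]])
         (auto intro!: continuous_intros orthant_add v)
    moreover have "\<forall>a\<in>orthant. zeta_ext D h (a + v) holomorphic_on UNIV"
      using hcont_zeta_ext[OF h] orthant_add[OF _ v] unfolding hcont_def by blast
    ultimately show "hcont UNIV (\<lambda>a s. zeta_ext D h (a + v) s)" by (simp add: hcont_def case_prod_beta)
    show "hcont UNIV (\<lambda>a s. zeta_ext D h a s + pole_form D s * integral {0..1} (\<lambda>u. R (a + u *\<^sub>R v) s))"
      by (intro hcont_add hcont_mult hcont_hol pole_form_holomorphic hI hcont_zeta_ext h)
    fix s assume s: "s \<in> half_plane 0 D"
    have s': "s \<in> half_plane 0 (D - 1)" "s + 1 \<in> half_plane 0 (D + int d - 1)" using half_plane_step s by blast+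
    show "zeta_ext D h (a + v) s = zeta_ext D h a s + pole_form D s * integral {0..1} (\<lambda>u. R (a + u *\<^sub>R v) s)"
    proof (cases "D \<ge> 0")
      case True
      then have Re: "Re s > 0" using half_plane_0_Re_pos s by blast
      have "R (a + u *\<^sub>R v) s = normalizer (D - 1) s * (\<Sum>i\<in>UNIV. of_real (v $ i) *
          (zeta_series (pd i h) (a + u *\<^sub>R v) s - s * zeta_series (\<lambda>x. h x * pd i F x) (a + u *\<^sub>R v) (s + 1)))" if u: "u \<in> {0..1}" for u
      proof -
        have o: "a + u *\<^sub>R v \<in> orthant" using u by (auto intro!: orthant_add[OF a] orthant_scaleR[OF v])
        show ?thesis
          unfolding R_def zeta_ext_eq[OF polyfun_pd[OF h] o s'(1)] zeta_ext_eq[OF polyfun_prod_pd[OF h] o s'(2)] normalizer_step2[OF Re]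
          by (simp add: sum_distrib_left algebra_simps)
      qed
      then have "integral {0..1} (\<lambda>u. R (a + u *\<^sub>R v) s) = integral {0..1} (\<lambda>u. normalizer (D - 1) s * (\<Sum>i\<in>UNIV. of_real (v $ i) *
          (zeta_series (pd i h) (a + u *\<^sub>R v) s - s * zeta_series (\<lambda>x. h x * pd i F x) (a + u *\<^sub>R v) (s + 1))))"
        by (rule integral_cong)
      also have "\<dots> = normalizer (D - 1) s * (zeta_series h (a + v) s - zeta_series h a s)"
        using zeta_series_ftc[OF h s a v] by simp
      finally have I: "integral {0..1} (\<lambda>u. R (a + u *\<^sub>R v) s) = normalizer (D - 1) s * (zeta_series h (a + v) s - zeta_series h a s)" .
      show ?thesis
        unfolding zeta_ext_eq[OF h a s] zeta_ext_eq[OF h orthant_add[OF a v] s] normalizer_step1[of D] I by (simp add: algebra_simps)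
    next
      case False
      then have "h = (\<lambda>_. 0)" using polyfun_neg[OF h] by simp
      then have "R (a + u *\<^sub>R v) s = 0" if u: "u \<in> {0..1}" for u
      proof -
        have o: "a + u *\<^sub>R v \<in> orthant" using u by (auto intro!: orthant_add[OF a] orthant_scaleR[OF v])
        show ?thesis
          unfolding R_def zeta_ext_eq[OF polyfun_pd[OF h] o s'(1)] zeta_ext_eq[OF polyfun_prod_pd[OF h] o s'(2)]
          using \<open>h = _\<close> by simp
      qed
      then have "integral {0..1} (\<lambda>u. R (a + u *\<^sub>R v) s) = integral {0..1} (\<lambda>u::real. 0)"
        by (rule integral_cong)
      then show ?thesis
        unfolding zeta_ext_eq[OF h a s] zeta_ext_eq[OF h orthant_add[OF a v] s] using \<open>h = _\<close> by simp
    qed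
  qed
  then show ?thesis by (simp add: R_def)
qed

text \<open>Integrating along the segment from 0 to \<open>a\<close> costs one degree, while the
  terms inside have a form closer to 0 by one. The induction generalises over \<open>s\<close> as
  well, because the second kind of term lives at s + 1.\<close>

lemma zeta_ext_polyfun:
  "polyfun D h \<Longrightarrow> pole_form D s = - of_nat M \<Longrightarrow> \<exists>Q. polyfun (int M) Q \<and> (\<forall>a\<in>orthant. zeta_ext D h a s = Q a)"
proof (induction M arbitrary: D h s)
  case 0
  have const: "zeta_ext D h a s = zeta_ext D h 0 s" if "a \<in> orthant" for a
    using zeta_ext_ftc[OF 0(1) orthant_zero that, of s] 0(2) by simp
  show ?case
    by (intro exI[of _ "\<lambda>_. zeta_ext D h 0 s"] conjI ballI polyfun_const const) auto
next
  case (Suc M)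
  have l: "pole_form (D - 1) s = - of_nat M" "pole_form (D + int d - 1) (s + 1) = - of_nat M"
    unfolding pole_form_step(2)[of D s] pole_form_step(1)[of D s] using Suc.prems(2) by simp_all
  have "\<forall>i. \<exists>Q. polyfun (int M) Q \<and> (\<forall>a\<in>orthant. zeta_ext (D - 1) (pd i h) a s = Q a)"
    by (intro allI Suc.IH[OF polyfun_pd[OF Suc.prems(1)] l(1)])
  from choice[OF this]
  obtain Q1 where Q1: "\<And>i. polyfun (int M) (Q1 i)" "\<And>i a. a \<in> orthant \<Longrightarrow> zeta_ext (D - 1) (pd i h) a s = Q1 i a"
    by blast
  have "\<forall>i. \<exists>Q. polyfun (int M) Q \<and> (\<forall>a\<in>orthant. zeta_ext (D + int d - 1) (\<lambda>x. h x * pd i F x) a (s + 1) = Q a)"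
    by (intro allI Suc.IH[OF polyfun_prod_pd[OF Suc.prems(1)] l(2)])
  from choice[OF this]
  obtain Q2 where Q2: "\<And>i. polyfun (int M) (Q2 i)" "\<And>i a. a \<in> orthant \<Longrightarrow> zeta_ext (D + int d - 1) (\<lambda>x. h x * pd i F x) a (s + 1) = Q2 i a"
    by blast
  define q where "q = (\<lambda>i a. Q1 i a + (-1) * Q2 i a)"
  have q: "polyfun (int M) (q i)" for i
    unfolding q_def by (intro polyfun_add polyfun_cmult Q1 Q2)
  define I where "I = (\<lambda>i a. integral (cbox 0 1) (\<lambda>u::real. of_real 1 * q i (u *\<^sub>R a + 0)))"
  have I: "polyfun (int M) (I i)" for i
    unfolding I_def by (intro polyfun_integral_affine q continuous_intros)
  define Q where "Q = (\<lambda>a. zeta_ext D h 0 s + pole_form D s * (\<Sum>i\<in>UNIV. of_real (a $ i) * I i a))"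
  have "polyfun (int (Suc M)) (\<lambda>a. of_real (a $ i) * I i a)" for i
    using polyfun_mult[OF polyfun_coord I] by (simp add: add.commute)
  then have "polyfun (int (Suc M)) Q"
    unfolding Q_def by (intro polyfun_add polyfun_const polyfun_cmult polyfun_sum) auto
  moreover have "zeta_ext D h a s = Q a" if a: "a \<in> orthant" for a
  proof -
    have "integral {0..1} (\<lambda>u. \<Sum>i\<in>UNIV. of_real (a $ i) *
       (zeta_ext (D - 1) (pd i h) (0 + u *\<^sub>R a) s - zeta_ext (D + int d - 1) (\<lambda>x. h x * pd i F x) (0 + u *\<^sub>R a) (s + 1))) =
       integral {0..1} (\<lambda>u. \<Sum>i\<in>UNIV. of_real (a $ i) * q i (u *\<^sub>R a + 0))"
      by (intro integral_cong) (simp add: q_def Q1(2) Q2(2) orthant_scaleR[OF a])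
    also have "\<dots> = (\<Sum>i\<in>UNIV. of_real (a $ i) * I i a)"
    proof (rule integral_unique, intro has_integral_sum has_integral_mult_right)
      fix i
      have "continuous_on {0..1} (\<lambda>u. q i (u *\<^sub>R a + 0))"
        by (rule continuous_on_compose2[OF continuous_on_polyfun[OF q[of i], of UNIV]]) (auto intro!: continuous_intros)
      then show "((\<lambda>u. q i (u *\<^sub>R a + 0)) has_integral I i a) {0..1}"
        using integrable_continuous_interval integrable_integral by (simp add: I_def) blast
    qed auto
    finally show ?thesis
      using zeta_ext_ftc[OF Suc.prems(1) orthant_zero a, of s] by (simp add: Q_def)
  qed
  ultimately show ?case by blast
qed

section \<open>Values of the continuations\<close>

text \<open>The factor \<open>\<gamma>\<close> is the reciprocal of the normaliser with its
  removable singularities filled in. Outside the possible poles either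
  \<open>rGamma (pole_form D s)\<close> is nonzero, or s is a non-positive integer and both
  reciprocal Gamma functions have a simple zero. It depends on neither \<open>E\<close> nor
  \<open>Fn\<close>, so all shifts of Z and zeta share it.\<close>

lemma mero_cont_value:
  obtains \<gamma> :: "complex \<Rightarrow> complex" where
    "\<And>E Fn s. E holomorphic_on UNIV \<Longrightarrow> (\<And>z. z \<in> half_plane 0 (int (total_deg g)) \<Longrightarrow> E z = normalizer (int (total_deg g)) z * Fn z) \<Longrightarrow>
      s \<notin> possible_poles f g \<Longrightarrow> mero_cont (abscissa f g) Fn s = \<gamma> s * E s"
proof -
  define D where "D = int (total_deg g)"
  define \<phi> where "\<phi> = (\<lambda>z. rGamma z / rGamma (pole_form D z))"
  have pole_form_deriv: "(pole_form D has_field_derivative of_nat d) (at z)" for z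
    unfolding pole_form_def[abs_def] by (auto intro!: derivative_eq_intros)
  have pole_iff: "s \<in> possible_poles f g \<longleftrightarrow> pole_form D s \<in> \<int>\<^sub>\<le>\<^sub>0 \<and> s \<notin> \<int>\<^sub>\<le>\<^sub>0" for s
  proof -
    have "s = of_real ((real (total_deg g) + real CARD('n) - real l) / real d) \<longleftrightarrow> pole_form D s = - of_nat l" for l
      using d_pos by (auto simp: pole_form_def D_def field_simps add_eq_0_iff2)
    then show ?thesis
      unfolding possible_poles_def by (auto elim!: nonpos_Ints_cases')
  qed
  have lim: "\<exists>L. (\<phi> \<longlongrightarrow> L) (at s)" if s: "s \<notin> possible_poles f g" for s
  proof (cases "pole_form D s \<in> \<int>\<^sub>\<le>\<^sub>0")
    case False
    have "isCont \<phi> s"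
      unfolding \<phi>_def using False pole_form_deriv[of s, THEN DERIV_isCont]
      by (intro continuous_intros) (auto simp: rGamma_eq_zero_iff intro!: isCont_o2[of s "pole_form D" rGamma] continuous_intros)
    then show ?thesis by (auto simp: isCont_def)
  next
    case True
    with s have "s \<in> \<int>\<^sub>\<le>\<^sub>0" by (simp add: pole_iff)
    then obtain N where N: "s = - of_nat N" by (elim nonpos_Ints_cases')
    obtain M where M: "pole_form D s = - of_nat M" using True by (elim nonpos_Ints_cases')
    have num: "(rGamma has_field_derivative (-1) ^ N * fact N) (at s)"
      unfolding N by (rule has_field_derivative_rGamma_nonpos_int)
    have "(rGamma has_field_derivative (-1) ^ M * fact M) (at (pole_form D s))"
      unfolding M by (rule has_field_derivative_rGamma_nonpos_int)
    then have den: "((\<lambda>z. rGamma (pole_form D z)) has_field_derivative ((-1) ^ M * fact M) * of_nat d) (at s)"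
      by (rule DERIV_chain2[OF _ pole_form_deriv])
    have "rGamma s = 0" "rGamma (pole_form D s) = 0" "((-1) ^ M * fact M) * of_nat d \<noteq> (0 :: complex)"
      using \<open>s \<in> \<int>\<^sub>\<le>\<^sub>0\<close> True d_pos by (simp_all add: rGamma_eq_zero_iff)
    from tendsto_divide_common_zero[OF num this(1) den this(2,3)]
    show ?thesis unfolding \<phi>_def by blast
  qed
  show ?thesis
  proof (rule that[of "remove_sings \<phi>"])
    fix E Fn s
    assume E: "E holomorphic_on UNIV"
      and eq: "\<And>z. z \<in> half_plane 0 (int (total_deg g)) \<Longrightarrow> E z = normalizer (int (total_deg g)) z * Fn z"
      and s: "s \<notin> possible_poles f g"
    have anE: "E analytic_on UNIV" using E by (simp add: analytic_on_open)
    have anl: "(\<lambda>z. rGamma (pole_form D z)) analytic_on UNIV"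
      by (simp add: analytic_on_open holomorphic_rGamma' pole_form_holomorphic)
    define h where "h = (\<lambda>z. E z * \<phi> z)"
    have "h meromorphic_on UNIV"
      unfolding h_def \<phi>_def
      by (intro meromorphic_intros analytic_on_imp_meromorphic_on anE anl analytic_rGamma)
    then have nice: "remove_sings h nicely_meromorphic_on UNIV" by (rule remove_sings_nicely_meromorphic)
    have "mero_cont (abscissa f g) Fn = remove_sings h"
    proof (rule mero_cont_eqI[OF nice])
      fix z assume "Re z > abscissa f g"
      then have z: "z \<in> half_plane 0 D" using d_pos by (simp add: abscissa_def half_plane_def D_def pos_divide_less_eq)
      then have Re: "Re z > 0" by (rule half_plane_0_Re_pos) (simp add: D_def)
      have Rel: "Re (pole_form D z) > 0" using z by (simp add: pole_form_def half_plane_def mult.commute)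
      have nz: "rGamma z \<noteq> 0" "rGamma (pole_form D z) \<noteq> 0"
        using Re Rel by (auto simp: rGamma_eq_zero_iff elim!: nonpos_Ints_cases)
      have "isCont h z"
        unfolding h_def \<phi>_def using nz
        by (intro continuous_intros analytic_at_imp_isCont analytic_on_subset[OF anE] analytic_on_subset[OF anl]) (auto intro!: continuous_intros)
      then have "remove_sings h z = h z" by (intro remove_sings_eqI) (simp add: isCont_def)
      also have "h z = E z * (rGamma z / rGamma (pole_form D z))" by (simp add: h_def \<phi>_def)
      also have "\<dots> = Fn z"
        using eq[of z] z nz by (simp add: D_def[symmetric] normalizer_def Gamma_def)
      finally show "remove_sings h z = Fn z" .
    qed
    \<comment> \<open>\<open>remove_sings\<close> returns the limit; E is continuous, so the limit
      of the product factors.\<close>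
    moreover have "remove_sings h s = remove_sings \<phi> s * E s"
    proof -
      obtain L where L: "(\<phi> \<longlongrightarrow> L) (at s)" using lim[OF s] by blast
      have "(E \<longlongrightarrow> E s) (at s)"
        using analytic_at_imp_isCont[OF analytic_on_subset[OF anE, of "{s}"]] by (simp add: isCont_def)
      from tendsto_mult[OF this L] have "remove_sings h s = E s * L"
        unfolding h_def by (rule remove_sings_eqI)
      then show ?thesis using remove_sings_eqI[OF L] by simp
    qed
    ultimately show "mero_cont (abscissa f g) Fn s = remove_sings \<phi> s * E s" by simp
  qed
qed

text \<open>Shifting changes neither the abscissa nor the normaliser, so the shifted functions are
  governed by the same \<open>\<gamma>\<close>; the unshifted ones are the case a = 0.\<close>

lemma zeta_values:
  obtains \<gamma> :: "complex \<Rightarrow> complex" where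
    "\<And>a s. a \<in> orthant \<Longrightarrow> s \<notin> possible_poles f g \<Longrightarrow> Zint_shift f lf g a s = \<gamma> s * Z_ext (int (total_deg g)) (meval g) a s"
    "\<And>a s. a \<in> orthant \<Longrightarrow> s \<notin> possible_poles f g \<Longrightarrow> Zsum_shift f lf g a s = \<gamma> s * zeta_ext (int (total_deg g)) (meval g) a s"
    "\<And>s. s \<notin> possible_poles f g \<Longrightarrow> Zint f lf g s = \<gamma> s * Z_ext (int (total_deg g)) (meval g) 0 s"
    "\<And>s. s \<notin> possible_poles f g \<Longrightarrow> Zsum f lf g s = \<gamma> s * zeta_ext (int (total_deg g)) (meval g) 0 s"
proof -
  let ?D = "int (total_deg g)"
  note g = polyfun_meval[of g]
  obtain \<gamma> where \<gamma>: "\<And>E Fn s. E holomorphic_on UNIV \<Longrightarrow> (\<And>z. z \<in> half_plane 0 ?D \<Longrightarrow> E z = normalizer ?D z * Fn z) \<Longrightarrow>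
      s \<notin> possible_poles f g \<Longrightarrow> mero_cont (abscissa f g) Fn s = \<gamma> s * E s"
    using mero_cont_value[of g] by blast
  have abs: "abscissa (mshift a f) (mshift a g) = abscissa f g" for a by (simp add: abscissa_def)
  have Z: "mero_cont (abscissa f g) (Z_integral (meval g) a) s = \<gamma> s * Z_ext ?D (meval g) a s"
    if "a \<in> orthant" "s \<notin> possible_poles f g" for a s
    using hcont_Z_ext[OF g] Z_ext_eq[OF g] that by (intro \<gamma>) (auto simp: hcont_def)
  have S: "mero_cont (abscissa f g) (zeta_series (meval g) a) s = \<gamma> s * zeta_ext ?D (meval g) a s"
    if "a \<in> orthant" "s \<notin> possible_poles f g" for a s
    using hcont_zeta_ext[OF g] zeta_ext_eq[OF g] that by (intro \<gamma>) (auto simp: hcont_def)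
  have lattice_vec: "(\<chi> i. real (k $ i)) = lattice_vec k" for k :: "nat^'n" by (simp add: lattice_vec_def)
  show ?thesis
  proof (rule that[of \<gamma>])
    show "Zint_shift f lf g a s = \<gamma> s * Z_ext ?D (meval g) a s" if "a \<in> orthant" "s \<notin> possible_poles f g" for a s
      using Z[OF that] by (simp add: Zint_shift_def Zint_def abs meval_mshift Z_integral_def[abs_def] integrand_def)
    show "Zsum_shift f lf g a s = \<gamma> s * zeta_ext ?D (meval g) a s" if "a \<in> orthant" "s \<notin> possible_poles f g" for a s
      using S[OF that] by (simp add: Zsum_shift_def Zsum_def abs meval_mshift zeta_series_def[abs_def] integrand_def lattice_vec)
    show "Zint f lf g s = \<gamma> s * Z_ext ?D (meval g) 0 s" if "s \<notin> possible_poles f g" for s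
      using Z[OF orthant_zero that] by (simp add: Zint_def Z_integral_def[abs_def] integrand_def)
    show "Zsum f lf g s = \<gamma> s * zeta_ext ?D (meval g) 0 s" if "s \<notin> possible_poles f g" for s
      using S[OF orthant_zero that] by (simp add: Zsum_def zeta_series_def[abs_def] integrand_def lattice_vec)
  qed
qed

lemma zeta_ext_cube_cont:
  assumes "polyfun D h" "a \<in> orthant"
  shows "continuous_on (cbox 0 1) (\<lambda>t. zeta_ext D h (a + t) s)"
proof -
  have "continuous_on (cbox 0 1) (\<lambda>t. zeta_ext D h (fst (a + t, s)) (snd (a + t, s)))"
    by (rule continuous_on_compose2[OF hcont_continuous[OF hcont_zeta_ext[OF assms(1)]]])
       (auto intro!: continuous_intros orthant_add[OF assms(2) cbox01_orthant])
  then show ?thesis by simp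
qed

end

theorem proposition4:
  fixes f g :: "'n::finite mpoly" and lf :: "real^'n \<Rightarrow> complex"
  assumes "mahler f" and "log_branch f lf"
  shows
    "(\<forall>s. s \<notin> possible_poles f g \<longrightarrow>
        set_integrable lborel (cbox 0 1) (\<lambda>t. Zsum_shift f lf g t s) \<and>
        Zint f lf g s = (LINT t:cbox 0 1|lborel. Zsum_shift f lf g t s)) \<and>
     (\<forall>N::nat.
        (\<exists>P::'n mpoly. total_deg P \<le> N * total_deg f + total_deg g + CARD('n) \<and>
           (\<forall>a\<in>orthant. Zsum_shift f lf g a (- of_nat N) = meval P a)) \<and>
        (\<exists>P::'n mpoly. total_deg P \<le> N * total_deg f + total_deg g + CARD('n) \<and>
           (\<forall>a\<in>orthant. Zint_shift f lf g a (- of_nat N) = meval P a))) \<and>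
     (\<forall>N::nat. \<forall>c::'n mpoly.
        (\<forall>a\<in>orthant. Zint_shift f lf g a (- of_nat N) = meval c a) \<longrightarrow>
          Zsum f lf g (- of_nat N) =
            (\<Sum>L\<in>Poly_Mapping.keys c. Poly_Mapping.lookup c L * of_real (\<Prod>i\<in>UNIV. bernnum (Poly_Mapping.lookup L i))) \<and>
          (\<forall>a\<in>orthant. Zsum_shift f lf g a (- of_nat N) =
            (\<Sum>L\<in>Poly_Mapping.keys c. Poly_Mapping.lookup c L * of_real (\<Prod>i\<in>UNIV. poly (bernpoly (Poly_Mapping.lookup L i)) (a $ i)))))"
proof -
  interpret mahler_poly f lf by unfold_locales fact+
  let ?D = "int (total_deg g)"
  note g = polyfun_meval[of g]
  obtain \<gamma> where Zi: "\<And>a s. a \<in> orthant \<Longrightarrow> s \<notin> possible_poles f g \<Longrightarrow> Zint_shift f lf g a s = \<gamma> s * Z_ext ?D (meval g) a s"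
    and Zs: "\<And>a s. a \<in> orthant \<Longrightarrow> s \<notin> possible_poles f g \<Longrightarrow> Zsum_shift f lf g a s = \<gamma> s * zeta_ext ?D (meval g) a s"
    and Zi0: "\<And>s. s \<notin> possible_poles f g \<Longrightarrow> Zint f lf g s = \<gamma> s * Z_ext ?D (meval g) 0 s"
    and Zs0: "\<And>s. s \<notin> possible_poles f g \<Longrightarrow> Zsum f lf g s = \<gamma> s * zeta_ext ?D (meval g) 0 s"
    using zeta_values[of g] by blast
  have reg: "- of_nat N \<notin> possible_poles f g" for N by (simp add: possible_poles_def)
  have average: "Zint_shift f lf g a s = integral (cbox 0 1) (\<lambda>t. Zsum_shift f lf g (a + t) s)"
    if a: "a \<in> orthant" and s: "s \<notin> possible_poles f g" for a s
  proof -
    have "integral (cbox 0 1) (\<lambda>t. Zsum_shift f lf g (a + t) s) = integral (cbox 0 1) (\<lambda>t. \<gamma> s * zeta_ext ?D (meval g) (a + t) s)"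
      by (intro integral_cong Zs orthant_add[OF a cbox01_orthant] s)
    then show ?thesis by (simp add: Zi[OF a s] raabe[OF g a])
  qed
  have part1: "set_integrable lborel (cbox 0 1) (\<lambda>t. Zsum_shift f lf g t s) \<and>
        Zint f lf g s = (LINT t:cbox 0 1|lborel. Zsum_shift f lf g t s)" if s: "s \<notin> possible_poles f g" for s
  proof -
    have "continuous_on (cbox 0 1) (\<lambda>t. \<gamma> s * zeta_ext ?D (meval g) (0 + t) s)"
      by (intro continuous_intros zeta_ext_cube_cont[OF g orthant_zero])
    then have "continuous_on (cbox 0 1) (\<lambda>t. Zsum_shift f lf g t s)"
      by (rule continuous_on_eq) (simp add: Zs[OF cbox01_orthant s])
    then have int: "set_integrable lborel (cbox 0 1) (\<lambda>t. Zsum_shift f lf g t s)"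
      unfolding set_integrable_def by (intro borel_integrable_compact compact_cbox)
    then have "(LINT t:cbox 0 1|lborel. Zsum_shift f lf g t s) = integral (cbox 0 1) (\<lambda>t. Zsum_shift f lf g t s)"
      by (rule set_borel_integral_eq_integral(2))
    then show ?thesis
      using int average[OF orthant_zero s] by (simp add: Zi0[OF s] Zi[OF orthant_zero s])
  qed
  have "\<exists>Q. polyfun (int (N * total_deg f + total_deg g + CARD('n))) Q \<and> (\<forall>a\<in>orthant. Zsum_shift f lf g a (- of_nat N) = Q a)" for N
  proof -
    have "pole_form ?D (- of_nat N) = - of_nat (N * total_deg f + total_deg g + CARD('n))"
      by (simp add: pole_form_def algebra_simps)
    from zeta_ext_polyfun[OF g this] obtain Q where Q: "polyfun (int (N * total_deg f + total_deg g + CARD('n))) Q"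
      "\<forall>a\<in>orthant. zeta_ext ?D (meval g) a (- of_nat N) = Q a" by blast
    then show ?thesis
      by (intro exI[of _ "\<lambda>a. \<gamma> (- of_nat N) * Q a"]) (simp add: polyfun_cmult Zs[OF _ reg])
  qed
  then obtain Q where Q: "\<And>N. polyfun (int (N * total_deg f + total_deg g + CARD('n))) (Q N)"
    "\<And>N a. a \<in> orthant \<Longrightarrow> Zsum_shift f lf g a (- of_nat N) = Q N a"
    by metis
  \<comment> \<open>The cube average of the polynomial for zeta; by Raabe's formula it is the
    polynomial for Z, with the same degree bound.\<close>
  define R where "R = (\<lambda>N a. integral (cbox 0 1) (\<lambda>t. of_real 1 * Q N (1 *\<^sub>R a + t)))"
  have R: "polyfun (int (N * total_deg f + total_deg g + CARD('n))) (R N)" for N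
    unfolding R_def by (intro polyfun_integral_affine Q(1) continuous_intros)
  have ZR: "Zint_shift f lf g a (- of_nat N) = R N a" if a: "a \<in> orthant" for N a
    unfolding average[OF a reg] R_def
    by (intro integral_cong) (simp add: Q(2) orthant_add[OF a cbox01_orthant])
  have part2: "(\<exists>P::'n mpoly. total_deg P \<le> N * total_deg f + total_deg g + CARD('n) \<and>
           (\<forall>a\<in>orthant. Zsum_shift f lf g a (- of_nat N) = meval P a)) \<and>
        (\<exists>P::'n mpoly. total_deg P \<le> N * total_deg f + total_deg g + CARD('n) \<and>
           (\<forall>a\<in>orthant. Zint_shift f lf g a (- of_nat N) = meval P a))" for N
    using polyfun_imp_meval[OF Q(1)[of N]] polyfun_imp_meval[OF R[of N]] Q(2) ZR by metis
  have part3: "Zsum_shift f lf g a (- of_nat N) =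
      (\<Sum>L\<in>Poly_Mapping.keys c. Poly_Mapping.lookup c L * of_real (\<Prod>i\<in>UNIV. poly (bernpoly (Poly_Mapping.lookup L i)) (a $ i)))"
    if c: "\<forall>a\<in>orthant. Zint_shift f lf g a (- of_nat N) = meval c a" and a: "a \<in> orthant" for N and c :: "'n mpoly" and a
  proof -
    define B where "B = (\<lambda>L (a::real^'n). complex_of_real (\<Prod>i\<in>UNIV. poly (bernpoly (Poly_Mapping.lookup L i)) (a $ i)))"
    \<comment> \<open>The candidate for zeta: every monomial of \<open>c\<close> replaced by the
      corresponding product of Bernoulli polynomials.\<close>
    define T where "T = (\<lambda>a. \<Sum>L\<in>Poly_Mapping.keys c. Poly_Mapping.lookup c L * B L a)"
    have B: "polyfun (\<Sum>i\<in>UNIV. int (degree (bernpoly (Poly_Mapping.lookup L i)))) (B L)" for L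
      unfolding B_def of_real_prod by (intro polyfun_prod polyfun_poly)
    have "\<exists>K. polyfun K T"
    proof -
      define K where "K = (\<Sum>L\<in>Poly_Mapping.keys c. \<Sum>i\<in>UNIV. int (degree (bernpoly (Poly_Mapping.lookup L i))))"
      have "(\<Sum>i\<in>UNIV. int (degree (bernpoly (Poly_Mapping.lookup L i)))) \<le> K" if "L \<in> Poly_Mapping.keys c" for L
        unfolding K_def using that by (intro member_le_sum) (auto intro: sum_nonneg)
      then have "polyfun K T"
        unfolding T_def by (intro polyfun_sum polyfun_cmult polyfun_mono[OF B])
      then show ?thesis by blast
    qed
    then obtain K where T: "polyfun K T" by blast
    \<comment> \<open>A common degree bound for Q and T; its size is irrelevant, since injectivity
      of averaging holds for every bound.\<close>
    define J where "J = max K (int (N * total_deg f + total_deg g + CARD('n)))"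
    define W where "W = (\<lambda>a. Q N a + (-1) * T a)"
    have "polyfun J W"
      unfolding W_def J_def by (intro polyfun_add polyfun_cmult polyfun_mono[OF T] polyfun_mono[OF Q(1)]) auto
    \<comment> \<open>Q averages to Z by Raabe's formula and T averages to \<open>meval c\<close> by
      the Bernoulli average; by hypothesis these agree on the orthant.\<close>
    moreover have "integral (cbox 0 1) (\<lambda>t. W (b + t)) = 0" if b: "b \<in> orthant" for b
    proof -
      have cont: "continuous_on (cbox 0 1) (\<lambda>t. h (b + t))" if "polyfun D h" for D and h :: "real^'n \<Rightarrow> complex"
        by (rule continuous_on_compose2[OF continuous_on_polyfun[OF that, of UNIV]]) (auto intro!: continuous_intros)
      have iQ: "((\<lambda>t. Q N (b + t)) has_integral meval c b) (cbox 0 1)"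
        using integrable_integral[OF integrable_continuous[OF cont[OF Q(1)[of N]]]] ZR[OF b, of N] c b
        by (simp add: R_def)
      have iB: "((\<lambda>t. B L (b + t)) has_integral mon L b) (cbox 0 1)" for L
        using integrable_integral[OF integrable_continuous[OF cont[OF B[of L]]]] bernpoly_cube_average[of L b]
        by (simp add: B_def)
      have "((\<lambda>t. T (b + t)) has_integral (\<Sum>L\<in>Poly_Mapping.keys c. Poly_Mapping.lookup c L * mon L b)) (cbox 0 1)"
        unfolding T_def by (intro has_integral_sum has_integral_mult_right iB) auto
      from has_integral_add[OF iQ has_integral_mult_right[OF this, of "-1"]]
      have "((\<lambda>t. W (b + t)) has_integral 0) (cbox 0 1)"
        by (simp add: W_def meval_mon)
      then show ?thesis by (rule integral_unique)
    qed
    ultimately have "W a = 0" by (rule cube_average_injective[OF _ _ a])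
    then show ?thesis by (simp add: W_def T_def B_def Q(2)[OF a])
  qed
  have part3': "Zsum f lf g (- of_nat N) =
      (\<Sum>L\<in>Poly_Mapping.keys c. Poly_Mapping.lookup c L * of_real (\<Prod>i\<in>UNIV. bernnum (Poly_Mapping.lookup L i)))"
    if c: "\<forall>a\<in>orthant. Zint_shift f lf g a (- of_nat N) = meval c a" for N and c :: "'n mpoly"
    using part3[OF c orthant_zero] by (simp add: Zs0[OF reg] Zs[OF orthant_zero reg] bernnum_def)
  show ?thesis
    using part1 part2 part3 part3' by blast
qed

end
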